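(* Up to the change of $\zeta$ into $\zeta^{-1}$, Malle's $\mathbb{Z}$-fusion datum $(\mathbb{S},\mathbb{T})$ can be categorified by the monoidal category $D(B)\text{-stab}_B$, endowed with the pivotal structure induced by the pivot $z^{-1}K$ and the balanced structure induced by $z\theta$.
   Context: Fix an integer $d\ge 2$ and a primitive $d$-th root of unity $\zeta\in\mathbb{C}$. Notation: $(n)_\xi=1+\xi+\cdots+\xi^{n-1}$, $(n)!_\xi=\prod_{i=1}^n(i)_\xi$, $(0)!_\xi=1$. Modules are finite-dimensional left modules. **The algebra.** $D(B)$ (the Drinfeld double of the Taft algebra $B$) is the $\mathbb{C}$-algebra with generators $E,F,K,z$ and relations $K^d=z^d=1$, $E^d=F^d=0$, $z$ central, $KE=\zeta EK$, $KF=\zeta^{-1}FK$, $[E,F]=K-zK^{-1}$. It is a Hopf algebra with $\Delta(K)=K\otimes K$, $\Delta(z)=z\otimes z$, $\Delta(E)=1\otimes E+E\otimes K$, $\Delta(F)=F\otimes 1+zK^{-1}\otimes F$, $\varepsilon(K)=\varepsilon(z)=1$, $\varepsilon(E)=\varepsilon(F)=0$, $S(K)=K^{-1}$, $S(z)=z^{-1}$, $S(E)=-EK^{-1}$, $S(F)=-\zeta^{-1}FKz^{-1}$. $B$ is the Hopf subalgebra generated by $E,K$. Set $\beta_{i,j}=\frac1d\sum_{k=0}^{d-1}\frac{\zeta^{(i-k)(i+j)-i(i+1)/2}}{(i)!_\zeta}z^{-k}F^iK^k$ for $0\le i,j\le d-1$. Then $R=\sum_{i,j=0}^{d-1}E^iK^j\otimes\beta_{i,j}$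 is a universal $R$-matrix. Let $\tau(a\otimes b)=b\otimes a$. The braiding on $D(B)\text{-mod}$ is $c_{M,N}(m\otimes n)=\tau(R)(n\otimes m)$. Put $u=\sum_{i,j=0}^{d-1}S(\beta_{i,j})E^iK^j$ and $\theta=K^{-1}u$ (a central invertible element). With the pivot $z^{-1}K$, for $f\in\mathrm{End}_{D(B)}(M)$ one has $\mathrm{Tr}_+(f)=\mathrm{trace}(z^{-1}Kf)$ and $\mathrm{Tr}_-(f)=\mathrm{trace}(fK^{-1}z)$ (ordinary traces), and $\dim_\pm(M)=\mathrm{Tr}_\pm(\mathrm{Id}_M)$. The balanced structure is given by $\theta_1=z\theta$. **The category.** $D(B)\text{-proj}_B$ is the full subcategory of $D(B)\text{-mod}$ whose objects are the $D(B)$-modules whose restriction to $B$ is projective. $D(B)\text{-stab}_B$ is the additive quotient of $D(B)\text{-mod}$ by $D(B)\text{-proj}_B$; it is also the quotient of the stable category $D(B)\text{-stab}$ (the additive quotient of $D(B)\text{-mod}$ by the projective modules, with its triangulated structure) by the image of $D(B)\text{-proj}_B$. It is a triangulated monoidal category. **Its fusion datum.** For $1\le l\le d$, $p\in\mathbb{Z}/d\mathbb{Z}$, $M_{l,p}$ is the simple $D(B)$-module with basis $e_1,\dots,e_l$, $z=\zeta^{2p+l-1}\mathrm{Id}$, $Ke_i=\zeta^{p+l-i}e_i$, $Fe_i=e_{i+1}$ ($Fe_l=0$), $Ee_1=0$, $Ee_{i+1}=\zeta^p(i)_\zeta(\zeta^{l-i}-1)e_i$; these are all the simple modules, without repetition.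 Let $\Lambda^\#(d)=\{1,\dots,d-1\}\times\mathbb{Z}/d\mathbb{Z}$ (the first coordinate being viewed as a nonzero class mod $d$) with the involution $\iota(l,p)=(-l,p+l)$, and let $\mathcal{E}$ be a set of representatives of $\iota$-orbits in $\Lambda^\#(d)$. Put $\dim^{\mathrm{st}_B}(D(B))=\sum_{\lambda\in\mathcal{E}}\dim_-(M_\lambda)\dim_+(M_\lambda)=\frac{d^2}{(1-\zeta)(1-\zeta^{-1})}>0$, with positive square root $\sqrt{\dim^{\mathrm{st}_B}(D(B))}$. For $\lambda,\lambda'\in\mathcal{E}$ set $\mathbb{S}^{\mathrm{st}_B}_{\lambda,\lambda'}=\mathrm{Tr}_+(c_{M_{\lambda'},M_\lambda}\circ c_{M_\lambda,M_{\lambda'}})/\sqrt{\dim^{\mathrm{st}_B}(D(B))}$, and let $\mathbb{T}^{\mathrm{st}_B}$ be the diagonal matrix whose $\lambda$-entry is the scalar by which $\theta_1^{-1}$ acts on $M_\lambda$. The pair $(\mathbb{S}^{\mathrm{st}_B},\mathbb{T}^{\mathrm{st}_B})$ is the fusion datum associated with $D(B)\text{-stab}_B$. **Malle's datum.** Let $Y=\{0,1,\dots,d\}$, and let $\pi:Y\to\{0,1\}$ be $1$ on $\{0,1\}$ and $0$ on $\{2,\dots,d\}$. Let $\Psi(Y,\pi)$ be the set of maps $f:Y\to\{0,\dots,d-1\}$ strictly increasing on $\{0,1\}$ and on $\{2,\dots,d\}$, and $\Psi^\#(Y,\pi)=\{f\in\Psi(Y,\pi):\sum_{y\in Y}f(y)\equiv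 d(d-1)/2 \bmod d\}$. Put $\varepsilon(f)=(-1)^{|\{(y,y')\in Y\times Y:\ y<y',\ f(y)<f(y')\}|}$. Let $V=\bigoplus_{i=0}^{d-1}\mathbb{C}v_i$, let $\mathcal{S}=(\zeta^{ij})_{0\le i,j\le d-1}$ be viewed as an automorphism of $V$, and $\delta(d)=\det(\mathcal{S})=\prod_{0\le i<j\le d-1}(\zeta^j-\zeta^i)$. Let $(\mathbf{S}_{f,f'})$ be the matrix of $\bigwedge^2\mathcal{S}\otimes\bigwedge^{d-1}\mathcal{S}$ in the basis $\mathbf{v}_f=(v_{f(0)}\wedge v_{f(1)})\otimes(v_{f(2)}\wedge\cdots\wedge v_{f(d)})$, $f\in\Psi(Y,\pi)$, of $\bigwedge^2V\otimes\bigwedge^{d-1}V$. For $f,g\in\Psi^\#(Y,\pi)$ put $\mathbb{S}_{f,g}=\frac{(-1)^{d-1}}{\delta(d)}\varepsilon(f)\varepsilon(g)\overline{\mathbf{S}_{f,g}}$, and let $\mathbb{T}$ be the diagonal matrix with entries $\mathbb{T}_f=\zeta_*^{d(1-d^2)}\prod_{y\in Y}\zeta_*^{-6(f(y)^2+df(y))}$, where $\zeta_*$ is a primitive $(12d)$-th root of unity with $\zeta_*^{12}=\zeta$. The pair $(\mathbb{S},\mathbb{T})$ is Malle's $\mathbb{Z}$-fusion datum (its associated fusion ring has integer, possibly negative, structure constants). **Meaning of "categorified".** The fusion datum $(\mathbb{S}^{\mathrm{st}_B},\mathbb{T}^{\mathrm{st}_B})$ of the category recovers $(\mathbb{S},\mathbb{T})$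 after complex conjugation (the change of $\zeta$ into $\zeta^{-1}$), up to multiplying the $S$-matrix by a root of unity, for a suitable choice of $\mathcal{E}$ and a bijection between $\Psi^\#(Y,\pi)$ and $\mathcal{E}$. The bijection sends $f$, with $i=f(0)$, $j=f(1)$, to $(j-i,i)$ or to $\iota(j-i,i)$, according to whether $(-1)^k\varepsilon(f)$ is $1$ or $-1$, where $k\in\{0,\dots,d-1\}$ is the residue of $i+j$ mod $d$. *)

theory Defs
  imports Complex_Main "HOL-Library.FuncSet" "HOL-Combinatorics.Permutations"
    "Jordan_Normal_Form.Matrix" "Jordan_Normal_Form.Determinant"
begin

definition primitive_root_of_unity :: "nat \<Rightarrow> complex \<Rightarrow> bool" where
  "primitive_root_of_unity n x \<longleftrightarrow> n > 0 \<and> x ^ n = 1 \<and> (\<forall>k. 0 < k \<and> k < n \<longrightarrow> x ^ k \<noteq> 1)"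

definition root_of_unity :: "complex \<Rightarrow> bool" where
  "root_of_unity x \<longleftrightarrow> (\<exists>n>0. x ^ n = 1)"

definition qnum :: "complex \<Rightarrow> nat \<Rightarrow> complex" where
  "qnum \<xi> n = (\<Sum>i<n. \<xi> ^ i)"

definition qfact :: "complex \<Rightarrow> nat \<Rightarrow> complex" where
  "qfact \<xi> n = (\<Prod>i=1..n. qnum \<xi> i)"

definition mtrace :: "complex mat \<Rightarrow> complex" where
  "mtrace A = (\<Sum>i<dim_row A. A $$ (i, i))"

text \<open>Kronecker product: the basis vector of \<open>V \<otimes> W\<close> with index \<open>i * dim W + j\<close> is \<open>v\<^sub>i \<otimes> w\<^sub>j\<close>.\<close>

definition kron :: "complex mat \<Rightarrow> complex mat \<Rightarrow> complex mat" where
  "kron A B = mat (dim_row A * dim_row B) (dim_col A * dim_col B)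
     (\<lambda>(r, s). A $$ (r div dim_row B, s div dim_col B) * B $$ (r mod dim_row B, s mod dim_col B))"

text \<open>Matrix of \<open>v \<otimes> w \<mapsto> w \<otimes> v\<close> from \<open>V \<otimes> W\<close> to \<open>W \<otimes> V\<close>, with \<open>m = dim V\<close> and \<open>n = dim W\<close>.\<close>

definition flip_mat :: "nat \<Rightarrow> nat \<Rightarrow> complex mat" where
  "flip_mat m n = mat (n * m) (m * n)
     (\<lambda>(r, s). if r div m = s mod n \<and> r mod m = s div n then 1 else 0)"


section \<open>The Drinfeld double of the Taft algebra and its modules\<close>

text \<open>A finite-dimensional module is given, in a basis, by the matrices of the generators.
  A \<open>D(B)\<close>-module extends a \<open>B\<close>-module by the actions of \<open>F\<close> and \<open>z\<close>, so that predicates on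
  \<open>'r b_rep_scheme\<close> apply to the restriction of a \<open>D(B)\<close>-module to \<open>B\<close>.\<close>

record b_rep =
  rdim :: nat
  actE :: "complex mat"
  actK :: "complex mat"

record db_rep = b_rep +
  actF :: "complex mat"
  actz :: "complex mat"

definition b_module :: "nat \<Rightarrow> complex \<Rightarrow> 'r b_rep_scheme \<Rightarrow> bool" where
  "b_module d \<zeta> X \<longleftrightarrow> (let n = rdim X; E = actE X; K = actK X in
     E \<in> carrier_mat n n \<and> K \<in> carrier_mat n n \<and>
     K ^\<^sub>m d = 1\<^sub>m n \<and> E ^\<^sub>m d = 0\<^sub>m n n \<and> K * E = \<zeta> \<cdot>\<^sub>m (E * K))"

text \<open>Since \<open>K\<^sup>d = z\<^sup>d = 1\<close>, inverses of \<open>K\<close> and \<open>z\<close> are written as \<open>(d - 1)\<close>-st powers.\<close>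

definition db_module :: "nat \<Rightarrow> complex \<Rightarrow> db_rep \<Rightarrow> bool" where
  "db_module d \<zeta> M \<longleftrightarrow> (let n = rdim M; E = actE M; F = actF M; K = actK M; Z = actz M in
     E \<in> carrier_mat n n \<and> F \<in> carrier_mat n n \<and> K \<in> carrier_mat n n \<and> Z \<in> carrier_mat n n \<and>
     K ^\<^sub>m d = 1\<^sub>m n \<and> Z ^\<^sub>m d = 1\<^sub>m n \<and> E ^\<^sub>m d = 0\<^sub>m n n \<and> F ^\<^sub>m d = 0\<^sub>m n n \<and>
     Z * E = E * Z \<and> Z * F = F * Z \<and> Z * K = K * Z \<and>
     K * E = \<zeta> \<cdot>\<^sub>m (E * K) \<and> K * F = inverse \<zeta> \<cdot>\<^sub>m (F * K) \<and>
     E * F - F * E = K - Z * K ^\<^sub>m (d - 1))"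

definition b_hom :: "'r b_rep_scheme \<Rightarrow> 's b_rep_scheme \<Rightarrow> complex mat set" where
  "b_hom X Y = {f \<in> carrier_mat (rdim Y) (rdim X). f * actE X = actE Y * f \<and> f * actK X = actK Y * f}"

definition db_hom :: "db_rep \<Rightarrow> db_rep \<Rightarrow> complex mat set" where
  "db_hom M N = {f \<in> carrier_mat (rdim N) (rdim M).
     f * actE M = actE N * f \<and> f * actF M = actF N * f \<and>
     f * actK M = actK N * f \<and> f * actz M = actz N * f}"

definition mat_surj :: "complex mat \<Rightarrow> bool" where
  "mat_surj f \<longleftrightarrow> (\<lambda>v. f *\<^sub>v v) ` carrier_vec (dim_col f) = carrier_vec (dim_row f)"

definition b_projective :: "nat \<Rightarrow> complex \<Rightarrow> 'r b_rep_scheme \<Rightarrow> bool" where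
  "b_projective d \<zeta> P \<longleftrightarrow> b_module d \<zeta> P \<and>
     (\<forall>(X :: b_rep) (Y :: b_rep) g h. b_module d \<zeta> X \<and> b_module d \<zeta> Y \<and> g \<in> b_hom X Y \<and> mat_surj g \<and> h \<in> b_hom P Y
        \<longrightarrow> (\<exists>h'\<in>b_hom P X. g * h' = h))"

definition db_proj_B :: "nat \<Rightarrow> complex \<Rightarrow> db_rep set" where
  "db_proj_B d \<zeta> = {P. db_module d \<zeta> P \<and> b_projective d \<zeta> P}"

text \<open>Elements of \<open>D(B)\<close> are represented by formal linear combinations of words in the
  generators; they are only ever used through their action on modules.\<close>

datatype db_gen = gE | gF | gK | gz

type_synonym db_elt = "(complex \<times> db_gen list) list"

fun gen_mat :: "db_rep \<Rightarrow> db_gen \<Rightarrow> complex mat" where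
  "gen_mat M gE = actE M"
| "gen_mat M gF = actF M"
| "gen_mat M gK = actK M"
| "gen_mat M gz = actz M"

definition word_mat :: "db_rep \<Rightarrow> db_gen list \<Rightarrow> complex mat" where
  "word_mat M w = foldr (\<lambda>g A. gen_mat M g * A) w (1\<^sub>m (rdim M))"

definition act :: "db_rep \<Rightarrow> db_elt \<Rightarrow> complex mat" where
  "act M x = mat (rdim M) (rdim M) (\<lambda>(r, s). \<Sum>(c, w)\<leftarrow>x. c * word_mat M w $$ (r, s))"

definition elt_mult :: "db_elt \<Rightarrow> db_elt \<Rightarrow> db_elt" where
  "elt_mult x y = map (\<lambda>((a, v), (b, w)). (a * b, v @ w)) (List.product x y)"

text \<open>The power \<open>g\<^sup>n\<close> for \<open>n \<in> \<int>\<close>, where \<open>g\<close> is \<open>K\<close> or \<open>z\<close>.\<close>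

definition gpow :: "nat \<Rightarrow> db_gen \<Rightarrow> int \<Rightarrow> db_gen list" where
  "gpow d g n = replicate (nat (n mod int d)) g"

fun antipode_gen :: "nat \<Rightarrow> complex \<Rightarrow> db_gen \<Rightarrow> complex \<times> db_gen list" where
  "antipode_gen d \<zeta> gK = (1, gpow d gK (-1))"
| "antipode_gen d \<zeta> gz = (1, gpow d gz (-1))"
| "antipode_gen d \<zeta> gE = (-1, gE # gpow d gK (-1))"
| "antipode_gen d \<zeta> gF = (- inverse \<zeta>, gF # gK # gpow d gz (-1))"

text \<open>The antipode, extended to words as an algebra antihomomorphism.\<close>

definition antipode :: "nat \<Rightarrow> complex \<Rightarrow> db_elt \<Rightarrow> db_elt" where
  "antipode d \<zeta> x = map (\<lambda>(c, w). (c * (\<Prod>g\<leftarrow>w. fst (antipode_gen d \<zeta> g)),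
     concat (map (\<lambda>g. snd (antipode_gen d \<zeta> g)) (rev w)))) x"

text \<open>The coproduct enters through the action on tensor products:
  \<open>\<Delta>(E) = 1 \<otimes> E + E \<otimes> K\<close>, \<open>\<Delta>(F) = F \<otimes> 1 + zK\<^sup>-\<^sup>1 \<otimes> F\<close>, and \<open>K\<close>, \<open>z\<close> are group-like.\<close>

definition db_tensor :: "nat \<Rightarrow> db_rep \<Rightarrow> db_rep \<Rightarrow> db_rep" where
  "db_tensor d M N = \<lparr>
     rdim = rdim M * rdim N,
     actE = kron (1\<^sub>m (rdim M)) (actE N) + kron (actE M) (actK N),
     actK = kron (actK M) (actK N),
     actF = kron (actF M) (1\<^sub>m (rdim N)) + kron (actz M * actK M ^\<^sub>m (d - 1)) (actF N),
     actz = kron (actz M) (actz N)\<rparr>"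

text \<open>\<open>R = \<Sum> EK i j \<otimes> beta i j\<close>, the sum being over \<open>0 \<le> i, j < d\<close>.\<close>

definition EK :: "nat \<Rightarrow> nat \<Rightarrow> db_elt" where
  "EK i j = [(1, replicate i gE @ replicate j gK)]"

definition beta :: "nat \<Rightarrow> complex \<Rightarrow> nat \<Rightarrow> nat \<Rightarrow> db_elt" where
  "beta d \<zeta> i j = map (\<lambda>k.
     (1 / of_nat d *
        (\<zeta> powi ((int i - int k) * (int i + int j) - int (i * (i + 1) div 2)) / qfact \<zeta> i),
      gpow d gz (- int k) @ replicate i gF @ replicate k gK)) [0..<d]"

definition R_mat :: "nat \<Rightarrow> complex \<Rightarrow> db_rep \<Rightarrow> db_rep \<Rightarrow> complex mat" where
  "R_mat d \<zeta> M N = mat (rdim M * rdim N) (rdim M * rdim N)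
     (\<lambda>(r, s). \<Sum>i<d. \<Sum>j<d. kron (act M (EK i j)) (act N (beta d \<zeta> i j)) $$ (r, s))"

text \<open>Since \<open>\<tau>(R)(n \<otimes> m)\<close> is the flip of \<open>R(m \<otimes> n)\<close>, the braiding is \<open>R\<close> followed by the flip.\<close>

definition braiding :: "nat \<Rightarrow> complex \<Rightarrow> db_rep \<Rightarrow> db_rep \<Rightarrow> complex mat" where
  "braiding d \<zeta> M N = flip_mat (rdim M) (rdim N) * R_mat d \<zeta> M N"

definition u_elt :: "nat \<Rightarrow> complex \<Rightarrow> db_elt" where
  "u_elt d \<zeta> = concat (map (\<lambda>(i, j). elt_mult (antipode d \<zeta> (beta d \<zeta> i j)) (EK i j))
     (List.product [0..<d] [0..<d]))"

definition theta :: "nat \<Rightarrow> complex \<Rightarrow> db_elt" where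
  "theta d \<zeta> = elt_mult [(1, gpow d gK (-1))] (u_elt d \<zeta>)"

definition theta1 :: "nat \<Rightarrow> complex \<Rightarrow> db_elt" where
  "theta1 d \<zeta> = elt_mult [(1, [gz])] (theta d \<zeta>)"

definition theta1_inv_mat :: "nat \<Rightarrow> complex \<Rightarrow> db_rep \<Rightarrow> complex mat" where
  "theta1_inv_mat d \<zeta> M = (THE A. A \<in> carrier_mat (rdim M) (rdim M) \<and>
     inverts_mat A (act M (theta1 d \<zeta>)) \<and> inverts_mat (act M (theta1 d \<zeta>)) A)"

definition Tr_plus :: "nat \<Rightarrow> db_rep \<Rightarrow> complex mat \<Rightarrow> complex" where
  "Tr_plus d M f = mtrace (act M [(1, gpow d gz (-1) @ [gK])] * f)"

definition Tr_minus :: "nat \<Rightarrow> db_rep \<Rightarrow> complex mat \<Rightarrow> complex" where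
  "Tr_minus d M f = mtrace (f * act M [(1, gpow d gK (-1) @ [gz])])"

text \<open>\<open>M\<^bsub>l,p\<^esub>\<close>; the matrix index \<open>a < l\<close> stands for the basis vector \<open>e\<^bsub>a+1\<^esub>\<close>, and \<open>p\<close> for its class mod \<open>d\<close>.\<close>

definition simple_rep :: "complex \<Rightarrow> nat \<times> nat \<Rightarrow> db_rep" where
  "simple_rep \<zeta> = (\<lambda>(l, p). \<lparr>
     rdim = l,
     actE = mat l l (\<lambda>(r, s). if s = r + 1 then \<zeta> ^ p * qnum \<zeta> s * (\<zeta> ^ (l - s) - 1) else 0),
     actK = mat l l (\<lambda>(r, s). if r = s then \<zeta> ^ (p + l - (s + 1)) else 0),
     actF = mat l l (\<lambda>(r, s). if r = s + 1 then 1 else 0),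
     actz = \<zeta> ^ (2 * p + l - 1) \<cdot>\<^sub>m 1\<^sub>m l\<rparr>)"


section \<open>The category \<open>D(B)-stab\<^sub>B\<close> and its fusion datum\<close>

text \<open>The objects are the \<open>D(B)\<close>-modules; morphisms are taken modulo those factoring through an
  object of \<open>D(B)-proj\<^sub>B\<close>, and are represented as equivalence classes. The tensor product of
  objects, the braiding, the traces defined by the pivot and the twist are those induced from
  \<open>D(B)-mod\<close>.\<close>

definition factors_proj_B :: "nat \<Rightarrow> complex \<Rightarrow> db_rep \<Rightarrow> db_rep \<Rightarrow> complex mat \<Rightarrow> bool" where
  "factors_proj_B d \<zeta> M N f \<longleftrightarrow>
     (\<exists>P\<in>db_proj_B d \<zeta>. \<exists>a\<in>db_hom M P. \<exists>b\<in>db_hom P N. f = b * a)"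

definition stab_class :: "nat \<Rightarrow> complex \<Rightarrow> db_rep \<Rightarrow> db_rep \<Rightarrow> complex mat \<Rightarrow> complex mat set" where
  "stab_class d \<zeta> M N f = {g \<in> db_hom M N. factors_proj_B d \<zeta> M N (g - f)}"

text \<open>Composite of the class \<open>a\<close> of a morphism from \<open>L\<close> to \<open>M\<close> with the class \<open>b\<close> of a morphism
  from \<open>M\<close> to \<open>N\<close>.\<close>

definition stab_comp :: "nat \<Rightarrow> complex \<Rightarrow> db_rep \<Rightarrow> db_rep \<Rightarrow>
    complex mat set \<Rightarrow> complex mat set \<Rightarrow> complex mat set" where
  "stab_comp d \<zeta> L N b a = (\<Union>g\<in>b. \<Union>f\<in>a. stab_class d \<zeta> L N (g * f))"

definition stab_scalar :: "nat \<Rightarrow> complex \<Rightarrow> db_rep \<Rightarrow> complex \<Rightarrow> complex mat set" where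
  "stab_scalar d \<zeta> M t = stab_class d \<zeta> M M (t \<cdot>\<^sub>m 1\<^sub>m (rdim M))"

definition stab_braiding :: "nat \<Rightarrow> complex \<Rightarrow> db_rep \<Rightarrow> db_rep \<Rightarrow> complex mat set" where
  "stab_braiding d \<zeta> M N =
     stab_class d \<zeta> (db_tensor d M N) (db_tensor d N M) (braiding d \<zeta> M N)"

definition stab_twist_inv :: "nat \<Rightarrow> complex \<Rightarrow> db_rep \<Rightarrow> complex mat set" where
  "stab_twist_inv d \<zeta> M = stab_class d \<zeta> M M (theta1_inv_mat d \<zeta> M)"

text \<open>The common value of the trace on all representatives of the class.\<close>

definition stab_Tr_plus :: "nat \<Rightarrow> db_rep \<Rightarrow> complex mat set \<Rightarrow> complex" where
  "stab_Tr_plus d M a = the_elem (Tr_plus d M ` a)"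

definition stab_Tr_minus :: "nat \<Rightarrow> db_rep \<Rightarrow> complex mat set \<Rightarrow> complex" where
  "stab_Tr_minus d M a = the_elem (Tr_minus d M ` a)"

definition stab_dim_plus :: "nat \<Rightarrow> complex \<Rightarrow> db_rep \<Rightarrow> complex" where
  "stab_dim_plus d \<zeta> M = stab_Tr_plus d M (stab_scalar d \<zeta> M 1)"

definition stab_dim_minus :: "nat \<Rightarrow> complex \<Rightarrow> db_rep \<Rightarrow> complex" where
  "stab_dim_minus d \<zeta> M = stab_Tr_minus d M (stab_scalar d \<zeta> M 1)"

text \<open>Classes mod \<open>d\<close> are represented by their residues in \<open>{0..<d}\<close>.\<close>

definition Lambda_sharp :: "nat \<Rightarrow> (nat \<times> nat) set" where
  "Lambda_sharp d = {1..<d} \<times> {0..<d}"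

definition iota :: "nat \<Rightarrow> nat \<times> nat \<Rightarrow> nat \<times> nat" where
  "iota d = (\<lambda>(l, p). (d - l, (p + l) mod d))"

definition orbit_representatives :: "nat \<Rightarrow> (nat \<times> nat) set \<Rightarrow> bool" where
  "orbit_representatives d \<E> \<longleftrightarrow> \<E> \<subseteq> Lambda_sharp d \<and>
     (\<forall>\<kappa>\<in>Lambda_sharp d. \<exists>!\<mu>. \<mu> \<in> \<E> \<and> \<mu> \<in> {\<kappa>, iota d \<kappa>})"

definition stab_dim :: "nat \<Rightarrow> complex \<Rightarrow> (nat \<times> nat) set \<Rightarrow> complex" where
  "stab_dim d \<zeta> \<E> =
     (\<Sum>\<kappa>\<in>\<E>. stab_dim_minus d \<zeta> (simple_rep \<zeta> \<kappa>) * stab_dim_plus d \<zeta> (simple_rep \<zeta> \<kappa>))"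

text \<open>As \<open>stab_dim\<close> is a positive real number, its principal square root is the positive one.\<close>

definition stab_S :: "nat \<Rightarrow> complex \<Rightarrow> (nat \<times> nat) set \<Rightarrow> nat \<times> nat \<Rightarrow> nat \<times> nat \<Rightarrow> complex" where
  "stab_S d \<zeta> \<E> \<kappa> \<mu> = (let M = simple_rep \<zeta> \<kappa>; N = simple_rep \<zeta> \<mu>; MN = db_tensor d M N in
     stab_Tr_plus d MN (stab_comp d \<zeta> MN MN (stab_braiding d \<zeta> N M) (stab_braiding d \<zeta> M N))
       / csqrt (stab_dim d \<zeta> \<E>))"

definition stab_T :: "nat \<Rightarrow> complex \<Rightarrow> nat \<times> nat \<Rightarrow> nat \<times> nat \<Rightarrow> complex" where
  "stab_T d \<zeta> \<kappa> \<mu> = (if \<kappa> = \<mu> then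
     (THE t. stab_twist_inv d \<zeta> (simple_rep \<zeta> \<kappa>) = stab_scalar d \<zeta> (simple_rep \<zeta> \<kappa>) t) else 0)"


section \<open>Malle's fusion datum\<close>

text \<open>The maps \<open>Y = {0..d} \<rightarrow> {0..<d}\<close> also index the basis of \<open>V\<^sup>\<otimes>\<^sup>Y\<close> formed by the pure tensors
  of basis vectors; an element of \<open>V\<^sup>\<otimes>\<^sup>Y\<close> is represented by its coordinates.\<close>

definition Yfun :: "nat \<Rightarrow> (nat \<Rightarrow> nat) set" where
  "Yfun d = {0..d} \<rightarrow>\<^sub>E {0..<d}"

definition Psi :: "nat \<Rightarrow> (nat \<Rightarrow> nat) set" where
  "Psi d = {f \<in> Yfun d. strict_mono_on {0, 1} f \<and> strict_mono_on {2..d} f}"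

definition Psi_sharp :: "nat \<Rightarrow> (nat \<Rightarrow> nat) set" where
  "Psi_sharp d = {f \<in> Psi d. (\<Sum>y=0..d. f y) mod d = (d * (d - 1) div 2) mod d}"

definition eps :: "nat \<Rightarrow> (nat \<Rightarrow> nat) \<Rightarrow> complex" where
  "eps d f = (-1) ^ card {(y, y'). y \<in> {0..d} \<and> y' \<in> {0..d} \<and> y < y' \<and> f y < f y'}"

definition fourier :: "complex \<Rightarrow> nat \<Rightarrow> nat \<Rightarrow> complex" where
  "fourier \<zeta> i j = \<zeta> ^ (i * j)"

definition delta :: "nat \<Rightarrow> complex \<Rightarrow> complex" where
  "delta d \<zeta> = det (mat d d (\<lambda>(i, j). fourier \<zeta> i j))"

definition block_perms :: "nat \<Rightarrow> (nat \<Rightarrow> nat) set" where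
  "block_perms d = {\<sigma>. \<sigma> permutes {0..d} \<and> \<sigma> ` {0, 1} = {0, 1} \<and> \<sigma> ` {2..d} = {2..d}}"

text \<open>\<open>\<And>\<^sup>2V \<otimes> \<And>\<^sup>d\<^sup>-\<^sup>1V\<close> is realized inside \<open>V\<^sup>\<otimes>\<^sup>Y\<close>, as the tensors that are antisymmetric in the
  positions \<open>{0, 1}\<close> and in the positions \<open>{2..d}\<close>, by
  \<open>x\<^sub>1 \<and> \<dots> \<and> x\<^sub>k = \<Sum>\<^sub>\<sigma> sign \<sigma> (x\<^bsub>\<sigma> 1\<^esub> \<otimes> \<dots> \<otimes> x\<^bsub>\<sigma> k\<^esub>)\<close>; \<open>wedge_vec d f\<close> is \<open>v\<^sub>f\<close>.\<close>

definition wedge_vec :: "nat \<Rightarrow> (nat \<Rightarrow> nat) \<Rightarrow> (nat \<Rightarrow> nat) \<Rightarrow> complex" where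
  "wedge_vec d f = (\<lambda>g. \<Sum>\<sigma>\<in>block_perms d. of_int (sign \<sigma>) * (if g = f \<circ> \<sigma> then 1 else 0))"

definition fourier_tensor :: "nat \<Rightarrow> complex \<Rightarrow> ((nat \<Rightarrow> nat) \<Rightarrow> complex) \<Rightarrow> (nat \<Rightarrow> nat) \<Rightarrow> complex" where
  "fourier_tensor d \<zeta> t = (\<lambda>g. \<Sum>h\<in>Yfun d. (\<Prod>y=0..d. fourier \<zeta> (g y) (h y)) * t h)"

text \<open>The \<open>(f, f')\<close>-entry is the coefficient of \<open>v\<^sub>f\<close> in the image of \<open>v\<^bsub>f'\<^esub>\<close>.\<close>

definition wedge_S :: "nat \<Rightarrow> complex \<Rightarrow> (nat \<Rightarrow> nat) \<Rightarrow> (nat \<Rightarrow> nat) \<Rightarrow> complex" where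
  "wedge_S d \<zeta> f f' = (THE c. c \<in> extensional (Psi d) \<and>
     (\<forall>g\<in>Yfun d. fourier_tensor d \<zeta> (wedge_vec d f') g = (\<Sum>h\<in>Psi d. c h * wedge_vec d h g))) f"

definition malle_S :: "nat \<Rightarrow> complex \<Rightarrow> (nat \<Rightarrow> nat) \<Rightarrow> (nat \<Rightarrow> nat) \<Rightarrow> complex" where
  "malle_S d \<zeta> f g = (-1) ^ (d - 1) / delta d \<zeta> * eps d f * eps d g * cnj (wedge_S d \<zeta> f g)"

definition malle_T :: "nat \<Rightarrow> complex \<Rightarrow> (nat \<Rightarrow> nat) \<Rightarrow> (nat \<Rightarrow> nat) \<Rightarrow> complex" where
  "malle_T d \<zeta>s f g = (if f = g then
     \<zeta>s powi (int d * (1 - int d ^ 2)) *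
       (\<Prod>y=0..d. \<zeta>s powi (- 6 * (int (f y) ^ 2 + int d * int (f y)))) else 0)"

definition malle_to_simple :: "nat \<Rightarrow> (nat \<Rightarrow> nat) \<Rightarrow> nat \<times> nat" where
  "malle_to_simple d f = (let i = f 0; j = f 1; k = (i + j) mod d in
     if (-1) ^ k * eps d f = 1 then (j - i, i) else iota d (j - i, i))"

end

theory Submission
  imports Defs
begin

text \<open>A morphism factoring through a module that is projective over \<open>B\<close> has trace zero after multiplication
  by the pivot, because \<open>K\<close> commutes with \<open>E\<close> only up to \<open>\<zeta>\<close>; so traces descend to the quotient and all
  invariants are computed on the simple modules, in the weight basis, where \<open>R (e\<^sub>a \<otimes> f\<^sub>b)\<close> is a combination
  of the vectors \<open>e\<^bsub>a-i\<^esub> \<otimes> f\<^bsub>b+i\<^esub>\<close>. The partial trace of the double braiding is a scalar, which is read off on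
  a highest weight vector; this gives
  \<open>(1 - \<zeta>\<^sup>-\<^sup>1) Tr\<^sub>+ (c c) = \<zeta>\<^bsup>-(2pp'+lp'+pl')\<^esup> (1 - \<zeta>\<^bsup>-ll'\<^esup>)\<close>. The twist acts on \<open>M\<^bsub>l,p\<^esub>\<close> by \<open>\<zeta>\<^bsup>p(p+l)\<^esup>\<close>, by
  Cauchy's \<open>q\<close>-binomial theorem.

  For \<open>(l, p) = (j - i, i)\<close> the trace is \<open>\<zeta>\<^bsup>-(ij'+ji')\<^esup> - \<zeta>\<^bsup>-(ii'+jj')\<^esup>\<close>, up to a constant, and applying \<open>\<iota>\<close>
  amounts to exchanging \<open>i\<close> and \<open>j\<close>, which changes the sign. On Malle's side, let \<open>k \<equiv> i + j\<close> be the value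
  omitted by \<open>f\<close> on \<open>{2..d}\<close>. The minor of order \<open>d - 1\<close> of the Fourier matrix is, up to a sign and the
  determinant, the entry \<open>\<zeta>\<^bsup>-kk'\<^esup> / d\<close> of the inverse matrix, and \<open>\<zeta>\<^bsup>-kk'\<^esup>\<close> turns the minor of order \<open>2\<close> into
  the above expression.\<close>

text \<open>Objects of the quotient category carry sets of representatives, which creates three
  obligations: each class must be nonempty, its trace must not depend on the representative, and the
  scalar giving the twist must be unique. Nonemptiness for the braiding forces a direct check that R
  intertwines the two coproducts on the generators; in coordinates this reduces to the commutator of
  E with a power of F. Uniqueness of the scalar rests on the quantum dimension of a simple module
  with 0 < l < d being nonzero.

  The sums over j and k in R and in u are a Fourier transform on Z/d followed by its inverse:
  summing over j forces k to be a weight, and only the index i survives.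

  The root of unity has two sources. Conjugating the minors leaves the quotient of the conjugate of
  the Fourier determinant by the determinant itself, which is a sign because conjugation permutes
  the rows. The trace has denominator 1 - \<zeta>^-1, while the root of the dimension is d / |1 -
  \<zeta>|; what remains is (1 - \<zeta>) / |1 - \<zeta>|, whose square is -\<zeta>.\<close>

section \<open>Matrices indexed by pairs, Kronecker products, powers of diagonal and subdiagonal
  matrices\<close>

lemma sum_lessThan_mult:
  fixes f :: "nat \<Rightarrow> 'a::comm_monoid_add"
  shows "(\<Sum>k<m * n. f k) = (\<Sum>i<m. \<Sum>a<n. f (i * n + a))"
proof -
  have "(\<Sum>k<m * n. f k) = (\<Sum>i<m. sum f {i * n..<i * n + n})"
    by (rule sum.nat_group[symmetric])
  also have "\<dots> = (\<Sum>i<m. \<Sum>a<n. f (i * n + a))"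
  proof (rule sum.cong[OF refl])
    fix i
    show "sum f {i * n..<i * n + n} = (\<Sum>a<n. f (i * n + a))"
      using sum.shift_bounds_nat_ivl[of f 0 "i * n" n] by (simp add: lessThan_atLeast0 add.commute)
  qed
  finally show ?thesis .
qed

lemma pair_index_less:
  fixes i m a n :: nat
  assumes "i < m" "a < n"
  shows "i * n + a < m * n"
proof -
  have "i * n + a < Suc i * n" using assms(2) by simp
  also have "\<dots> \<le> m * n" using assms(1) by (intro mult_le_mono1) simp
  finally show ?thesis .
qed

lemma pair_index_cases:
  fixes r m n :: nat
  assumes "r < m * n"
  obtains i a where "i < m" "a < n" "r = i * n + a"
proof -
  have "n > 0" using assms by (cases n) auto
  then show ?thesis
    using assms by (intro that[of "r div n" "r mod n"]) (auto simp: less_mult_imp_div_less)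
qed

lemma pair_index_eq_iff:
  fixes i j a b m n :: nat
  assumes "i < m" "a < n" "j < m" "b < n"
  shows "i * n + a = j * n + b \<longleftrightarrow> i = j \<and> a = b"
proof
  assume *: "i * n + a = j * n + b"
  have "(i * n + a) div n = i" "(j * n + b) div n = j" using assms by auto
  then show "i = j \<and> a = b" using * by auto
qed auto

lemma index_mult_mat_sum:
  assumes "A \<in> carrier_mat l m" "B \<in> carrier_mat m n" "i < l" "j < n"
  shows "(A * B) $$ (i, j) = (\<Sum>k<m. A $$ (i, k) * B $$ (k, j))"
  using assms by (simp add: scalar_prod_def lessThan_atLeast0)

lemma mtrace_comm:
  assumes "A \<in> carrier_mat m n" "B \<in> carrier_mat n m"
  shows "mtrace (A * B) = mtrace (B * A)"
proof -
  have "mtrace (A * B) = (\<Sum>i<m. \<Sum>k<n. A $$ (i, k) * B $$ (k, i))"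
    using assms by (simp add: mtrace_def scalar_prod_def lessThan_atLeast0)
  also have "\<dots> = (\<Sum>k<n. \<Sum>i<m. B $$ (k, i) * A $$ (i, k))"
    by (subst sum.swap) (simp add: mult.commute)
  also have "\<dots> = mtrace (B * A)"
    using assms by (simp add: mtrace_def scalar_prod_def lessThan_atLeast0)
  finally show ?thesis .
qed

lemma mtrace_mult:
  assumes "A \<in> carrier_mat m n" "B \<in> carrier_mat n m"
  shows "mtrace (A * B) = (\<Sum>r<m. \<Sum>k<n. A $$ (r, k) * B $$ (k, r))"
  using assms by (simp add: mtrace_def scalar_prod_def lessThan_atLeast0)

lemma mtrace_smult: "mtrace (c \<cdot>\<^sub>m A) = c * mtrace A" if "A \<in> carrier_mat n n"
  using that by (simp add: mtrace_def sum_distrib_left)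

lemma mtrace_minus:
  assumes "A \<in> carrier_mat n n" "B \<in> carrier_mat n n"
  shows "mtrace (A - B) = mtrace A - mtrace B"
  using assms by (simp add: mtrace_def sum_subtractf)

lemma kron_carrier [simp]:
  "A \<in> carrier_mat m n \<Longrightarrow> B \<in> carrier_mat p q \<Longrightarrow> kron A B \<in> carrier_mat (m * p) (n * q)"
  by (auto simp: kron_def)

lemma index_kron:
  assumes "A \<in> carrier_mat m n" "B \<in> carrier_mat p q" "i < m" "a < p" "j < n" "b < q"
  shows "kron A B $$ (i * p + a, j * q + b) = A $$ (i, j) * B $$ (a, b)"
  using assms by (simp add: kron_def pair_index_less)

lemma eq_pair_matI:
  assumes "A \<in> carrier_mat (m * p) (n * q)" "B \<in> carrier_mat (m * p) (n * q)"
    and "\<And>i a j b. i < m \<Longrightarrow> a < p \<Longrightarrow> j < n \<Longrightarrow> b < q \<Longrightarrow>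
      A $$ (i * p + a, j * q + b) = B $$ (i * p + a, j * q + b)"
  shows "A = B"
proof (rule eq_matI)
  fix r s assume "r < dim_row B" "s < dim_col B"
  then have "r < m * p" "s < n * q" using assms by auto
  then show "A $$ (r, s) = B $$ (r, s)"
    by (elim pair_index_cases) (use assms(3) in auto)
qed (use assms in auto)

lemma index_mult_mat_pair:
  assumes "A \<in> carrier_mat k (m * n)" "B \<in> carrier_mat (m * n) l" "r < k" "s < l"
  shows "(A * B) $$ (r, s) = (\<Sum>i<m. \<Sum>a<n. A $$ (r, i * n + a) * B $$ (i * n + a, s))"
  unfolding index_mult_mat_sum[OF assms] by (rule sum_lessThan_mult)

lemma kron_mult:
  assumes "A \<in> carrier_mat m n" "B \<in> carrier_mat p q" "C \<in> carrier_mat n k" "D \<in> carrier_mat q l"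
  shows "kron A B * kron C D = kron (A * C) (B * D)"
proof (rule eq_pair_matI[of _ m p k l])
  have AB: "kron A B \<in> carrier_mat (m * p) (n * q)" and CD: "kron C D \<in> carrier_mat (n * q) (k * l)"
    by (rule kron_carrier[OF assms(1,2)], rule kron_carrier[OF assms(3,4)])
  then show "kron A B * kron C D \<in> carrier_mat (m * p) (k * l)"
    by (rule mult_carrier_mat)
  show "kron (A * C) (B * D) \<in> carrier_mat (m * p) (k * l)"
    using assms by (intro kron_carrier mult_carrier_mat)
  fix i a j b assume *: "i < m" "a < p" "j < k" "b < l"
  have "(kron A B * kron C D) $$ (i * p + a, j * l + b) =
      (\<Sum>x<n. \<Sum>y<q. kron A B $$ (i * p + a, x * q + y) * kron C D $$ (x * q + y, j * l + b))"
    by (rule index_mult_mat_pair[OF AB CD]) (use * in \<open>auto intro: pair_index_less\<close>)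
  also have "\<dots> = (\<Sum>x<n. \<Sum>y<q. (A $$ (i, x) * C $$ (x, j)) * (B $$ (a, y) * D $$ (y, b)))"
    using * by (intro sum.cong refl)
      (simp add: index_kron[OF assms(1,2)] index_kron[OF assms(3,4)])
  also have "\<dots> = (\<Sum>x<n. A $$ (i, x) * C $$ (x, j)) * (\<Sum>y<q. B $$ (a, y) * D $$ (y, b))"
    by (simp add: sum_product)
  also have "\<dots> = (A * C) $$ (i, j) * (B * D) $$ (a, b)"
    using * by (simp add: index_mult_mat_sum[OF assms(1,3)] index_mult_mat_sum[OF assms(2,4)]
        del: index_mult_mat)
  also have "\<dots> = kron (A * C) (B * D) $$ (i * p + a, j * l + b)"
    using * by (intro index_kron[symmetric, OF mult_carrier_mat[OF assms(1,3)] mult_carrier_mat[OF assms(2,4)]])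
  finally show "(kron A B * kron C D) $$ (i * p + a, j * l + b) =
     kron (A * C) (B * D) $$ (i * p + a, j * l + b)" .
qed

lemma kron_one: "kron (1\<^sub>m m) (1\<^sub>m n) = 1\<^sub>m (m * n)"
proof (rule eq_pair_matI[of _ m n m n])
  fix i a j b assume *: "i < m" "a < n" "j < m" "b < n"
  have "i * n + a = j * n + b \<longleftrightarrow> i = j \<and> a = b"
    using * by (intro pair_index_eq_iff)
  then show "kron (1\<^sub>m m) (1\<^sub>m n) $$ (i * n + a, j * n + b) = 1\<^sub>m (m * n) $$ (i * n + a, j * n + b)"
    using * by (subst index_kron[of _ m m _ n n]) (auto simp: pair_index_less)
qed auto

lemma kron_pow:
  assumes "A \<in> carrier_mat m m" "B \<in> carrier_mat n n"
  shows "kron A B ^\<^sub>m k = kron (A ^\<^sub>m k) (B ^\<^sub>m k)"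
proof (induction k)
  case 0
  have "dim_row (kron A B) = m * n" using assms by (simp add: kron_def)
  then show ?case using assms by (simp add: kron_one)
next
  case (Suc k)
  then show ?case
    using assms by (simp add: kron_mult[of _ m m _ n n _ m _ n])
qed

lemma pow_mat_Suc_left:
  assumes "A \<in> carrier_mat n n"
  shows "A ^\<^sub>m Suc k = A * A ^\<^sub>m k"
proof (induction k)
  case (Suc k)
  have "A ^\<^sub>m Suc (Suc k) = (A * A ^\<^sub>m k) * A" using Suc by simp
  also have "\<dots> = A * A ^\<^sub>m Suc k" using assms by (simp add: assoc_mult_mat[of _ n n _ n _ n])
  finally show ?case .
qed (use assms in auto)

lemma pow_mat_add:
  assumes "A \<in> carrier_mat n n"
  shows "A ^\<^sub>m (j + k) = A ^\<^sub>m j * A ^\<^sub>m k"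
proof (induction k)
  case (Suc k)
  then show ?case using assms by (simp add: assoc_mult_mat[of _ n n _ n _ n])
qed (use assms in auto)

lemma index_mult_diag_right:
  assumes "A \<in> carrier_mat n n" "i < n" "j < n"
  shows "(A * mat n n (\<lambda>(r, s). if r = s then c r else (0 :: complex))) $$ (i, j) = A $$ (i, j) * c j"
proof -
  have "(A * mat n n (\<lambda>(r, s). if r = s then c r else 0)) $$ (i, j) =
      (\<Sum>k<n. A $$ (i, k) * mat n n (\<lambda>(r, s). if r = s then c r else 0) $$ (k, j))"
    using assms by (intro index_mult_mat_sum) auto
  also have "\<dots> = (\<Sum>k<n. if k = j then A $$ (i, k) * c k else 0)"
    using assms by (intro sum.cong refl) auto
  finally show ?thesis using assms by simp
qed

lemma index_mult_diag_left:
  assumes "A \<in> carrier_mat n n" "i < n" "j < n"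
  shows "(mat n n (\<lambda>(r, s). if r = s then c r else (0 :: complex)) * A) $$ (i, j) = c i * A $$ (i, j)"
proof -
  have "(mat n n (\<lambda>(r, s). if r = s then c r else 0) * A) $$ (i, j) =
      (\<Sum>k<n. mat n n (\<lambda>(r, s). if r = s then c r else 0) $$ (i, k) * A $$ (k, j))"
    using assms by (intro index_mult_mat_sum) auto
  also have "\<dots> = (\<Sum>k<n. if k = i then c k * A $$ (k, j) else 0)"
    using assms by (intro sum.cong refl) auto
  finally show ?thesis using assms by simp
qed

lemma smult_one_diag: "c \<cdot>\<^sub>m 1\<^sub>m n = mat n n (\<lambda>(r, s). if r = s then c else (0 :: complex))"
  by (auto intro!: eq_matI)

lemma diag_pow:
  "mat n n (\<lambda>(r, s). if r = s then c r else 0) ^\<^sub>m k =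
    mat n n (\<lambda>(r, s). if r = s then c r ^ k else (0 :: complex))"
proof (induction k)
  case (Suc k)
  show ?case
    unfolding pow_mat.simps Suc
    by (rule eq_matI) (auto simp: index_mult_diag_right mult.commute simp del: index_mult_mat(1))
qed (auto intro!: eq_matI)

text \<open>The weights are arbitrary because F K z^-1, which up to a scalar is the antipode of F,
  acts on a simple module as a shift with varying weights.\<close>

lemma subdiagonal_pow:
  "mat l l (\<lambda>(r, s). if r = s + 1 then g s else 0) ^\<^sub>m i =
   mat l l (\<lambda>(r, s). if r = s + i then \<Prod>t<i. g (s + t) else (0 :: complex))"
proof (induction i)
  case 0
  then show ?case by (auto intro!: eq_matI)
next
  case (Suc i)
  let ?A = "mat l l (\<lambda>(r, s). if r = s + i then \<Prod>t<i. g (s + t) else (0 :: complex))"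
  let ?F = "mat l l (\<lambda>(r, s). if r = s + 1 then g s else 0)"
  let ?C = "mat l l (\<lambda>(r, s). if r = s + Suc i then \<Prod>t<Suc i. g (s + t) else (0 :: complex))"
  have "?A * ?F = ?C"
  proof (rule eq_matI)
    fix r s assume "r < dim_row ?C" "s < dim_col ?C"
    then have rs: "r < l" "s < l" by auto
    have "(?A * ?F) $$ (r, s) = (\<Sum>m<l. ?A $$ (r, m) * ?F $$ (m, s))"
      using rs by (intro index_mult_mat_sum) auto
    also have "\<dots> = (\<Sum>m<l. if m = s + 1 then if r = Suc s + i then (\<Prod>t<i. g (Suc s + t)) * g s else 0 else 0)"
      using rs by (intro sum.cong refl) auto
    also have "\<dots> = ?C $$ (r, s)"
      using rs by (auto simp: prod.lessThan_Suc_shift mult.commute simp del: prod.lessThan_Suc)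
    finally show "(?A * ?F) $$ (r, s) = ?C $$ (r, s)" .
  qed auto
  then show ?case using Suc by simp
qed

lemma qcomm_pow:
  fixes \<zeta> :: complex
  assumes K: "K \<in> carrier_mat n n" and E: "E \<in> carrier_mat n n" and KE: "K * E = \<zeta> \<cdot>\<^sub>m (E * K)"
  shows "K * E ^\<^sub>m j = \<zeta> ^ j \<cdot>\<^sub>m (E ^\<^sub>m j * K)"
proof (induction j)
  case 0
  show ?case using K E by (auto intro!: eq_matI)
next
  case (Suc j)
  have c: "E ^\<^sub>m j \<in> carrier_mat n n" using E by simp
  have "K * E ^\<^sub>m Suc j = (K * E ^\<^sub>m j) * E"
    by (simp add: assoc_mult_mat[OF K c E])
  also have "\<dots> = (\<zeta> ^ j \<cdot>\<^sub>m (E ^\<^sub>m j * K)) * E"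
    by (simp only: Suc)
  also have "\<dots> = \<zeta> ^ j \<cdot>\<^sub>m (E ^\<^sub>m j * (K * E))"
    by (simp add: mult_smult_assoc_mat[OF mult_carrier_mat[OF c K] E] assoc_mult_mat[OF c K E])
  also have "\<dots> = \<zeta> ^ j \<cdot>\<^sub>m (\<zeta> \<cdot>\<^sub>m (E ^\<^sub>m j * (E * K)))"
    unfolding KE using K E c by (simp add: mult_smult_distrib[of _ n n _ n])
  also have "\<dots> = \<zeta> ^ Suc j \<cdot>\<^sub>m (E ^\<^sub>m j * (E * K))"
    by (rule eq_matI) auto
  also have "E ^\<^sub>m j * (E * K) = E ^\<^sub>m Suc j * K"
    by (simp add: assoc_mult_mat[OF c E K])
  finally show ?case .
qed

section \<open>Traces of endomorphisms of projective modules\<close>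

text \<open>The free module \<open>\<complex>[E]/(E\<^sup>d) \<otimes> P\<close>, in which \<open>E\<^sup>i \<otimes> v\<^sub>a\<close> has index \<open>i * dim P + a\<close>.\<close>

definition shift_mat :: "nat \<Rightarrow> complex mat" where
  "shift_mat d = mat d d (\<lambda>(r, s). if r = Suc s then 1 else 0)"

definition power_mat :: "nat \<Rightarrow> complex \<Rightarrow> complex mat" where
  "power_mat d \<zeta> = mat d d (\<lambda>(r, s). if r = s then \<zeta> ^ r else 0)"

text \<open>This is the module induced from the subalgebra generated by K. It is a plain
  \<open>b_rep\<close> because the lifting property in \<open>b_projective\<close> quantifies over
  that type.\<close>

definition b_free :: "nat \<Rightarrow> complex \<Rightarrow> 'r b_rep_scheme \<Rightarrow> b_rep" where
  "b_free d \<zeta> P = \<lparr>rdim = d * rdim P, actE = kron (shift_mat d) (1\<^sub>m (rdim P)),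
     actK = kron (power_mat d \<zeta>) (actK P)\<rparr>"

text \<open>The multiplication map, with E^i \<otimes> v going to E^i v; it is the counit of the
  induction.\<close>

definition free_proj :: "nat \<Rightarrow> 'r b_rep_scheme \<Rightarrow> complex mat" where
  "free_proj d P = mat (rdim P) (d * rdim P)
     (\<lambda>(r, s). (actE P ^\<^sub>m (s div rdim P)) $$ (r, s mod rdim P))"

lemma shift_mat_carrier [simp]: "shift_mat d \<in> carrier_mat d d"
  and power_mat_carrier [simp]: "power_mat d \<zeta> \<in> carrier_mat d d"
  by (simp_all add: shift_mat_def power_mat_def)

lemma index_shift_mat [simp]: "r < d \<Longrightarrow> s < d \<Longrightarrow> shift_mat d $$ (r, s) = (if r = Suc s then 1 else 0)"
  and index_power_mat [simp]: "r < d \<Longrightarrow> s < d \<Longrightarrow> power_mat d \<zeta> $$ (r, s) = (if r = s then \<zeta> ^ r else 0)"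
  by (simp_all add: shift_mat_def power_mat_def)

lemma shift_mat_pow: "shift_mat d ^\<^sub>m k = mat d d (\<lambda>(r, s). if r = s + k then 1 else 0)"
  unfolding shift_mat_def Suc_eq_plus1 subdiagonal_pow by (rule eq_matI) auto

lemma power_shift_qcomm: "power_mat d \<zeta> * shift_mat d = \<zeta> \<cdot>\<^sub>m (shift_mat d * power_mat d \<zeta>)"
  unfolding power_mat_def
  by (rule eq_matI) (auto simp: index_mult_diag_left[OF shift_mat_carrier] index_mult_diag_right[OF shift_mat_carrier]
    carrier_matD[OF shift_mat_carrier] simp del: index_mult_mat(1))

lemma kron_zero_left: "kron (0\<^sub>m m n) B = 0\<^sub>m (m * dim_row B) (n * dim_col B)"
proof -
  have "0 < dim_row B" if "r < m * dim_row B" for r using that by (cases "dim_row B") auto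
  moreover have "0 < dim_col B" if "s < n * dim_col B" for s using that by (cases "dim_col B") auto
  ultimately show ?thesis
    by (intro eq_matI) (auto simp: kron_def less_mult_imp_div_less)
qed

lemma kron_smult_left: "kron (c \<cdot>\<^sub>m A) B = c \<cdot>\<^sub>m kron A B"
proof -
  have "0 < dim_row B" if "r < m * dim_row B" for r m using that by (cases "dim_row B") auto
  moreover have "0 < dim_col B" if "s < n * dim_col B" for s n using that by (cases "dim_col B") auto
  ultimately show ?thesis
    by (intro eq_matI) (auto simp: kron_def less_mult_imp_div_less)
qed

lemma b_free_module:
  assumes \<zeta>: "\<zeta> ^ d = 1" and P: "b_module d \<zeta> P"
  shows "b_module d \<zeta> (b_free d \<zeta> P)"
proof -
  let ?n = "rdim P" let ?J = "shift_mat d" let ?D = "power_mat d \<zeta>" let ?K = "actK P"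
  have K: "?K \<in> carrier_mat ?n ?n" "?K ^\<^sub>m d = 1\<^sub>m ?n"
    using P by (auto simp: b_module_def Let_def)
  have J: "?J ^\<^sub>m d = 0\<^sub>m d d"
    by (auto simp: shift_mat_pow intro!: eq_matI)
  have D: "?D ^\<^sub>m d = 1\<^sub>m d"
    unfolding power_mat_def diag_pow
    by (rule eq_matI) (auto simp: \<zeta> power_mult[symmetric] mult.commute[of _ d] power_mult)
  have "kron ?J (1\<^sub>m ?n) ^\<^sub>m d = 0\<^sub>m (d * ?n) (d * ?n)"
    by (simp add: kron_pow[OF shift_mat_carrier one_carrier_mat] J kron_zero_left)
  moreover have "kron ?D ?K ^\<^sub>m d = 1\<^sub>m (d * ?n)"
    by (simp add: kron_pow[OF power_mat_carrier K(1)] D K(2) kron_one)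
  moreover have "kron ?D ?K * kron ?J (1\<^sub>m ?n) = \<zeta> \<cdot>\<^sub>m (kron ?J (1\<^sub>m ?n) * kron ?D ?K)"
    using K(1) by (simp add: kron_mult[OF power_mat_carrier K(1) shift_mat_carrier one_carrier_mat]
        kron_mult[OF shift_mat_carrier one_carrier_mat power_mat_carrier K(1)]
        power_shift_qcomm kron_smult_left)
  ultimately show ?thesis
    using K(1) by (simp add: b_module_def b_free_def Let_def)
qed

lemma index_free_proj:
  assumes "r < rdim P" "i < d" "a < rdim P"
  shows "free_proj d P $$ (r, i * rdim P + a) = (actE P ^\<^sub>m i) $$ (r, a)"
  using assms by (simp add: free_proj_def pair_index_less)

lemma free_proj_carrier [simp]: "free_proj d P \<in> carrier_mat (rdim P) (d * rdim P)"
  by (simp add: free_proj_def)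

lemma eq_mat_pair_colI:
  assumes "A \<in> carrier_mat k (n * q)" "B \<in> carrier_mat k (n * q)"
    and "\<And>r j b. r < k \<Longrightarrow> j < n \<Longrightarrow> b < q \<Longrightarrow> A $$ (r, j * q + b) = B $$ (r, j * q + b)"
  shows "A = B"
proof (rule eq_matI)
  fix r s assume "r < dim_row B" "s < dim_col B"
  then have "r < k" "s < n * q" using assms by auto
  then show "A $$ (r, s) = B $$ (r, s)"
    by (elim pair_index_cases) (use assms(3) in auto)
qed (use assms in auto)

lemma free_proj_hom:
  assumes P: "b_module d \<zeta> P"
  shows "free_proj d P \<in> b_hom (b_free d \<zeta> P) P"
proof -
  let ?n = "rdim P" let ?J = "shift_mat d" let ?D = "power_mat d \<zeta>" let ?K = "actK P" let ?E = "actE P"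
  let ?\<pi> = "free_proj d P"
  have K: "?K \<in> carrier_mat ?n ?n" and E: "?E \<in> carrier_mat ?n ?n" "?E ^\<^sub>m d = 0\<^sub>m ?n ?n"
    and KE: "?K * ?E = \<zeta> \<cdot>\<^sub>m (?E * ?K)"
    using P by (auto simp: b_module_def Let_def)
  have JE: "kron ?J (1\<^sub>m ?n) \<in> carrier_mat (d * ?n) (d * ?n)" and DK: "kron ?D ?K \<in> carrier_mat (d * ?n) (d * ?n)"
    using K by auto
  have "?\<pi> * kron ?J (1\<^sub>m ?n) = ?E * ?\<pi>"
  proof (rule eq_mat_pair_colI[of _ ?n d ?n])
    fix r j b assume *: "r < ?n" "j < d" "b < ?n"
    then have jb: "j * ?n + b < d * ?n" by (intro pair_index_less)
    have "(?\<pi> * kron ?J (1\<^sub>m ?n)) $$ (r, j * ?n + b) =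
        (\<Sum>i<d. \<Sum>a<?n. ?\<pi> $$ (r, i * ?n + a) * kron ?J (1\<^sub>m ?n) $$ (i * ?n + a, j * ?n + b))"
      by (rule index_mult_mat_pair[OF free_proj_carrier JE]) (use * jb in auto)
    also have "\<dots> = (\<Sum>i<d. \<Sum>a<?n. if a = b then if i = Suc j then (?E ^\<^sub>m i) $$ (r, b) else 0 else 0)"
      using * by (intro sum.cong refl)
       (auto simp: index_free_proj index_kron[OF shift_mat_carrier one_carrier_mat])
    also have "\<dots> = (if Suc j < d then (?E ^\<^sub>m Suc j) $$ (r, b) else 0)"
      using * by (simp add: sum.delta del: pow_mat.simps)
    also have "\<dots> = (?E ^\<^sub>m Suc j) $$ (r, b)"
    \<comment> \<open>In the top degree the shift has no target, and the right side vanishes because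
      E^d = 0 on P.\<close>
    proof (cases "Suc j < d")
      case False
      then have "Suc j = d" using * by simp
      then show ?thesis using E(2) * by (simp del: pow_mat.simps)
    qed simp
    also have "\<dots> = (\<Sum>m<?n. ?E $$ (r, m) * (?E ^\<^sub>m j) $$ (m, b))"
      unfolding pow_mat_Suc_left[OF E(1)] by (rule index_mult_mat_sum) (use E * in auto)
    also have "\<dots> = (\<Sum>m<?n. ?E $$ (r, m) * ?\<pi> $$ (m, j * ?n + b))"
      using * by (intro sum.cong refl) (simp add: index_free_proj)
    also have "\<dots> = (?E * ?\<pi>) $$ (r, j * ?n + b)"
      by (rule index_mult_mat_sum[OF E(1) free_proj_carrier, symmetric]) (use * jb in auto)
    finally show "(?\<pi> * kron ?J (1\<^sub>m ?n)) $$ (r, j * ?n + b) = (?E * ?\<pi>) $$ (r, j * ?n + b)" .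
  qed (auto intro!: mult_carrier_mat[OF free_proj_carrier JE] mult_carrier_mat[OF E(1) free_proj_carrier])
  moreover have "?\<pi> * kron ?D ?K = ?K * ?\<pi>"
  proof (rule eq_mat_pair_colI[of _ ?n d ?n])
    fix r j b assume *: "r < ?n" "j < d" "b < ?n"
    then have jb: "j * ?n + b < d * ?n" by (intro pair_index_less)
    have Ej: "?E ^\<^sub>m j \<in> carrier_mat ?n ?n" using E by simp
    have "(?\<pi> * kron ?D ?K) $$ (r, j * ?n + b) =
        (\<Sum>i<d. \<Sum>a<?n. ?\<pi> $$ (r, i * ?n + a) * kron ?D ?K $$ (i * ?n + a, j * ?n + b))"
      by (rule index_mult_mat_pair[OF free_proj_carrier DK]) (use * jb in auto)
    also have "\<dots> = (\<Sum>i<d. \<Sum>a<?n. if i = j then \<zeta> ^ j * ((?E ^\<^sub>m j) $$ (r, a) * ?K $$ (a, b)) else 0)"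
      using * by (intro sum.cong refl)
       (auto simp: index_free_proj index_kron[OF power_mat_carrier K])
    also have "\<dots> = (\<Sum>i<d. if i = j then \<Sum>a<?n. \<zeta> ^ j * ((?E ^\<^sub>m j) $$ (r, a) * ?K $$ (a, b)) else 0)"
      by (intro sum.cong refl) auto
    also have "\<dots> = \<zeta> ^ j * (\<Sum>a<?n. (?E ^\<^sub>m j) $$ (r, a) * ?K $$ (a, b))"
      using * by (simp add: sum.delta sum_distrib_left)
    also have "\<dots> = \<zeta> ^ j * (?E ^\<^sub>m j * ?K) $$ (r, b)"
      using * by (simp add: index_mult_mat_sum[OF Ej K])
    also have "\<dots> = (?K * ?E ^\<^sub>m j) $$ (r, b)"
      unfolding qcomm_pow[OF K E(1) KE] using * E K by simp
    also have "\<dots> = (\<Sum>m<?n. ?K $$ (r, m) * (?E ^\<^sub>m j) $$ (m, b))"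
      by (rule index_mult_mat_sum) (use E K * in auto)
    also have "\<dots> = (\<Sum>m<?n. ?K $$ (r, m) * ?\<pi> $$ (m, j * ?n + b))"
      using * by (intro sum.cong refl) (simp add: index_free_proj)
    also have "\<dots> = (?K * ?\<pi>) $$ (r, j * ?n + b)"
      by (rule index_mult_mat_sum[OF K free_proj_carrier, symmetric]) (use * jb in auto)
    finally show "(?\<pi> * kron ?D ?K) $$ (r, j * ?n + b) = (?K * ?\<pi>) $$ (r, j * ?n + b)" .
  qed (auto intro!: mult_carrier_mat[OF free_proj_carrier DK] mult_carrier_mat[OF K free_proj_carrier])
  ultimately show ?thesis by (simp add: b_hom_def b_free_def)
qed

lemma free_proj_surj:
  assumes E: "actE P \<in> carrier_mat (rdim P) (rdim P)" and d: "d > 0"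
  shows "mat_surj (free_proj d P)"
proof -
  let ?n = "rdim P"
  \<comment> \<open>The inclusion of P as the summand of degree 0. A linear section suffices for
    surjectivity; an E-linear one is what projectivity supplies later.\<close>
  let ?\<iota> = "mat (d * ?n) ?n (\<lambda>(r, s). if r = s then 1 else 0) :: complex mat"
  have "free_proj d P * ?\<iota> = 1\<^sub>m ?n"
  proof (rule eq_matI)
    fix r s assume *: "r < dim_row (1\<^sub>m ?n :: complex mat)" "s < dim_col (1\<^sub>m ?n :: complex mat)"
    then have s: "s < d * ?n" using d pair_index_less[of 0 d s ?n] by simp
    have "(free_proj d P * ?\<iota>) $$ (r, s) = (\<Sum>m<d * ?n. free_proj d P $$ (r, m) * ?\<iota> $$ (m, s))"
      using * by (intro index_mult_mat_sum) auto
    also have "\<dots> = (\<Sum>m<d * ?n. if m = s then free_proj d P $$ (r, m) else 0)"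
      using * by (intro sum.cong refl) auto
    also have "\<dots> = free_proj d P $$ (r, 0 * ?n + s)"
      using s by simp
    also have "\<dots> = 1\<^sub>m ?n $$ (r, s)"
      using * d E by (subst index_free_proj) auto
    finally show "(free_proj d P * ?\<iota>) $$ (r, s) = 1\<^sub>m ?n $$ (r, s)" .
  qed (auto simp: free_proj_def)
  then have *: "free_proj d P *\<^sub>v (?\<iota> *\<^sub>v v) = v" if "v \<in> carrier_vec ?n" for v
    using that assoc_mult_mat_vec[OF free_proj_carrier[of d P] _ that, of ?\<iota>] by simp
  have dims: "dim_row (free_proj d P) = ?n" "dim_col (free_proj d P) = d * ?n"
    by (simp_all add: free_proj_def)
  show ?thesis
    unfolding mat_surj_def dims
  proof (intro equalityI subsetI)
    fix v :: "complex vec" assume "v \<in> carrier_vec ?n"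
    then show "v \<in> (\<lambda>v. free_proj d P *\<^sub>v v) ` carrier_vec (d * ?n)"
      by (intro image_eqI[where x = "?\<iota> *\<^sub>v v"])
        (auto simp: * intro!: mult_mat_vec_carrier[of _ "d * ?n" ?n])
  next
    fix v :: "complex vec" assume "v \<in> (\<lambda>v. free_proj d P *\<^sub>v v) ` carrier_vec (d * ?n)"
    then show "v \<in> carrier_vec ?n" by (auto intro!: mult_mat_vec_carrier[OF free_proj_carrier])
  qed
qed

text \<open>A section of the free cover gives \<open>1 = \<Sum>\<^sub>i E\<^sup>i t E\<^bsup>d-1-i\<^esup>\<close>, and moving the powers of \<open>E\<close> around the
  trace gives the same term for each \<open>i\<close>, up to the factors \<open>\<xi>\<^bsup>-k\<^esup>\<close>, whose sum is \<open>0\<close>.\<close>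

lemma mtrace_projective:
  assumes d: "d > 0" and z1: "\<zeta> ^ d = 1" and \<xi>: "\<xi> ^ d = 1" "\<xi> \<noteq> 1"
    and P: "b_projective d \<zeta> P" and gc: "g \<in> carrier_mat (rdim P) (rdim P)" and gE: "g * actE P = actE P * g"
    and C: "C \<in> carrier_mat (rdim P) (rdim P)" and CE: "C * actE P = \<xi> \<cdot>\<^sub>m (actE P * C)"
  shows "mtrace (C * g) = 0"
proof -
  let ?n = "rdim P" let ?K = "actK P" let ?E = "actE P" let ?\<pi> = "free_proj d P"
  \<comment> \<open>The same B-module as P with any further record fields removed, since lifts are
    available only against targets of type \<open>b_rep\<close>.\<close>
  let ?Y = "\<lparr>rdim = ?n, actE = ?E, actK = ?K\<rparr>"
  have mod: "b_module d \<zeta> P" using P by (simp add: b_projective_def)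
  then have K: "?K \<in> carrier_mat ?n ?n" and E: "?E \<in> carrier_mat ?n ?n"
    and Y: "b_module d \<zeta> ?Y"
    by (auto simp: b_module_def Let_def)
  have "?\<pi> \<in> b_hom (b_free d \<zeta> P) ?Y"
    using free_proj_hom[OF mod] by (simp add: b_hom_def)
  moreover have "mat_surj ?\<pi>" using E d by (intro free_proj_surj) auto
  moreover have "1\<^sub>m ?n \<in> b_hom P ?Y"
    using E K by (simp add: b_hom_def)
  \<comment> \<open>Lifting the identity of P through the free cover gives an E-linear
    section.\<close>
  ultimately obtain h where h: "h \<in> b_hom P (b_free d \<zeta> P)" "?\<pi> * h = 1\<^sub>m ?n"
    using P Y b_free_module[OF z1 mod] unfolding b_projective_def by metis
  have hc: "h \<in> carrier_mat (d * ?n) ?n"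
    and hE: "h * ?E = kron (shift_mat d) (1\<^sub>m ?n) * h"
    using h(1) by (auto simp: b_hom_def b_free_def)
  have JE: "kron (shift_mat d) (1\<^sub>m ?n) \<in> carrier_mat (d * ?n) (d * ?n)" by simp
  \<comment> \<open>The component of the section in degree i. Linearity over E yields
    \<open>H (Suc i) * E = H i\<close>, so all components are determined by the top one,
    \<open>t\<close>.\<close>
  define H where "H i = mat ?n ?n (\<lambda>(a, s). h $$ (i * ?n + a, s))" for i
  have Hc: "H i \<in> carrier_mat ?n ?n" for i by (simp add: H_def)
  have H: "H i $$ (a, s) = h $$ (i * ?n + a, s)" if "a < ?n" "s < ?n" for i a s
    using that by (simp add: H_def)
  have Ei: "?E ^\<^sub>m i \<in> carrier_mat ?n ?n" for i using E by simp
  have HE: "H (Suc i) * ?E = H i" if i: "Suc i < d" for i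
  proof (rule eq_matI)
    fix a s assume "a < dim_row (H i)" "s < dim_col (H i)"
    then have as: "a < ?n" "s < ?n" by (auto simp: H_def)
    then have ia: "Suc i * ?n + a < d * ?n" using i by (intro pair_index_less)
    have "(H (Suc i) * ?E) $$ (a, s) = (\<Sum>m<?n. h $$ (Suc i * ?n + a, m) * ?E $$ (m, s))"
      using as by (simp add: index_mult_mat_sum[OF Hc E] H del: index_mult_mat)
    also have "\<dots> = (h * ?E) $$ (Suc i * ?n + a, s)"
      using ia as by (simp add: index_mult_mat_sum[OF hc E] del: index_mult_mat)
    also have "\<dots> = (\<Sum>j<d. \<Sum>b<?n. kron (shift_mat d) (1\<^sub>m ?n) $$ (Suc i * ?n + a, j * ?n + b) * h $$ (j * ?n + b, s))"
      unfolding hE by (rule index_mult_mat_pair[OF JE hc ia as(2)])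
    also have "\<dots> = (\<Sum>j<d. \<Sum>b<?n. if b = a then if j = i then h $$ (i * ?n + b, s) else 0 else 0)"
    proof (intro sum.cong refl)
      fix j b assume "j \<in> {..<d}" "b \<in> {..<?n}"
      then show "kron (shift_mat d) (1\<^sub>m ?n) $$ (Suc i * ?n + a, j * ?n + b) * h $$ (j * ?n + b, s) =
          (if b = a then if j = i then h $$ (i * ?n + b, s) else 0 else 0)"
        using as i by (subst index_kron[OF shift_mat_carrier one_carrier_mat]) auto
    qed
    also have "\<dots> = H i $$ (a, s)"
      using as i by (simp add: sum.delta H)
    finally show "(H (Suc i) * ?E) $$ (a, s) = H i $$ (a, s)" .
  qed (use E in \<open>auto simp: H_def\<close>)
  define t where "t = H (d - 1)"
  have tc: "t \<in> carrier_mat ?n ?n" by (simp add: t_def Hc)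
  have Ht: "H (d - 1 - k) = t * ?E ^\<^sub>m k" if "k < d" for k
    using that
  proof (induction k)
    case 0
    then show ?case using tc E by (simp add: t_def)
  next
    case (Suc k)
    have "H (d - 1 - Suc k) = H (Suc (d - 1 - Suc k)) * ?E"
      using Suc.prems by (intro HE[symmetric]) simp
    also have "Suc (d - 1 - Suc k) = d - 1 - k" using Suc.prems by simp
    also have "H (d - 1 - k) = t * ?E ^\<^sub>m k" using Suc by simp
    finally show ?case by (simp add: assoc_mult_mat[OF tc Ei E])
  qed
  have gEi: "g * ?E ^\<^sub>m i = ?E ^\<^sub>m i * g" for i
  proof -
    have one: "1 \<cdot>\<^sub>m A = A" for A :: "complex mat" by (auto intro!: eq_matI)
    show ?thesis using qcomm_pow[OF gc E, of 1 i] gE by (simp add: one)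
  qed
  have Cg: "C * g \<in> carrier_mat ?n ?n" using C gc by simp
  have tr: "mtrace (C * g * (?E ^\<^sub>m (d - 1 - k) * H (d - 1 - k))) * \<xi> ^ k = mtrace (C * g * (?E ^\<^sub>m (d - 1) * t))"
    if k: "k < d" for k
  proof -
    let ?A = "?E ^\<^sub>m (d - 1 - k)" let ?B = "?E ^\<^sub>m k"
    have c: "?A \<in> carrier_mat ?n ?n" "?B \<in> carrier_mat ?n ?n" using Ei by auto
    have m: "C * g * ?A * t \<in> carrier_mat ?n ?n"
      using C gc c(1) tc by (intro mult_carrier_mat)
    have "C * g * (?A * (t * ?B)) = (C * g * ?A * t) * ?B"
      using C gc c tc by (simp add: assoc_mult_mat[of _ ?n ?n _ ?n _ ?n])
    then have "mtrace (C * g * (?A * (t * ?B))) = mtrace (?B * (C * g * ?A * t))"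
      using mtrace_comm[OF m c(2)] by simp
    also have "\<dots> * \<xi> ^ k = mtrace (\<xi> ^ k \<cdot>\<^sub>m (?B * (C * g * ?A * t)))"
      by (subst mtrace_smult[OF mult_carrier_mat[OF c(2) m]]) (rule mult.commute)
    also have "\<xi> ^ k \<cdot>\<^sub>m (?B * (C * g * ?A * t)) = (\<xi> ^ k \<cdot>\<^sub>m (?B * C)) * (g * ?A * t)"
      using C gc c tc by (simp add: assoc_mult_mat[of _ ?n ?n _ ?n _ ?n] mult_smult_assoc_mat[of _ ?n ?n _ ?n])
    also have "\<dots> = C * ?B * (g * ?A * t)"
      by (simp add: qcomm_pow[OF C E CE])
    also have "\<dots> = C * (?B * g) * (?A * t)"
      using C gc c tc by (simp add: assoc_mult_mat[of _ ?n ?n _ ?n _ ?n])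
    also have "\<dots> = C * g * (?B * ?A * t)"
      unfolding gEi[symmetric] using C gc c tc by (simp add: assoc_mult_mat[of _ ?n ?n _ ?n _ ?n])
    also have "?B * ?A = ?E ^\<^sub>m (d - 1)"
      using k by (simp flip: pow_mat_add[OF E])
    finally show ?thesis using Ht[OF k] by simp
  qed
  have \<xi>0: "\<xi> \<noteq> 0" using \<xi> d by (cases "\<xi> = 0") (auto simp: power_0_left)
  have "mtrace (C * g) = mtrace (C * g * (?\<pi> * h))"
    using C gc by (simp add: h(2) right_mult_one_mat[of _ ?n ?n])
  also have "\<dots> = (\<Sum>r<?n. \<Sum>m<?n. (C * g) $$ (r, m) * (\<Sum>i<d. \<Sum>a<?n. ?\<pi> $$ (m, i * ?n + a) * h $$ (i * ?n + a, r)))"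
    unfolding mtrace_mult[OF Cg mult_carrier_mat[OF free_proj_carrier hc]]
    by (simp add: index_mult_mat_pair[OF free_proj_carrier hc] del: index_mult_mat)
  also have "\<dots> = (\<Sum>r<?n. \<Sum>m<?n. (C * g) $$ (r, m) * (\<Sum>i<d. (?E ^\<^sub>m i * H i) $$ (m, r)))"
    by (intro sum.cong refl arg_cong2[of _ _ _ _ "(*)"])
      (simp add: index_mult_mat_sum[OF Ei Hc] index_free_proj H del: index_mult_mat)
  also have "\<dots> = (\<Sum>r<?n. \<Sum>i<d. \<Sum>m<?n. (C * g) $$ (r, m) * (?E ^\<^sub>m i * H i) $$ (m, r))"
    by (subst sum.swap) (simp add: sum_distrib_left)
  also have "\<dots> = (\<Sum>i<d. \<Sum>r<?n. \<Sum>m<?n. (C * g) $$ (r, m) * (?E ^\<^sub>m i * H i) $$ (m, r))"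
    by (rule sum.swap)
  also have "\<dots> = (\<Sum>i<d. mtrace (C * g * (?E ^\<^sub>m i * H i)))"
    unfolding mtrace_mult[OF Cg mult_carrier_mat[OF Ei Hc]] ..
  also have "\<dots> = (\<Sum>k<d. mtrace (C * g * (?E ^\<^sub>m (d - 1 - k) * H (d - 1 - k))))"
    by (rule sum.reindex_bij_witness[of _ "\<lambda>k. d - 1 - k" "\<lambda>k. d - 1 - k"]) auto
  also have "\<dots> = (\<Sum>k<d. mtrace (C * g * (?E ^\<^sub>m (d - 1) * t)) * inverse \<xi> ^ k)"
  proof (intro sum.cong refl)
    fix k assume "k \<in> {..<d}"
    then show "mtrace (C * g * (?E ^\<^sub>m (d - 1 - k) * H (d - 1 - k))) =
        mtrace (C * g * (?E ^\<^sub>m (d - 1) * t)) * inverse \<xi> ^ k"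
      using tr[of k, symmetric] \<xi>0 by (simp add: power_inverse)
  qed
  also have "\<dots> = mtrace (C * g * (?E ^\<^sub>m (d - 1) * t)) * (\<Sum>k<d. inverse \<xi> ^ k)"
    by (simp add: sum_distrib_left)
  also have "(\<Sum>k<d. inverse \<xi> ^ k) = 0"
    using \<xi> by (subst geometric_sum) (auto simp: power_inverse)
  finally show ?thesis by simp
qed

section \<open>Modules over the double and the quotient category\<close>

text \<open>Shape conditions common to arbitrary modules, the simple modules and their tensor
  products. In the trace arguments the relations of D(B) enter through the B-projective module in
  the middle of a factorization.\<close>

definition db_carrier :: "db_rep \<Rightarrow> bool" where
  "db_carrier M \<longleftrightarrow> (\<forall>g. gen_mat M g \<in> carrier_mat (rdim M) (rdim M))"

lemma db_carrierD:
  assumes "db_carrier M"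
  shows "actE M \<in> carrier_mat (rdim M) (rdim M)" "actF M \<in> carrier_mat (rdim M) (rdim M)"
    "actK M \<in> carrier_mat (rdim M) (rdim M)" "actz M \<in> carrier_mat (rdim M) (rdim M)"
  using assms unfolding db_carrier_def by (metis gen_mat.simps)+

lemma db_carrierI:
  assumes "actE M \<in> carrier_mat (rdim M) (rdim M)" "actF M \<in> carrier_mat (rdim M) (rdim M)"
    "actK M \<in> carrier_mat (rdim M) (rdim M)" "actz M \<in> carrier_mat (rdim M) (rdim M)"
  shows "db_carrier M"
  unfolding db_carrier_def
proof
  fix g show "gen_mat M g \<in> carrier_mat (rdim M) (rdim M)" using assms by (cases g) auto
qed

lemma db_module_carrier: "db_module d \<zeta> M \<Longrightarrow> db_carrier M"
  by (rule db_carrierI) (auto simp: db_module_def Let_def)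

lemma word_mat_Nil [simp]: "word_mat M [] = 1\<^sub>m (rdim M)"
  and word_mat_Cons: "word_mat M (g # w) = gen_mat M g * word_mat M w"
  by (simp_all add: word_mat_def)

lemma gen_mat_carrier: "db_carrier M \<Longrightarrow> gen_mat M g \<in> carrier_mat (rdim M) (rdim M)"
  by (simp add: db_carrier_def)

lemma word_mat_carrier: "db_carrier M \<Longrightarrow> word_mat M w \<in> carrier_mat (rdim M) (rdim M)"
  by (induction w) (auto simp: word_mat_Cons intro: mult_carrier_mat gen_mat_carrier)

lemma word_mat_append:
  assumes "db_carrier M"
  shows "word_mat M (v @ w) = word_mat M v * word_mat M w"
proof (induction v)
  case Nil
  then show ?case using word_mat_carrier[OF assms, of w] by simp
next
  case (Cons g v)
  then show ?case
    by (simp add: word_mat_Cons assoc_mult_mat[OF gen_mat_carrier word_mat_carrier word_mat_carrier] assms)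
qed

lemma word_mat_replicate:
  assumes "db_carrier M"
  shows "word_mat M (replicate n g) = gen_mat M g ^\<^sub>m n"
proof (induction n)
  case 0
  then show ?case using gen_mat_carrier[OF assms, of g] by simp
next
  case (Suc n)
  then show ?case
    by (simp add: word_mat_Cons pow_mat_Suc_left[OF gen_mat_carrier[OF assms]] del: pow_mat.simps(2))
qed

lemma act_carrier [simp]: "act M x \<in> carrier_mat (rdim M) (rdim M)"
  by (simp add: act_def)

lemma act_word: "db_carrier M \<Longrightarrow> act M [(1, w)] = word_mat M w"
  using word_mat_carrier[of M w] by (intro eq_matI) (auto simp: act_def)

lemma hom_word:
  assumes M: "db_carrier M" and N: "db_carrier N" and f: "f \<in> db_hom M N"
  shows "f * word_mat M w = word_mat N w * f"
proof (induction w)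
  case Nil
  then show ?case using f by (auto simp: db_hom_def)
next
  case (Cons g w)
  have fc: "f \<in> carrier_mat (rdim N) (rdim M)" using f by (simp add: db_hom_def)
  have "f * gen_mat M g = gen_mat N g * f" using f by (cases g) (auto simp: db_hom_def)
  then have "f * word_mat M (g # w) = gen_mat N g * f * word_mat M w"
    by (simp add: word_mat_Cons flip: assoc_mult_mat[OF fc gen_mat_carrier[OF M] word_mat_carrier[OF M]])
  also have "\<dots> = gen_mat N g * (word_mat N w * f)"
    using Cons by (simp add: assoc_mult_mat[OF gen_mat_carrier[OF N] fc word_mat_carrier[OF M]])
  also have "\<dots> = word_mat N (g # w) * f"
    by (simp add: word_mat_Cons assoc_mult_mat[OF gen_mat_carrier[OF N] word_mat_carrier[OF N] fc])
  finally show ?case .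
qed

lemma smult_1_mat [simp]: "(1 :: complex) \<cdot>\<^sub>m A = A"
  by (auto intro!: eq_matI)

lemma smult_smult_mat [simp]: "a \<cdot>\<^sub>m (b \<cdot>\<^sub>m A) = (a * b :: complex) \<cdot>\<^sub>m A"
  by (auto intro!: eq_matI)

text \<open>Since z is central, only the letters K contribute a factor.\<close>

lemma word_qcomm_E:
  assumes P: "db_module d \<zeta> P" and w: "set w \<subseteq> {gK, gz}"
  shows "word_mat P w * actE P = \<zeta> ^ count_list w gK \<cdot>\<^sub>m (actE P * word_mat P w)"
  using w
proof (induction w)
  case Nil
  then show ?case using db_carrierD(1)[OF db_module_carrier[OF P]] by simp
next
  case (Cons g w)
  note c = db_module_carrier[OF P]
  note cg = gen_mat_carrier[OF c] and cw = word_mat_carrier[OF c] and cE = db_carrierD(1)[OF c]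
  define q where "q = (if g = gK then \<zeta> else 1)"
  have g: "gen_mat P g * actE P = q \<cdot>\<^sub>m (actE P * gen_mat P g)"
    using Cons.prems P by (cases g) (auto simp: q_def db_module_def Let_def)
  have "word_mat P (g # w) * actE P = gen_mat P g * (word_mat P w * actE P)"
    by (simp add: word_mat_Cons assoc_mult_mat[OF cg cw cE])
  also have "\<dots> = \<zeta> ^ count_list w gK \<cdot>\<^sub>m (gen_mat P g * actE P * word_mat P w)"
    using Cons by (simp add: mult_smult_distrib[OF cg mult_carrier_mat[OF cE cw]] assoc_mult_mat[OF cg cE cw])
  also have "\<dots> = (\<zeta> ^ count_list w gK * q) \<cdot>\<^sub>m (actE P * word_mat P (g # w))"
    by (simp add: g mult_smult_assoc_mat[OF mult_carrier_mat[OF cE cg] cw] word_mat_Cons assoc_mult_mat[OF cE cg cw])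
  also have "\<zeta> ^ count_list w gK * q = \<zeta> ^ count_list (g # w) gK"
    by (simp add: q_def)
  finally show ?case .
qed

section \<open>The ideal of morphisms factoring through B-projective modules, and traces on the
  quotient\<close>

lemma factors_hom:
  assumes "db_carrier M" "db_carrier N" "factors_proj_B d \<zeta> M N f"
  shows "f \<in> carrier_mat (rdim N) (rdim M)"
  using assms by (auto simp: factors_proj_B_def db_hom_def)

lemma hom_comp:
  assumes L: "db_carrier L" and M: "db_carrier M" and N: "db_carrier N"
    and f: "f \<in> db_hom L M" and g: "g \<in> db_hom M N"
  shows "g * f \<in> db_hom L N"
proof -
  have fc: "f \<in> carrier_mat (rdim M) (rdim L)" and gc: "g \<in> carrier_mat (rdim N) (rdim M)"
    using f g by (auto simp: db_hom_def)
  have *: "g * f * gen_mat L x = gen_mat N x * (g * f)" for x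
  proof -
    have fx: "f * gen_mat L x = gen_mat M x * f" and gx: "g * gen_mat M x = gen_mat N x * g"
      using f g by (cases x; simp add: db_hom_def)+
    have "g * f * gen_mat L x = g * (gen_mat M x * f)"
      by (simp add: assoc_mult_mat[OF gc fc gen_mat_carrier[OF L]] fx)
    also have "\<dots> = gen_mat N x * g * f"
      by (simp add: assoc_mult_mat[OF gc gen_mat_carrier[OF M] fc, symmetric] gx)
    also have "\<dots> = gen_mat N x * (g * f)"
      by (rule assoc_mult_mat[OF gen_mat_carrier[OF N] gc fc])
    finally show ?thesis .
  qed
  show ?thesis
    using *[of gE] *[of gF] *[of gK] *[of gz] mult_carrier_mat[OF gc fc] by (simp add: db_hom_def)
qed

text \<open>If f = b a with middle module P, cyclicity of the trace replaces f on M by the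
  endomorphism a b of P, and the word can be carried across because b is a morphism. The number of
  letters K supplies the parameter \<xi> of \<open>mtrace_projective\<close>; it is 1 for the pivot
  and d - 1 for its inverse.\<close>

lemma mtrace_word_factors:
  assumes d: "d > 0" and z1: "\<zeta> ^ d = 1" and M: "db_carrier M" and f: "factors_proj_B d \<zeta> M M f"
    and w: "set w \<subseteq> {gK, gz}" and wz: "\<zeta> ^ count_list w gK \<noteq> 1"
  shows "mtrace (word_mat M w * f) = 0"
proof -
  obtain P a b where P: "db_module d \<zeta> P" "b_projective d \<zeta> P"
    and a: "a \<in> db_hom M P" and b: "b \<in> db_hom P M" and f: "f = b * a"
    using f by (auto simp: factors_proj_B_def db_proj_B_def)
  note c = db_module_carrier[OF P(1)]
  have ac: "a \<in> carrier_mat (rdim P) (rdim M)" and bc: "b \<in> carrier_mat (rdim M) (rdim P)"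
    using a b by (auto simp: db_hom_def)
  have ab: "a * b \<in> db_hom P P" by (rule hom_comp[OF c M c b a])
  have "mtrace (word_mat M w * f) = mtrace (b * word_mat P w * a)"
    unfolding f hom_word[OF c M b] by (simp add: assoc_mult_mat[OF word_mat_carrier[OF M] bc ac])
  also have "\<dots> = mtrace (b * (word_mat P w * a))"
    by (simp add: assoc_mult_mat[OF bc word_mat_carrier[OF c] ac])
  also have "\<dots> = mtrace (word_mat P w * a * b)"
    by (rule mtrace_comm[OF bc mult_carrier_mat[OF word_mat_carrier[OF c] ac]])
  also have "\<dots> = mtrace (word_mat P w * (a * b))"
    by (simp add: assoc_mult_mat[OF word_mat_carrier[OF c] ac bc])
  also have "\<dots> = 0"
  proof (rule mtrace_projective[OF d z1 _ wz P(2)])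
    show "(\<zeta> ^ count_list w gK) ^ d = 1" using z1 by (metis power_mult mult.commute power_one)
  qed (use ab word_mat_carrier[OF c] word_qcomm_E[OF P(1) w] in \<open>auto simp: db_hom_def\<close>)
  finally show ?thesis .
qed

lemma gpow_minus_one: "d \<ge> 2 \<Longrightarrow> gpow d g (- 1) = replicate (d - 1) g"
  by (simp add: gpow_def zmod_minus1 nat_diff_distrib)

lemma count_list_replicate: "count_list (replicate n x) y = (if x = y then n else 0)"
  by (induction n) auto

lemma Tr_plus_factors:
  assumes d: "d \<ge> 2" and z: "primitive_root_of_unity d \<zeta>" and M: "db_carrier M"
    and f: "factors_proj_B d \<zeta> M M f"
  shows "Tr_plus d M f = 0"
proof -
  have "\<zeta> ^ 1 \<noteq> 1" using d z unfolding primitive_root_of_unity_def by (auto dest: spec[of _ 1])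
  then show ?thesis
    unfolding Tr_plus_def act_word[OF M] using d z
    by (intro mtrace_word_factors[OF _ _ M f])
      (auto simp: gpow_minus_one primitive_root_of_unity_def count_list_replicate)
qed

lemma Tr_minus_factors:
  assumes d: "d \<ge> 2" and z: "primitive_root_of_unity d \<zeta>" and M: "db_carrier M"
    and f: "factors_proj_B d \<zeta> M M f"
  shows "Tr_minus d M f = 0"
proof -
  have "\<zeta> ^ (d - 1) \<noteq> 1" using d z unfolding primitive_root_of_unity_def by auto
  moreover have "Tr_minus d M f = mtrace (word_mat M (gpow d gK (- 1) @ [gz]) * f)"
    unfolding Tr_minus_def act_word[OF M]
    by (rule mtrace_comm[OF factors_hom[OF M M f] word_mat_carrier[OF M]])
  ultimately show ?thesis
    using d z by (simp only:) (intro mtrace_word_factors[OF _ _ M f],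
      auto simp: gpow_minus_one primitive_root_of_unity_def count_list_replicate)
qed

lemma Tr_plus_diff:
  assumes "db_carrier M" "f \<in> carrier_mat (rdim M) (rdim M)" "g \<in> carrier_mat (rdim M) (rdim M)"
  shows "Tr_plus d M (f - g) = Tr_plus d M f - Tr_plus d M g"
  unfolding Tr_plus_def
  by (simp add: mult_minus_distrib_mat[OF act_carrier assms(2,3)]
    mtrace_minus[OF mult_carrier_mat[OF act_carrier assms(2)] mult_carrier_mat[OF act_carrier assms(3)]])

lemma Tr_minus_diff:
  assumes "db_carrier M" "f \<in> carrier_mat (rdim M) (rdim M)" "g \<in> carrier_mat (rdim M) (rdim M)"
  shows "Tr_minus d M (f - g) = Tr_minus d M f - Tr_minus d M g"
  unfolding Tr_minus_def
  by (simp add: minus_mult_distrib_mat[OF assms(2,3) act_carrier]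
    mtrace_minus[OF mult_carrier_mat[OF assms(2) act_carrier] mult_carrier_mat[OF assms(3) act_carrier]])

text \<open>The zero module serves as the middle object. This makes the congruence reflexive, so
  that a morphism belongs to its own class.\<close>

lemma factors_zero:
  assumes d: "d > 0" and "db_carrier M" "db_carrier N"
  shows "factors_proj_B d \<zeta> M N (0\<^sub>m (rdim N) (rdim M))"
proof -
  let ?O = "0\<^sub>m 0 0 :: complex mat"
  let ?P = "\<lparr>rdim = 0, actE = ?O, actK = ?O, actF = ?O, actz = ?O\<rparr>"
  \<comment> \<open>Any two matrices without columns and of the same height agree, so every relation
    and every lifting problem for the zero module is solved at once.\<close>
  have e: "A = B" if "A \<in> carrier_mat n 0" "B \<in> carrier_mat n 0" for A B :: "complex mat" and n
    using that by (intro eq_matI) auto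
  have p: "?O ^\<^sub>m k = ?O" for k by (rule e[of _ 0]) auto
  have "db_module d \<zeta> ?P"
    by (simp add: db_module_def p) (auto intro: e[of _ 0])
  moreover have "b_projective d \<zeta> ?P"
  proof -
    have "\<exists>h'\<in>b_hom ?P X. g * h' = h"
      if X: "b_module d \<zeta> X" and "g \<in> b_hom X Y" "h \<in> b_hom ?P Y" for X Y :: b_rep and g h
    proof (rule bexI[of _ "0\<^sub>m (rdim X) 0"])
      show "g * 0\<^sub>m (rdim X) 0 = h"
        using that by (intro e[of _ "rdim Y"]) (auto simp: b_hom_def)
      show "0\<^sub>m (rdim X) 0 \<in> b_hom ?P X"
        using X by (auto simp: b_hom_def b_module_def Let_def intro!: e[of _ "rdim X"])
    qed
    moreover have "b_module d \<zeta> ?P"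
      by (simp add: b_module_def p) (auto intro: e[of _ 0])
    ultimately show ?thesis unfolding b_projective_def by blast
  qed
  moreover have "0\<^sub>m 0 (rdim M) \<in> db_hom M ?P" "0\<^sub>m (rdim N) 0 \<in> db_hom ?P N"
    using db_carrierD[OF assms(2)] db_carrierD[OF assms(3)] by (auto simp: db_hom_def intro!: eq_matI)
  moreover have "0\<^sub>m (rdim N) (rdim M) = 0\<^sub>m (rdim N) 0 * 0\<^sub>m 0 (rdim M)"
    by (auto intro!: eq_matI)
  ultimately show ?thesis unfolding factors_proj_B_def db_proj_B_def by blast
qed

text \<open>Membership needs the matrix itself to be a morphism; this is where the intertwining
  property of the braiding is indispensable.\<close>

lemma in_stab_class:
  assumes "d > 0" "db_carrier M" "db_carrier N" "f \<in> db_hom M N"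
  shows "f \<in> stab_class d \<zeta> M N f"
proof -
  have "f - f = 0\<^sub>m (rdim N) (rdim M)" using assms(4) by (auto simp: db_hom_def)
  then show ?thesis using factors_zero[OF assms(1-3), of \<zeta>] assms(4) by (simp add: stab_class_def)
qed

lemma the_elem_image:
  assumes "x \<in> A" "\<And>y. y \<in> A \<Longrightarrow> f y = c"
  shows "the_elem (f ` A) = c"
proof -
  have "f ` A = {c}" using assms by auto
  then show ?thesis by simp
qed

lemma Tr_plus_class:
  assumes "d \<ge> 2" "primitive_root_of_unity d \<zeta>" "db_carrier M" "f \<in> carrier_mat (rdim M) (rdim M)" "g \<in> stab_class d \<zeta> M M f"
  shows "Tr_plus d M g = Tr_plus d M f"
  using Tr_plus_diff[of M g f d] Tr_plus_factors[OF assms(1-3), of "g - f"] assms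
  by (simp add: stab_class_def db_hom_def)

lemma Tr_minus_class:
  assumes "d \<ge> 2" "primitive_root_of_unity d \<zeta>" "db_carrier M" "f \<in> carrier_mat (rdim M) (rdim M)" "g \<in> stab_class d \<zeta> M M f"
  shows "Tr_minus d M g = Tr_minus d M f"
  using Tr_minus_diff[of M g f d] Tr_minus_factors[OF assms(1-3), of "g - f"] assms
  by (simp add: stab_class_def db_hom_def)

lemma scalar_hom:
  assumes "db_carrier M"
  shows "t \<cdot>\<^sub>m 1\<^sub>m (rdim M) \<in> db_hom M M"
  using db_carrierD[OF assms]
  by (auto simp: db_hom_def mult_smult_assoc_mat[of _ "rdim M" "rdim M"] mult_smult_distrib[of _ "rdim M" "rdim M"])

lemma stab_dim_plus_eq:
  assumes "d \<ge> 2" "primitive_root_of_unity d \<zeta>" "db_carrier M"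
  shows "stab_dim_plus d \<zeta> M = Tr_plus d M (1\<^sub>m (rdim M))"
  unfolding stab_dim_plus_def stab_Tr_plus_def stab_scalar_def smult_1_mat
  using assms scalar_hom[OF assms(3), of 1]
  by (intro the_elem_image[OF in_stab_class] Tr_plus_class) auto

lemma stab_dim_minus_eq:
  assumes "d \<ge> 2" "primitive_root_of_unity d \<zeta>" "db_carrier M"
  shows "stab_dim_minus d \<zeta> M = Tr_minus d M (1\<^sub>m (rdim M))"
  unfolding stab_dim_minus_def stab_Tr_minus_def stab_scalar_def smult_1_mat
  using assms scalar_hom[OF assms(3), of 1]
  by (intro the_elem_image[OF in_stab_class] Tr_minus_class) auto

text \<open>Composition is absorbed into one leg of the factorization. Together with the next lemma
  this is the ideal property behind well-defined composition of classes.\<close>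

lemma factors_comp_left:
  assumes L: "db_carrier L" and M: "db_carrier M" and N: "db_carrier N"
    and f: "f \<in> db_hom L M" and g: "factors_proj_B d \<zeta> M N g"
  shows "factors_proj_B d \<zeta> L N (g * f)"
proof -
  obtain P a b where P: "P \<in> db_proj_B d \<zeta>" and ab: "a \<in> db_hom M P" "b \<in> db_hom P N" "g = b * a"
    using g by (auto simp: factors_proj_B_def)
  have "db_carrier P" using P by (auto simp: db_proj_B_def dest: db_module_carrier)
  then have "a * f \<in> db_hom L P" using hom_comp[OF L M _ f ab(1)] by blast
  moreover have "g * f = b * (a * f)"
    using ab f by (auto simp: db_hom_def intro!: assoc_mult_mat)
  ultimately show ?thesis using P ab by (auto simp: factors_proj_B_def)
qed

lemma factors_comp_right:
  assumes L: "db_carrier L" and M: "db_carrier M" and N: "db_carrier N"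
    and f: "factors_proj_B d \<zeta> L M f" and g: "g \<in> db_hom M N"
  shows "factors_proj_B d \<zeta> L N (g * f)"
proof -
  obtain P a b where P: "P \<in> db_proj_B d \<zeta>" and ab: "a \<in> db_hom L P" "b \<in> db_hom P M" "f = b * a"
    using f by (auto simp: factors_proj_B_def)
  have "db_carrier P" using P by (auto simp: db_proj_B_def dest: db_module_carrier)
  then have "g * b \<in> db_hom P N" using hom_comp[OF _ M N ab(2) g] by blast
  moreover have "g * f = g * b * a"
    using ab g by (auto simp: db_hom_def intro!: assoc_mult_mat[symmetric])
  ultimately show ?thesis using P ab by (auto simp: factors_proj_B_def)
qed

text \<open>For other representatives g' and f', the difference g' f' - g f is (g' - g) f' + g (f' -
  f), and both summands lie in the ideal, on which the trace vanishes.\<close>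

lemma stab_Tr_plus_comp:
  assumes d: "d \<ge> 2" and z: "primitive_root_of_unity d \<zeta>" and L: "db_carrier L" and M: "db_carrier M"
    and f: "f \<in> db_hom L M" and g: "g \<in> db_hom M L"
  shows "stab_Tr_plus d L (stab_comp d \<zeta> L L (stab_class d \<zeta> M L g) (stab_class d \<zeta> L M f)) = Tr_plus d L (g * f)"
  unfolding stab_Tr_plus_def
proof (rule the_elem_image)
  have d0: "d > 0" using d by simp
  show "g * f \<in> stab_comp d \<zeta> L L (stab_class d \<zeta> M L g) (stab_class d \<zeta> L M f)"
    unfolding stab_comp_def
    using in_stab_class[OF d0 L M f, of \<zeta>] in_stab_class[OF d0 M L g, of \<zeta>]
      in_stab_class[OF d0 L L hom_comp[OF L M L f g], of \<zeta>] by blast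
  fix e assume "e \<in> stab_comp d \<zeta> L L (stab_class d \<zeta> M L g) (stab_class d \<zeta> L M f)"
  then obtain g' f' where g': "g' \<in> db_hom M L" "factors_proj_B d \<zeta> M L (g' - g)"
    and f': "f' \<in> db_hom L M" "factors_proj_B d \<zeta> L M (f' - f)" and e: "e \<in> stab_class d \<zeta> L L (g' * f')"
    by (auto simp: stab_comp_def stab_class_def)
  have c: "g \<in> carrier_mat (rdim L) (rdim M)" "g' \<in> carrier_mat (rdim L) (rdim M)"
    "f \<in> carrier_mat (rdim M) (rdim L)" "f' \<in> carrier_mat (rdim M) (rdim L)"
    using f g f' g' by (auto simp: db_hom_def)
  note Tr0 = Tr_plus_factors[OF d z L]
  have "Tr_plus d L e = Tr_plus d L (g' * f')"
    by (rule Tr_plus_class[OF d z L mult_carrier_mat[OF c(2,4)] e])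
  also have "\<dots> = Tr_plus d L (g * f')"
    using Tr0[OF factors_comp_left[OF L M L f'(1) g'(2)]]
    by (simp add: minus_mult_distrib_mat[OF c(2,1,4)]
      Tr_plus_diff[OF L mult_carrier_mat[OF c(2,4)] mult_carrier_mat[OF c(1,4)]])
  also have "\<dots> = Tr_plus d L (g * f)"
    using Tr0[OF factors_comp_right[OF L M L f'(2) g]]
    by (simp add: mult_minus_distrib_mat[OF c(1,4,3)]
      Tr_plus_diff[OF L mult_carrier_mat[OF c(1,4)] mult_carrier_mat[OF c(1,3)]])
  finally show "Tr_plus d L e = Tr_plus d L (g * f)" .
qed

text \<open>A trace that is linear, constant on classes and nonzero on the identity separates the
  scalars. This makes the \<open>THE\<close> in \<open>stab_T\<close> meaningful.\<close>

lemma stab_scalar_inject: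
  assumes d: "d \<ge> 2" and z: "primitive_root_of_unity d \<zeta>" and M: "db_carrier M"
    and dim: "Tr_plus d M (1\<^sub>m (rdim M)) \<noteq> 0" and eq: "stab_scalar d \<zeta> M s = stab_scalar d \<zeta> M t"
  shows "s = t"
proof -
  have "s \<cdot>\<^sub>m 1\<^sub>m (rdim M) \<in> stab_class d \<zeta> M M (t \<cdot>\<^sub>m 1\<^sub>m (rdim M))"
    using in_stab_class[OF _ M M scalar_hom[OF M, of s]] d eq by (auto simp: stab_scalar_def)
  then have "Tr_plus d M (s \<cdot>\<^sub>m 1\<^sub>m (rdim M)) = Tr_plus d M (t \<cdot>\<^sub>m 1\<^sub>m (rdim M))"
    by (intro Tr_plus_class[OF d z M]) auto
  moreover have "Tr_plus d M (c \<cdot>\<^sub>m 1\<^sub>m (rdim M)) = c * Tr_plus d M (1\<^sub>m (rdim M))" for c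
    unfolding Tr_plus_def
    by (simp add: mult_smult_distrib[OF act_carrier one_carrier_mat]
      mtrace_smult[OF mult_carrier_mat[OF act_carrier one_carrier_mat]])
  ultimately show ?thesis using dim by simp
qed

section \<open>The simple modules in coordinates\<close>

locale taft =
  fixes d :: nat and \<zeta> :: complex
  assumes d: "d \<ge> 2" and \<zeta>: "primitive_root_of_unity d \<zeta>"
begin

abbreviation V :: "nat \<Rightarrow> nat \<Rightarrow> db_rep" where "V l p \<equiv> simple_rep \<zeta> (l, p)"

text \<open>With integer exponents, identities between powers of \<zeta> become polynomial
  identities between exponents, possibly up to multiples of d (\<open>q_cong\<close>). Most later
  computations are reduced to that form.\<close>

definition q :: "int \<Rightarrow> complex" where "q n = \<zeta> powi n"

lemma \<zeta>_pow_d: "\<zeta> ^ d = 1" and \<zeta>_pow_neq: "0 < k \<Longrightarrow> k < d \<Longrightarrow> \<zeta> ^ k \<noteq> 1"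
  using \<zeta> by (auto simp: primitive_root_of_unity_def)

lemma \<zeta>_nonzero [simp]: "\<zeta> \<noteq> 0"
  using \<zeta>_pow_d d by (auto simp: power_0_left)

lemma \<zeta>_neq_1: "\<zeta> \<noteq> 1"
  using \<zeta>_pow_neq[of 1] d by auto

lemma q_add: "q (m + n) = q m * q n"
  by (simp add: q_def power_int_add)

lemma q_minus: "q (- n) = inverse (q n)"
  by (simp add: q_def power_int_minus)

lemma q_diff: "q (m - n) = q m / q n"
  by (simp add: q_def power_int_diff)

lemma q_0 [simp]: "q 0 = 1" and q_1: "q 1 = \<zeta>" and q_nonzero [simp]: "q n \<noteq> 0"
  by (simp_all add: q_def)

lemma q_of_nat: "\<zeta> ^ n = q (int n)"
  by (simp add: q_def)

lemma q_mult: "q (m * n) = q m powi n" "q m ^ k = q (m * int k)"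
  by (simp_all add: q_def power_int_mult)

lemma q_d: "q (int d) = 1"
  using \<zeta>_pow_d by (simp add: q_def)

lemma q_dvd: "int d dvd n \<Longrightarrow> q n = 1"
  by (elim dvdE) (simp add: q_mult(1) q_d)

lemma q_cong: "int d dvd m - n \<Longrightarrow> q m = q n"
  using q_add[of "m - n" n] q_dvd[of "m - n"] by simp

lemma q_mod: "q (n mod int d) = q n" "q (m * (n mod int d)) = q (m * n)"
proof -
  show *: "q (m * (n mod int d)) = q (m * n)" for m
    by (rule q_cong) (simp add: mod_eq_dvd_iff[symmetric] right_diff_distrib[symmetric] mod_mult_right_eq)
  from *[of 1] show "q (n mod int d) = q n" by simp
qed

lemma q_eq_1_iff: "q n = 1 \<longleftrightarrow> int d dvd n"
proof
  assume "q n = 1"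
  then have "q (n mod int d) = 1" by (simp add: q_mod)
  moreover have nn: "n mod int d = int (nat (n mod int d))" using d by simp
  ultimately have "\<zeta> ^ nat (n mod int d) = 1" by (metis q_of_nat)
  moreover have "nat (n mod int d) < d" using d by (simp add: nat_less_iff)
  ultimately have "nat (n mod int d) = 0" using \<zeta>_pow_neq[of "nat (n mod int d)"] by linarith
  then show "int d dvd n" using nn by (simp add: dvd_eq_mod_eq_0)
qed (rule q_dvd)

text \<open>Orthogonality of the characters of Z/d.\<close>

lemma q_geometric: "(\<Sum>j<d. q (int j * n)) = (if int d dvd n then of_nat d else 0)"
proof (cases "int d dvd n")
  case True
  then have "q (int j * n) = 1" for j by (intro q_dvd) simp
  then show ?thesis using True by simp
next
  case False
  have "(\<Sum>j<d. q (int j * n)) = (\<Sum>j<d. q n ^ j)"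
    by (simp add: q_mult(2) mult.commute)
  also have "\<dots> = 0"
    using False by (subst geometric_sum) (simp_all add: q_eq_1_iff q_mult(2) q_dvd)
  finally show ?thesis using False by simp
qed

text \<open>Fourier inversion on Z/d: the sum over j vanishes unless k is congruent to w, and
  exactly one k below d is. The exponent has the shape found in R and in u, where j and k are the
  two summed exponents of K.\<close>

lemma q_double_sum:
  "(\<Sum>j<d. \<Sum>k<d. q (a + b * int k + int j * (w - int k))) = of_nat d * q (a + b * w)"
proof -
  have "(\<Sum>j<d. \<Sum>k<d. q (a + b * int k + int j * (w - int k))) =
      (\<Sum>k<d. q (a + b * int k) * (\<Sum>j<d. q (int j * (w - int k))))"
    by (subst sum.swap) (simp add: q_add sum_distrib_left)
  also have "\<dots> = (\<Sum>k<d. if k = nat (w mod int d) then of_nat d * q (a + b * w) else 0)"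
  proof (rule sum.cong[OF refl])
    fix k assume k: "k \<in> {..<d}"
    have "int d dvd w - int k \<longleftrightarrow> w mod int d = int k mod int d"
      by (rule mod_eq_dvd_iff[symmetric])
    also have "\<dots> \<longleftrightarrow> k = nat (w mod int d)"
      using k d by (auto simp: nat_eq_iff)
    finally have iff: "int d dvd w - int k \<longleftrightarrow> k = nat (w mod int d)" .
    moreover have "q (a + b * int k) = q (a + b * w)" if "int d dvd w - int k"
      using that by (intro q_cong[symmetric]) (simp add: right_diff_distrib[symmetric])
    ultimately show "q (a + b * int k) * (\<Sum>j<d. q (int j * (w - int k))) =
        (if k = nat (w mod int d) then of_nat d * q (a + b * w) else 0)"
      by (simp add: q_geometric)
  qed
  also have "\<dots> = of_nat d * q (a + b * w)"
    using d by (simp add: nat_less_iff)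
  finally show ?thesis .
qed

text \<open>With \<open>e\<close> indexed from \<open>0\<close>, \<open>K\<close> acts on \<open>e\<^sub>a\<close> by \<open>q (wt l p a)\<close>, and \<open>E e\<^sub>a = Ec l p a e\<^bsub>a-1\<^esub>\<close>.\<close>

definition wt :: "nat \<Rightarrow> nat \<Rightarrow> nat \<Rightarrow> int" where
  "wt l p a = int p + int l - 1 - int a"

definition Ec :: "nat \<Rightarrow> nat \<Rightarrow> nat \<Rightarrow> complex" where
  "Ec l p a = q (int p) * qnum \<zeta> a * (q (int l - int a) - 1)"

text \<open>The coefficient of E^i on the basis vector of index a. For i > a the factor with t = a
  is \<open>Ec l p 0 = 0\<close>, so truncated subtraction does no harm.\<close>

definition Eprod :: "nat \<Rightarrow> nat \<Rightarrow> nat \<Rightarrow> nat \<Rightarrow> complex" where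
  "Eprod l p a i = (\<Prod>t<i. Ec l p (a - t))"

lemma qnum_eq: "(\<zeta> - 1) * qnum \<zeta> n = q (int n) - 1"
  by (simp add: qnum_def power_diff_1_eq flip: q_of_nat)

lemma qnum_eq': "qnum \<zeta> n = (q (int n) - 1) / (\<zeta> - 1)"
  using \<zeta>_neq_1 by (simp add: qnum_eq[symmetric])

lemma qnum_nonzero: "0 < n \<Longrightarrow> n < d \<Longrightarrow> qnum \<zeta> n \<noteq> 0"
  using \<zeta>_neq_1 \<zeta>_pow_neq[of n] by (simp add: qnum_eq' q_of_nat)

lemma qfact_0 [simp]: "qfact \<zeta> 0 = 1" and qfact_Suc: "qfact \<zeta> (Suc n) = qfact \<zeta> n * qnum \<zeta> (Suc n)"
  by (simp_all add: qfact_def)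

lemma qfact_nonzero: "n < d \<Longrightarrow> qfact \<zeta> n \<noteq> 0"
  by (induction n) (auto simp: qfact_Suc qnum_nonzero)

text \<open>These two zeros at the ends of the module absorb the boundary conditions in the formulas
  for the action of E.\<close>

lemma Ec_0 [simp]: "Ec l p 0 = 0" and Ec_top [simp]: "Ec l p l = 0"
  by (simp_all add: Ec_def qnum_def)

lemma Eprod_0 [simp]: "Eprod l p a 0 = 1"
  and Eprod_Suc: "Eprod l p a (Suc i) = Eprod l p a i * Ec l p (a - i)"
  by (simp_all add: Eprod_def mult.commute)

lemma Eprod_Suc_Suc: "Eprod l p (Suc a) (Suc i) = Ec l p (Suc a) * Eprod l p a i"
  by (simp add: Eprod_def prod.lessThan_Suc_shift del: prod.lessThan_Suc)

lemma Eprod_eq_0: "a < i \<Longrightarrow> Eprod l p a i = 0"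
  unfolding Eprod_def by (rule prod_zero) (auto intro!: bexI[of _ a])

lemma Eprod_top: "0 < i \<Longrightarrow> Eprod l p l i = 0"
  unfolding Eprod_def by (rule prod_zero) (auto intro!: bexI[of _ 0])

lemma rdim_simple [simp]: "rdim (V l p) = l"
  by (simp add: simple_rep_def)

lemma simple_carrier: "db_carrier (V l p)"
  by (rule db_carrierI) (auto simp: simple_rep_def)

lemma actE_simple: "actE (V l p) = mat l l (\<lambda>(r, s). if s = r + 1 then Ec l p s else 0)"
  by (auto intro!: eq_matI simp: simple_rep_def Ec_def q_of_nat of_nat_diff)

lemma actK_simple: "actK (V l p) = mat l l (\<lambda>(r, s). if r = s then q (wt l p r) else 0)"
  by (auto intro!: eq_matI arg_cong[of _ _ q] simp: simple_rep_def wt_def q_of_nat of_nat_diff)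

lemma actF_simple: "actF (V l p) = mat l l (\<lambda>(r, s). if r = s + 1 then 1 else 0)"
  by (simp add: simple_rep_def)

lemma actz_simple:
  assumes "l > 0"
  shows "actz (V l p) = mat l l (\<lambda>(r, s). if r = s then q (2 * int p + int l - 1) else 0)"
proof -
  have "int (2 * p + l - 1) = 2 * int p + int l - 1" using assms by linarith
  then show ?thesis by (simp only: simple_rep_def smult_one_diag q_of_nat prod.case db_rep.select_convs)
qed

lemma actK_pow: "actK (V l p) ^\<^sub>m n = mat l l (\<lambda>(r, s). if r = s then q (wt l p r * int n) else 0)"
  by (rule eq_matI) (auto simp: actK_simple diag_pow q_mult(2))

lemma actz_pow:
  assumes "l > 0"
  shows "actz (V l p) ^\<^sub>m n =
    mat l l (\<lambda>(r, s). if r = s then q ((2 * int p + int l - 1) * int n) else 0)"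
  using assms by (intro eq_matI) (auto simp: actz_simple diag_pow q_mult(2))

lemma actE_pow:
  "actE (V l p) ^\<^sub>m i = mat l l (\<lambda>(r, s). if s = r + i then Eprod l p s i else 0)"
proof (induction i)
  case 0
  then show ?case by (auto intro!: eq_matI simp: simple_rep_def)
next
  case (Suc i)
  let ?A = "mat l l (\<lambda>(r, s). if s = r + i then Eprod l p s i else 0)"
  let ?E = "actE (V l p)"
  have "?A * ?E = mat l l (\<lambda>(r, s). if s = r + Suc i then Eprod l p s (Suc i) else 0)" (is "_ = ?C")
  proof (rule eq_matI)
    fix r s assume "r < dim_row ?C" "s < dim_col ?C"
    then have rs: "r < l" "s < l" by auto
    have "(?A * ?E) $$ (r, s) = (\<Sum>m<l. ?A $$ (r, m) * ?E $$ (m, s))"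
      using rs by (intro index_mult_mat_sum) (auto simp: actE_simple)
    also have "\<dots> = (\<Sum>m<l. if m = r + i then if s = Suc m then Eprod l p m i * Ec l p s else 0 else 0)"
      using rs by (intro sum.cong refl) (auto simp: actE_simple)
    also have "\<dots> = ?C $$ (r, s)"
      using rs Eprod_Suc_Suc[of l p "r + i" i] by (auto simp: mult.commute)
    finally show "(?A * ?E) $$ (r, s) = ?C $$ (r, s)" .
  qed (auto simp: actE_simple)
  then show ?case using Suc by simp
qed

lemma actF_pow:
  "actF (V l p) ^\<^sub>m i = mat l l (\<lambda>(r, s). if r = s + i then 1 else 0)"
proof -
  have "actF (V l p) = shift_mat l" by (simp add: actF_simple shift_mat_def)
  then show ?thesis by (simp add: shift_mat_pow)
qed

lemma gpow_exponent: "gpow d g n = replicate (nat (n mod int d)) g" "int (nat (n mod int d)) = n mod int d"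
  using d by (simp_all add: gpow_def)

lemma word_gpow_K: "word_mat (V l p) (gpow d gK n) =
    mat l l (\<lambda>(r, s). if r = s then q (wt l p r * n) else 0)"
  using d by (intro eq_matI) (auto simp: gpow_exponent word_mat_replicate[OF simple_carrier] actK_pow q_mod)

lemma word_gpow_z:
  assumes "l > 0"
  shows "word_mat (V l p) (gpow d gz n) =
    mat l l (\<lambda>(r, s). if r = s then q ((2 * int p + int l - 1) * n) else 0)"
  using assms d
  by (intro eq_matI) (auto simp: gpow_exponent word_mat_replicate[OF simple_carrier] actz_pow q_mod)

lemma word_pivot:
  assumes "l > 0" "a < l" "b < l"
  shows "word_mat (V l p) (gpow d gz (- 1) @ [gK]) $$ (a, b) =
    (if a = b then q (- (int p + int a)) else 0)"
    "word_mat (V l p) (gpow d gK (- 1) @ [gz]) $$ (a, b) =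
    (if a = b then q (int p + int a) else 0)"
proof -
  have 1: "word_mat (V l p) (gpow d gz (- 1) @ [gK]) =
    mat l l (\<lambda>(r, s). if r = s then q ((2 * int p + int l - 1) * - 1) else 0) * actK (V l p)"
    using assms db_carrierD(3)[OF simple_carrier, of l p]
    by (simp add: word_mat_append[OF simple_carrier] word_gpow_z word_mat_Cons)
  have 2: "word_mat (V l p) (gpow d gK (- 1) @ [gz]) =
    mat l l (\<lambda>(r, s). if r = s then q (wt l p r * - 1) else 0) * actz (V l p)"
    using assms db_carrierD(4)[OF simple_carrier, of l p]
    by (simp add: word_mat_append[OF simple_carrier] word_gpow_K word_mat_Cons)
  show "word_mat (V l p) (gpow d gz (- 1) @ [gK]) $$ (a, b) =
    (if a = b then q (- (int p + int a)) else 0)"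
    unfolding 1 using assms
    by (subst index_mult_diag_left) (auto simp: actK_simple wt_def simp flip: q_add intro!: arg_cong[of _ _ q])
  show "word_mat (V l p) (gpow d gK (- 1) @ [gz]) $$ (a, b) =
    (if a = b then q (int p + int a) else 0)"
    unfolding 2 using assms
    by (subst index_mult_diag_left) (auto simp: actz_simple wt_def simp flip: q_add intro!: arg_cong[of _ _ q])
qed

section \<open>The braiding of two simple modules\<close>

lemma act_EK:
  assumes "a < l" "a' < l"
  shows "act (V l p) (EK i j) $$ (a, a') =
    (if a' = a + i then Eprod l p a' i * q (wt l p a' * int j) else 0)"
proof -
  have "act (V l p) (EK i j) =
      mat l l (\<lambda>(r, s). if s = r + i then Eprod l p s i else 0) *
      mat l l (\<lambda>(r, s). if r = s then q (wt l p r * int j) else 0)"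
    by (simp add: EK_def act_word[OF simple_carrier] word_mat_append[OF simple_carrier]
      word_mat_replicate[OF simple_carrier] actE_pow actK_pow)
  then show ?thesis using assms by (simp add: index_mult_diag_right del: index_mult_mat)
qed

definition tri :: "nat \<Rightarrow> int" where "tri i = int (i * (i + 1) div 2)"

lemma tri_Suc: "tri (Suc i) = tri i + int i + 1"
proof -
  have "Suc i * (Suc i + 1) = i * (i + 1) + (Suc i) * 2" by (simp add: algebra_simps)
  then have "Suc i * (Suc i + 1) div 2 = i * (i + 1) div 2 + Suc i"
    by (metis div_mult_self1 zero_neq_numeral add.commute)
  then show ?thesis unfolding tri_def by simp
qed

lemma tri_0 [simp]: "tri 0 = 0"
  by (simp add: tri_def)

lemma act_beta:
  assumes "b < l" "b' < l" "l > 0"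
  shows "act (V l p) (beta d \<zeta> i j) $$ (b, b') = (if b = b' + i then
    \<Sum>k<d. 1 / of_nat d * (q ((int i - int k) * (int i + int j) - tri i) / qfact \<zeta> i) *
      q (- (int p + int b') * int k) else 0)"
proof -
  let ?M = "V l p" let ?s = "2 * int p + int l - 1"
  let ?D = "\<lambda>c. mat l l (\<lambda>(r, s). if r = s then c r else 0) :: complex mat"
  let ?F = "mat l l (\<lambda>(r, s). if r = s + i then 1 else 0) :: complex mat"
  have F: "?F \<in> carrier_mat l l" by simp
  have w: "word_mat ?M (gpow d gz (- int k) @ replicate i gF @ replicate k gK) $$ (b, b') =
    (if b = b' + i then q (- (int p + int b') * int k) else 0)" for k
  proof -
    have "word_mat ?M (gpow d gz (- int k) @ replicate i gF @ replicate k gK) =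
        ?D (\<lambda>_. q (?s * - int k)) * (?F * ?D (\<lambda>r. q (wt l p r * int k)))"
      using assms(3)
      by (simp only: word_mat_append[OF simple_carrier] word_gpow_z word_mat_replicate[OF simple_carrier]
        gen_mat.simps actF_pow actK_pow)
    then have "word_mat ?M (gpow d gz (- int k) @ replicate i gF @ replicate k gK) $$ (b, b') =
        q (?s * - int k) * (?F $$ (b, b') * q (wt l p b' * int k))"
      using assms
      by (simp only: index_mult_diag_left[OF mult_carrier_mat[OF F mat_carrier]] index_mult_diag_right[OF F])
    also have "\<dots> = (if b = b' + i then q (?s * - int k + wt l p b' * int k) else 0)"
      by (simp only: q_add) (use assms in simp)
    also have "?s * - int k + wt l p b' * int k = - (int p + int b') * int k"
      by (simp add: wt_def algebra_simps)
    finally show ?thesis .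
  qed
  have "act ?M (beta d \<zeta> i j) $$ (b, b') = (\<Sum>k\<leftarrow>[0..<d].
     (1 / of_nat d * (\<zeta> powi ((int i - int k) * (int i + int j) - int (i * (i + 1) div 2)) / qfact \<zeta> i)) *
     word_mat ?M (gpow d gz (- int k) @ replicate i gF @ replicate k gK) $$ (b, b'))"
    using assms by (simp add: act_def beta_def o_def)
  also have "\<dots> = (\<Sum>k<d.
     (1 / of_nat d * (q ((int i - int k) * (int i + int j) - tri i) / qfact \<zeta> i)) *
     (if b = b' + i then q (- (int p + int b') * int k) else 0))"
    by (simp only: w interv_sum_list_conv_sum_set_nat set_upt lessThan_atLeast0 q_def tri_def)
  finally show ?thesis by auto
qed

text \<open>The coefficient of \<open>e\<^bsub>a-i\<^esub> \<otimes> e\<^bsub>b+i\<^esub>\<close> in \<open>R (e\<^sub>a \<otimes> e\<^sub>b)\<close>.\<close>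

definition Rc :: "nat \<Rightarrow> nat \<Rightarrow> nat \<Rightarrow> nat \<Rightarrow> nat \<Rightarrow> nat \<Rightarrow> complex" where
  "Rc l p p' a b i = q (- wt l p a * int i - tri i - (int p' + int b) * (int i + wt l p a)) *
     Eprod l p a i / qfact \<zeta> i"

text \<open>The entry of R in row (a, b) and column (a', b'). It makes sense also for indices beyond
  the ends of the modules, so the intertwining identities can be stated without case distinctions at
  the boundary.\<close>

definition Rent :: "nat \<Rightarrow> nat \<Rightarrow> nat \<Rightarrow> nat \<Rightarrow> nat \<Rightarrow> nat \<Rightarrow> nat \<Rightarrow> complex" where
  "Rent l p p' a b a' b' = (if a + b = a' + b' \<and> a \<le> a' then Rc l p p' a' b' (a' - a) else 0)"

lemma index_R_mat:
  assumes "a < l" "a' < l" "b < l'" "b' < l'" "l \<le> d" "l' > 0"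
  shows "R_mat d \<zeta> (V l p) (V l' p') $$ (a * l' + b, a' * l' + b') =
    Rent l p p' a b a' b'"
proof -
  let ?M = "V l p" let ?N = "V l' p'"
  have c: "act ?M x \<in> carrier_mat l l" "act ?N x \<in> carrier_mat l' l'" for x
    using act_carrier[of ?M x] act_carrier[of ?N x] by auto
  have e: "kron (act ?M (EK i j)) (act ?N (beta d \<zeta> i j)) $$ (a * l' + b, a' * l' + b') =
     (if a' = a + i \<and> b = b' + i then \<Sum>k<d. Eprod l p a' i / qfact \<zeta> i / of_nat d *
       q ((int i * int i - tri i) + (- int i - (int p' + int b')) * int k + int j * ((wt l p a' + int i) - int k)) else 0)"
    for i j
  proof -
    \<comment> \<open>The exponents are regrouped as a constant, a multiple of k, and j times (w -
      k) with \<open>w = wt l p a' + int i\<close>, the pattern of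
      \<open>q_double_sum\<close>.\<close>
    let ?X = "\<lambda>k. (int i * int i - tri i) + (- int i - (int p' + int b')) * int k + int j * ((wt l p a' + int i) - int k)"
    have Q: "q (wt l p a' * int j) * q ((int i - int k) * (int i + int j) - tri i) * q (- (int p' + int b') * int k) =
      q (?X k)" for k
      unfolding q_add[symmetric] by (rule arg_cong[of _ _ q]) (simp add: algebra_simps)
    have "kron (act ?M (EK i j)) (act ?N (beta d \<zeta> i j)) $$ (a * l' + b, a' * l' + b') =
      act ?M (EK i j) $$ (a, a') * act ?N (beta d \<zeta> i j) $$ (b, b')"
      using assms by (intro index_kron[OF c(1) c(2)])
    also have "\<dots> = (if a' = a + i \<and> b = b' + i then \<Sum>k<d. Eprod l p a' i / qfact \<zeta> i / of_nat d *
      (q (wt l p a' * int j) * q ((int i - int k) * (int i + int j) - tri i) * q (- (int p' + int b') * int k)) else 0)"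
      using assms by (simp add: act_EK act_beta sum_distrib_left mult_ac)
    finally show ?thesis unfolding Q .
  qed
  have "R_mat d \<zeta> ?M ?N $$ (a * l' + b, a' * l' + b') =
     (\<Sum>i<d. \<Sum>j<d. kron (act ?M (EK i j)) (act ?N (beta d \<zeta> i j)) $$ (a * l' + b, a' * l' + b'))"
    using assms by (simp add: R_mat_def pair_index_less)
  also have "\<dots> = (\<Sum>i<d. if a' = a + i \<and> b = b' + i then
     Eprod l p a' i / qfact \<zeta> i / of_nat d * (\<Sum>j<d. \<Sum>k<d.
       q ((int i * int i - tri i) + (- int i - (int p' + int b')) * int k + int j * ((wt l p a' + int i) - int k))) else 0)"
    unfolding e
  proof (intro sum.cong refl)
    fix i
    show "(\<Sum>j<d. if a' = a + i \<and> b = b' + i then \<Sum>k<d. Eprod l p a' i / qfact \<zeta> i / of_nat d *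
       q ((int i * int i - tri i) + (- int i - (int p' + int b')) * int k + int j * ((wt l p a' + int i) - int k)) else 0) =
     (if a' = a + i \<and> b = b' + i then Eprod l p a' i / qfact \<zeta> i / of_nat d * (\<Sum>j<d. \<Sum>k<d.
       q ((int i * int i - tri i) + (- int i - (int p' + int b')) * int k + int j * ((wt l p a' + int i) - int k))) else 0)"
    proof (cases "a' = a + i \<and> b = b' + i")
      case True
      show ?thesis unfolding if_P[OF True] by (simp add: sum_distrib_left)
    next
      case False
      show ?thesis unfolding if_not_P[OF False] by simp
    qed
  qed
  \<comment> \<open>Both index conditions leave the single candidate i = a' - a, which lies below d
    because a' < l and l is at most d.\<close>
  also have "\<dots> = (\<Sum>i<d. if i = a' - a then if a' = a + i \<and> b = b' + i then Rc l p p' a' b' i else 0 else 0)"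
  proof (intro sum.cong refl)
    fix i
    have E: "(int i * int i - tri i) + (- int i - (int p' + int b')) * (wt l p a' + int i) =
      - wt l p a' * int i - tri i - (int p' + int b') * (int i + wt l p a')"
      by (simp add: algebra_simps)
    show "(if a' = a + i \<and> b = b' + i then
     Eprod l p a' i / qfact \<zeta> i / of_nat d * (\<Sum>j<d. \<Sum>k<d.
       q ((int i * int i - tri i) + (- int i - (int p' + int b')) * int k + int j * ((wt l p a' + int i) - int k))) else 0)
      = (if i = a' - a then if a' = a + i \<and> b = b' + i then Rc l p p' a' b' i else 0 else 0)"
      unfolding q_double_sum E Rc_def using d by auto
  qed
  also have "\<dots> = Rent l p p' a b a' b'"
    using assms by (auto simp: Rent_def)
  finally show ?thesis .
qed

section \<open>Intertwining identities for the coefficients of R\<close>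

text \<open>This is the commutator of E with F^i evaluated on the basis vector of index b; for i = 1
  it is the relation [E, F] = K - z K^-1.\<close>

lemma Ec_relation:
  assumes "b + i \<le> l"
  shows "Ec l p b + qnum \<zeta> i * q (int p + int l - int b - int i) =
    qnum \<zeta> i * q (int p + int b) + Ec l p (b + i)"
proof -
  have z: "\<zeta> - 1 \<noteq> 0" using \<zeta>_neq_1 by simp
  have i: "qnum \<zeta> i = (q (int i) - 1) / (\<zeta> - 1)" and b: "qnum \<zeta> b = (q (int b) - 1) / (\<zeta> - 1)"
    and bi: "qnum \<zeta> (b + i) = (q (int b) * q (int i) - 1) / (\<zeta> - 1)"
    by (simp_all add: qnum_eq' q_add)
  show ?thesis
    unfolding Ec_def i b bi using z
    by (simp add: q_add q_diff divide_simps) (simp add: algebra_simps)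
qed

text \<open>An entry of the identity between R \<Delta>(E) and the opposite coproduct E \<otimes> 1
  + K \<otimes> E applied after R. With i = a' - a, all four terms are multiples of the same
  quantity, and what remains is \<open>Ec_relation\<close> on the second module.\<close>

lemma Rent_E:
  assumes "a' < l" "l \<le> d" "b < l'"
  shows "Ec l' p' b' * Rent l p p' a b a' (b' - 1) + Ec l p a' * q (wt l' p' b') * Rent l p p' a b (a' - 1) b' =
    Ec l p (a + 1) * Rent l p p' (a + 1) b a' b' + Ec l' p' (b + 1) * q (wt l p a) * Rent l p p' a (b + 1) a' b'"
proof (cases "a + b + 1 = a' + b' \<and> a \<le> a'")
  case False
  then have "Ec l' p' b' * Rent l p p' a b a' (b' - 1) = 0"
    by (cases b') (auto simp: Rent_def)
  moreover have "Ec l p a' * q (wt l' p' b') * Rent l p p' a b (a' - 1) b' = 0"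
    using False by (cases a') (auto simp: Rent_def)
  moreover have "\<not> (a + 1 + b = a' + b' \<and> a + 1 \<le> a')" "\<not> (a + (b + 1) = a' + b' \<and> a \<le> a')"
    using False by linarith+
  then have "Rent l p p' (a + 1) b a' b' = 0" "Rent l p p' a (b + 1) a' b' = 0"
    unfolding Rent_def by (simp_all only: if_False)
  ultimately show ?thesis by (simp only: mult_zero_right add.right_neutral)
next
  case True
  define i where "i = a' - a"
  define W where "W = wt l p a'" define c where "c = int p' + int b'"
  have i: "a' = a + i" "b + 1 = b' + i" using True by (auto simp: i_def)
  have wa: "wt l p a = W + int i" by (simp add: W_def wt_def i)
  \<comment> \<open>The power of \<zeta> in the coefficient \<open>Rc l p p' a' b' i\<close>; the
    powers in the other three terms are measured against it.\<close>
  define X where "X = q (- W * int i - tri i - c * (int i + W))"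
  have T1: "Ec l' p' b' * Rent l p p' a b a' (b' - 1) = Ec l' p' b' * (X * q (int i + W)) * Eprod l p a' i / qfact \<zeta> i"
  proof (cases b')
    case (Suc b0)
    have "X * q (int i + W) = q (- W * int i - tri i - (int p' + int b0) * (int i + W))"
      unfolding X_def q_add[symmetric] by (rule arg_cong[of _ _ q]) (simp add: c_def Suc algebra_simps)
    then show ?thesis using Suc i by (simp add: Rent_def Rc_def W_def)
  qed simp
  have T4: "Rent l p p' a (b + 1) a' b' = X * Eprod l p a' i / qfact \<zeta> i"
    using i by (simp add: Rent_def Rc_def X_def W_def c_def)
  let ?L2 = "Ec l p a' * q (wt l' p' b') * Rent l p p' a b (a' - 1) b'" and ?L3 = "Ec l p (a + 1) * Rent l p p' (a + 1) b a' b'"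
  let ?T2 = "X * q (W + int i) * (qnum \<zeta> i * q (int p' + int l' - int b' - int i)) * Eprod l p a' i / qfact \<zeta> i" and ?T3 = "X * q (W + int i) * (qnum \<zeta> i * q (int p' + int b')) * Eprod l p a' i / qfact \<zeta> i"
  have "?L2 = ?T2 \<and>
    ?L3 = ?T3"
  \<comment> \<open>For i = 0 both terms vanish together with (0)_\<zeta>. For i > 0 they have
    degree i - 1, and comparison with degree i brings in the factor (i)_\<zeta> of the
    q-factorial.\<close>
  proof (cases i)
    case 0
    then show ?thesis using i by (cases a') (auto simp: Rent_def qnum_def)
  next
    case (Suc m)
    have m: "qfact \<zeta> m \<noteq> 0" "qnum \<zeta> (Suc m) \<noteq> 0"
      using assms i Suc qfact_nonzero[of m] qnum_nonzero[of "Suc m"] by auto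
    have e1: "q (wt l' p' b') * q (- wt l p (a + m) * int m - tri m - c * (int m + wt l p (a + m))) =
        X * q (W + int i) * q (int p' + int l' - int b' - int i)"
      unfolding X_def q_add[symmetric] Suc tri_Suc
      by (rule arg_cong[of _ _ q]) (simp add: W_def wt_def i Suc algebra_simps)
    have e2: "q (- wt l p a' * int m - tri m - c * (int m + wt l p a')) = X * q (W + int i) * q (int p' + int b')"
      unfolding X_def q_add[symmetric] Suc tri_Suc
      by (rule arg_cong[of _ _ q]) (simp add: W_def c_def Suc algebra_simps)
    have "?L2 =
        (q (wt l' p' b') * q (- wt l p (a + m) * int m - tri m - c * (int m + wt l p (a + m)))) *
          (Ec l p (Suc (a + m)) * Eprod l p (a + m) m) / qfact \<zeta> m"
      using i Suc by (simp add: Rent_def Rc_def c_def)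
    also have "\<dots> = ?T2"
      unfolding e1 using m i Suc by (simp add: Eprod_Suc_Suc qfact_Suc)
    finally have 1: "?L2 = ?T2" .
    have "?L3 =
       q (- wt l p a' * int m - tri m - c * (int m + wt l p a')) * (Eprod l p a' m * Ec l p (a' - m)) / qfact \<zeta> m"
      using i Suc by (simp add: Rent_def Rc_def c_def)
    also have "\<dots> = ?T3"
      unfolding e2 using m Suc by (simp add: Eprod_Suc qfact_Suc)
    finally show ?thesis using 1 by blast
  qed
  then have T2: "?L2 = ?T2"
    and T3: "?L3 = ?T3" by auto
  have rel: "Ec l' p' b' + qnum \<zeta> i * q (int p' + int l' - int b' - int i) =
    qnum \<zeta> i * q (int p' + int b') + Ec l' p' (b' + i)"
    using assms i by (intro Ec_relation) linarith
  have "Ec l' p' b' * Rent l p p' a b a' (b' - 1) + ?L2 =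
    X * q (W + int i) * (Ec l' p' b' + qnum \<zeta> i * q (int p' + int l' - int b' - int i)) * Eprod l p a' i / qfact \<zeta> i"
    unfolding T1 T2 by (simp add: add_divide_distrib[symmetric] algebra_simps)
  also have "\<dots> = ?L3 + Ec l' p' (b + 1) * q (wt l p a) * Rent l p p' a (b + 1) a' b'"
    unfolding rel T3 T4 wa unfolding i(2) by (simp add: add_divide_distrib[symmetric] algebra_simps)
  finally show ?thesis .
qed

text \<open>The same for F, whose opposite coproduct is 1 \<otimes> F + F \<otimes> z K^-1. The
  commutator of E with F^(i+1), with i = a' - a, is now used on the first module.\<close>

lemma Rent_F:
  assumes "a' < l" "l < d"
  shows "Rent l p p' a b (a' + 1) b' + q (int p + int a') * Rent l p p' a b a' (b' + 1) =
    (if 1 \<le> b then Rent l p p' a (b - 1) a' b' else 0) +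
    (if 1 \<le> a then q (int p' + int b) * Rent l p p' (a - 1) b a' b' else 0)"
proof -
  consider "a + b \<noteq> a' + b' + 1 \<or> a > a' + 1" | "a = a' + 1" "b = b'" | "a \<le> a'" "a + b = a' + b' + 1"
    by linarith
  then show ?thesis
  proof cases
    case 1
    then show ?thesis by (auto simp: Rent_def)
  next
    \<comment> \<open>Here a' - a is -1: only the two terms of degree 0 survive, and they differ by
      a power of \<zeta>.\<close>
    case 2
    have "q (- ((int p' + int b') * wt l p (Suc a'))) = q (int p' + int b') * q (- ((int p' + int b') * wt l p a'))"
      unfolding q_add[symmetric] by (rule arg_cong[of _ _ q]) (simp add: wt_def algebra_simps)
    then show ?thesis using 2 by (simp add: Rent_def Rc_def)
  next
    case 3
    define i where "i = a' - a"
    define W where "W = wt l p a'" define c where "c = int p' + int b'"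
    have i: "a' = a + i" "b = b' + i + 1" using 3 by (auto simp: i_def)
    define X where "X = q (- W * int i - tri i - c * (int i + W))"
    have m: "qfact \<zeta> i \<noteq> 0" using assms i by (auto intro!: qfact_nonzero)
    have wS: "wt l p (a' + 1) = W - 1" by (simp add: W_def wt_def)
    have T2: "Rent l p p' a b a' (b' + 1) = X * q (- int i - W) * Eprod l p a' i / qfact \<zeta> i"
    proof -
      have "X * q (- int i - W) = q (- W * int i - tri i - (int p' + int (b' + 1)) * (int i + W))"
        unfolding X_def q_add[symmetric] by (rule arg_cong[of _ _ q]) (simp add: c_def algebra_simps)
      then show ?thesis using i by (simp add: Rent_def Rc_def W_def)
    qed
    have T3: "Rent l p p' a (b - 1) a' b' = X * Eprod l p a' i / qfact \<zeta> i"
      using i by (simp add: Rent_def Rc_def X_def W_def c_def)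
    \<comment> \<open>The strict bound l < d enters here: i + 1 is at most l, so the divisor in the
      terms of degree i + 1 is nonzero.\<close>
    have n: "qnum \<zeta> (Suc i) \<noteq> 0" using assms i by (intro qnum_nonzero) auto
    have T1: "Rent l p p' a b (a' + 1) b' = X * q (- W) * Ec l p (a' + 1) / qnum \<zeta> (Suc i) * Eprod l p a' i / qfact \<zeta> i"
    proof -
      have "X * q (- W) = q (- wt l p (a' + 1) * int (Suc i) - tri (Suc i) - c * (int (Suc i) + wt l p (a' + 1)))"
        unfolding X_def q_add[symmetric] wS tri_Suc by (rule arg_cong[of _ _ q]) (simp add: algebra_simps)
      moreover have "Rent l p p' a b (a' + 1) b' = Rc l p p' (a' + 1) b' (Suc i)"
        using i by (simp add: Rent_def)
      moreover have "Eprod l p (a' + 1) (Suc i) = Ec l p (a' + 1) * Eprod l p a' i"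
        by (simp add: Eprod_Suc_Suc)
      ultimately show ?thesis unfolding Rc_def c_def by (simp add: qfact_Suc mult_ac)
    qed
    have T4: "(if 1 \<le> a then q (int p' + int b) * Rent l p p' (a - 1) b a' b' else 0) =
      X * q (- W) * Ec l p a / qnum \<zeta> (Suc i) * Eprod l p a' i / qfact \<zeta> i"
    proof (cases "a = 0")
      case False
      have "X * q (- W) = q (int p' + int b) * q (- W * int (Suc i) - tri (Suc i) - c * (int (Suc i) + W))"
        unfolding X_def q_add[symmetric] tri_Suc by (rule arg_cong[of _ _ q]) (simp add: algebra_simps c_def i)
      moreover have "Rent l p p' (a - 1) b a' b' = Rc l p p' a' b' (Suc i)"
        using i False by (auto simp: Rent_def Suc_diff_le)
      moreover have "Eprod l p a' (Suc i) = Ec l p a * Eprod l p a' i"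
        using i by (simp add: Eprod_Suc)
      ultimately show ?thesis using False unfolding Rc_def c_def W_def by (simp add: qfact_Suc mult_ac)
    qed simp
    have "Ec l p a + qnum \<zeta> (Suc i) * q (int p + int l - int a - int (Suc i)) =
        qnum \<zeta> (Suc i) * q (int p + int a) + Ec l p (a + Suc i)"
      using assms i by (intro Ec_relation) simp
    also have "int p + int l - int a - int (Suc i) = W"
      by (simp add: W_def wt_def i)
    finally have A: "q (- W) * (Ec l p a + qnum \<zeta> (Suc i) * q W) =
        q (- W) * (qnum \<zeta> (Suc i) * q (int p + int a) + Ec l p (a' + 1))"
      by (simp add: i)
    have B: "q (- W) * q W = 1" by (simp flip: q_add)
    have C: "q (- W) * q (int p + int a) = q (int p + int a') * q (- int i - W)"
      unfolding q_add[symmetric] by (rule arg_cong[of _ _ q]) (simp add: i)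
    have rel: "q (- W) * Ec l p a + qnum \<zeta> (Suc i) =
        qnum \<zeta> (Suc i) * (q (int p + int a') * q (- int i - W)) + q (- W) * Ec l p (a' + 1)"
    proof -
      have "q (- W) * Ec l p a + qnum \<zeta> (Suc i) = q (- W) * Ec l p a + (q (- W) * q W) * qnum \<zeta> (Suc i)"
        by (simp only: B mult_1_left)
      also have "\<dots> = q (- W) * (Ec l p a + qnum \<zeta> (Suc i) * q W)"
        by (simp add: algebra_simps)
      also have "\<dots> = qnum \<zeta> (Suc i) * (q (- W) * q (int p + int a)) + q (- W) * Ec l p (a' + 1)"
        unfolding A by (simp add: algebra_simps)
      finally show ?thesis unfolding C .
    qed
    have "Rent l p p' a b (a' + 1) b' + q (int p + int a') * Rent l p p' a b a' (b' + 1) =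
       X * ((qnum \<zeta> (Suc i) * (q (int p + int a') * q (- int i - W)) + q (- W) * Ec l p (a' + 1)) / qnum \<zeta> (Suc i)) * Eprod l p a' i / qfact \<zeta> i"
      unfolding T1 T2 using m n by (simp add: field_simps)
    also have "\<dots> = Rent l p p' a (b - 1) a' b' +
      (if 1 \<le> a then q (int p' + int b) * Rent l p p' (a - 1) b a' b' else 0)"
      unfolding rel[symmetric] T3 T4 using m n by (simp add: field_simps)
    finally show ?thesis using i by simp
  qed
qed

end

lemma sum_pair_delta:
  fixes f :: "nat \<Rightarrow> nat \<Rightarrow> complex"
  shows "(\<Sum>c<m. \<Sum>e<n. if c = x \<and> e = y then f c e else 0) = (if x < m \<and> y < n then f x y else 0)"
proof -
  have "(\<Sum>c<m. \<Sum>e<n. if c = x \<and> e = y then f c e else 0) =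
      (\<Sum>c<m. if c = x then \<Sum>e<n. if e = y then f c e else 0 else 0)"
    by (rule sum.cong[OF refl]) auto
  then show ?thesis by simp
qed

context taft
begin

section \<open>Tensor products of simple modules and the braiding in coordinates\<close>

abbreviation "MN l p l' p' \<equiv> db_tensor d (V l p) (V l' p')"

lemma rdim_tensor [simp]: "rdim (db_tensor d M N) = rdim M * rdim N"
  by (simp add: db_tensor_def)

lemma tensor_carrier:
  assumes "db_carrier M" "db_carrier N"
  shows "db_carrier (db_tensor d M N)"
  by (rule db_carrierI)
    (use db_carrierD[OF assms(1)] db_carrierD[OF assms(2)] in \<open>simp_all add: db_tensor_def\<close>)

lemma word_tensor:
  assumes M: "db_carrier M" and N: "db_carrier N" and w: "set w \<subseteq> {gK, gz}"
  shows "word_mat (db_tensor d M N) w = kron (word_mat M w) (word_mat N w)"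
  using w
proof (induction w)
  case Nil
  then show ?case by (simp add: kron_one)
next
  case (Cons g w)
  have "gen_mat (db_tensor d M N) g = kron (gen_mat M g) (gen_mat N g)"
    using Cons.prems by (auto simp: db_tensor_def)
  then show ?case
    using Cons by (simp add: word_mat_Cons kron_mult[OF gen_mat_carrier[OF M] gen_mat_carrier[OF N]
      word_mat_carrier[OF M] word_mat_carrier[OF N]])
qed

lemma index_kron_simple:
  assumes "A \<in> carrier_mat l l" "B \<in> carrier_mat l' l'" "a < l" "b < l'" "a' < l" "b' < l'"
  shows "kron A B $$ (a * l' + b, a' * l' + b') = A $$ (a, a') * B $$ (b, b')"
  by (rule index_kron[OF assms])

lemma index_tensor:
  assumes "a < l" "b < l'" "a' < l" "b' < l'"
  shows "actE (MN l p l' p') $$ (a * l' + b, a' * l' + b') =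
      (if a = a' \<and> b' = b + 1 then Ec l' p' b' else 0) + (if a' = a + 1 \<and> b = b' then Ec l p a' * q (wt l' p' b') else 0)" (is ?E)
    and "actF (MN l p l' p') $$ (a * l' + b, a' * l' + b') =
      (if a = a' + 1 \<and> b = b' then 1 else 0) + (if a = a' \<and> b = b' + 1 then q (int p + int a') else 0)" (is ?F)
    and "actK (MN l p l' p') $$ (a * l' + b, a' * l' + b') =
      (if a = a' \<and> b = b' then q (wt l p a + wt l' p' b) else 0)" (is ?K)
    and "actz (MN l p l' p') $$ (a * l' + b, a' * l' + b') =
      (if a = a' \<and> b = b' then q (2 * int p + int l - 1 + (2 * int p' + int l' - 1)) else 0)" (is ?z)
proof -
  let ?M = "V l p" let ?N = "V l' p'"
  note M = db_carrierD[OF simple_carrier[of l p], simplified] and N = db_carrierD[OF simple_carrier[of l' p'], simplified]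
  have l: "l > 0" "l' > 0" using assms by auto
  have lt: "a * l' + b < l * l'" "a' * l' + b' < l * l'" using assms by (auto intro: pair_index_less)
  note k = index_kron_simple[of _ l _ l', OF _ _ assms]
  have h: "(actz ?M * actK ?M ^\<^sub>m (d - 1)) $$ (a, a') = (if a = a' then q (int p + int a') else 0)"
  proof -
    have "(actz ?M * actK ?M ^\<^sub>m (d - 1)) $$ (a, a') = q (2 * int p + int l - 1) * (actK ?M ^\<^sub>m (d - 1)) $$ (a, a')"
      unfolding actz_simple[OF l(1)] using assms M by (intro index_mult_diag_left) auto
    also have "\<dots> = (if a = a' then q (2 * int p + int l - 1 + wt l p a * (int d - 1)) else 0)"
      using assms d by (simp add: actK_pow q_add of_nat_diff)
    also have "q (2 * int p + int l - 1 + wt l p a * (int d - 1)) = q (int p + int a)"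
      by (rule q_cong) (simp add: wt_def algebra_simps)
    finally show ?thesis by auto
  qed
  have hc: "actz ?M * actK ?M ^\<^sub>m (d - 1) \<in> carrier_mat l l"
    using M by (intro mult_carrier_mat[of _ l l]) auto
  have "actE (MN l p l' p') $$ (a * l' + b, a' * l' + b') =
    kron (1\<^sub>m l) (actE ?N) $$ (a * l' + b, a' * l' + b') + kron (actE ?M) (actK ?N) $$ (a * l' + b, a' * l' + b')"
    using lt M N by (simp add: db_tensor_def kron_def)
  then show ?E
    using assms M N by (simp add: k actE_simple actK_simple)
  have F: "actF (MN l p l' p') $$ (a * l' + b, a' * l' + b') =
    kron (actF ?M) (1\<^sub>m l') $$ (a * l' + b, a' * l' + b') + kron (actz ?M * actK ?M ^\<^sub>m (d - 1)) (actF ?N) $$ (a * l' + b, a' * l' + b')"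
    using lt M N hc by (simp add: db_tensor_def kron_def)
  show ?F
    unfolding F k[OF M(2) one_carrier_mat] k[OF hc N(2)] h using assms by (simp add: actF_simple)
  show ?K
    using assms M N by (simp add: db_tensor_def k) (simp add: actK_simple q_add)
  show ?z
    unfolding q_add using assms M N by (simp add: db_tensor_def k) (simp add: actz_simple l)
qed

lemma tensor_simple_carrier: "db_carrier (MN l p l' p')"
  by (rule tensor_carrier[OF simple_carrier simple_carrier])

text \<open>The truncated indices \<open>a - 1\<close> and \<open>b - 1\<close> are harmless at 0,
  since they come with \<open>Ec l p 0\<close> and \<open>Ec l' p' 0\<close>.\<close>

lemma mult_tensor_right:
  assumes G: "G \<in> carrier_mat k (l * l')" and r: "r < k" and ab: "a < l" "b < l'"
  shows "(G * actE (MN l p l' p')) $$ (r, a * l' + b) =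
      G $$ (r, a * l' + (b - 1)) * Ec l' p' b + G $$ (r, (a - 1) * l' + b) * (Ec l p a * q (wt l' p' b))" (is ?E)
    and "(G * actF (MN l p l' p')) $$ (r, a * l' + b) =
      (if a + 1 < l then G $$ (r, (a + 1) * l' + b) else 0) +
      (if b + 1 < l' then G $$ (r, a * l' + (b + 1)) * q (int p + int a) else 0)" (is ?F)
    and "(G * actK (MN l p l' p')) $$ (r, a * l' + b) = G $$ (r, a * l' + b) * q (wt l p a + wt l' p' b)" (is ?K)
    and "(G * actz (MN l p l' p')) $$ (r, a * l' + b) =
      G $$ (r, a * l' + b) * q (2 * int p + int l - 1 + (2 * int p' + int l' - 1))" (is ?z)
proof -
  note M = db_carrierD[OF tensor_simple_carrier[of l p l' p'], simplified]
  have lt: "a * l' + b < l * l'" using ab by (rule pair_index_less)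
  note * = index_mult_mat_pair[OF G _ r lt]
  have "(G * actE (MN l p l' p')) $$ (r, a * l' + b) = (\<Sum>c<l. \<Sum>e<l'.
      (if c = a \<and> e = b - 1 then G $$ (r, c * l' + e) * Ec l' p' b else 0) +
      (if c = a - 1 \<and> e = b then G $$ (r, c * l' + e) * (Ec l p a * q (wt l' p' b)) else 0))"
    unfolding *[OF M(1)]
  proof (intro sum.cong refl)
    fix c e assume "c \<in> {..<l}" "e \<in> {..<l'}"
    then have ce: "c < l" "e < l'" by auto
    show "G $$ (r, c * l' + e) * actE (MN l p l' p') $$ (c * l' + e, a * l' + b) =
      (if c = a \<and> e = b - 1 then G $$ (r, c * l' + e) * Ec l' p' b else 0) +
      (if c = a - 1 \<and> e = b then G $$ (r, c * l' + e) * (Ec l p a * q (wt l' p' b)) else 0)"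
      unfolding index_tensor(1)[OF ce ab] by (cases a; cases b) auto
  qed
  then show ?E
    using ab by (simp add: sum.distrib sum_pair_delta less_imp_diff_less)
  have "(G * actF (MN l p l' p')) $$ (r, a * l' + b) = (\<Sum>c<l. \<Sum>e<l'.
      (if c = a + 1 \<and> e = b then G $$ (r, c * l' + e) else 0) +
      (if c = a \<and> e = b + 1 then G $$ (r, c * l' + e) * q (int p + int a) else 0))"
    unfolding *[OF M(2)] using ab by (intro sum.cong refl) (auto simp: index_tensor)
  then show ?F
    using ab by (simp add: sum.distrib sum_pair_delta)
  have "(G * actK (MN l p l' p')) $$ (r, a * l' + b) = (\<Sum>c<l. \<Sum>e<l'.
      if c = a \<and> e = b then G $$ (r, c * l' + e) * q (wt l p a + wt l' p' b) else 0)"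
    unfolding *[OF M(3)] using ab by (intro sum.cong refl) (auto simp: index_tensor)
  then show ?K
    using ab by (simp add: sum_pair_delta)
  have "(G * actz (MN l p l' p')) $$ (r, a * l' + b) = (\<Sum>c<l. \<Sum>e<l'.
      if c = a \<and> e = b then G $$ (r, c * l' + e) * q (2 * int p + int l - 1 + (2 * int p' + int l' - 1)) else 0)"
    unfolding *[OF M(4)] using ab by (intro sum.cong refl) (auto simp: index_tensor)
  then show ?z
    using ab by (simp add: sum_pair_delta)
qed

lemma mult_tensor_left:
  assumes G: "G \<in> carrier_mat (l * l') k" and s: "s < k" and ab: "a < l" "b < l'"
  shows "(actE (MN l p l' p') * G) $$ (a * l' + b, s) =
      (if b + 1 < l' then Ec l' p' (b + 1) * G $$ (a * l' + (b + 1), s) else 0) +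
      (if a + 1 < l then Ec l p (a + 1) * q (wt l' p' b) * G $$ ((a + 1) * l' + b, s) else 0)" (is ?E)
    and "(actF (MN l p l' p') * G) $$ (a * l' + b, s) =
      (if 1 \<le> a then G $$ ((a - 1) * l' + b, s) else 0) +
      (if 1 \<le> b then q (int p + int a) * G $$ (a * l' + (b - 1), s) else 0)" (is ?F)
    and "(actK (MN l p l' p') * G) $$ (a * l' + b, s) = q (wt l p a + wt l' p' b) * G $$ (a * l' + b, s)" (is ?K)
    and "(actz (MN l p l' p') * G) $$ (a * l' + b, s) =
      q (2 * int p + int l - 1 + (2 * int p' + int l' - 1)) * G $$ (a * l' + b, s)" (is ?z)
proof -
  note M = db_carrierD[OF tensor_simple_carrier[of l p l' p'], simplified]
  have lt: "a * l' + b < l * l'" using ab by (rule pair_index_less)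
  note * = index_mult_mat_pair[OF _ G lt s]
  have "(actE (MN l p l' p') * G) $$ (a * l' + b, s) = (\<Sum>c<l. \<Sum>e<l'.
      (if c = a \<and> e = b + 1 then Ec l' p' (b + 1) * G $$ (c * l' + e, s) else 0) +
      (if c = a + 1 \<and> e = b then Ec l p (a + 1) * q (wt l' p' b) * G $$ (c * l' + e, s) else 0))"
    unfolding *[OF M(1)] using ab by (intro sum.cong refl) (auto simp: index_tensor)
  then show ?E
    using ab by (simp add: sum.distrib sum_pair_delta)
  have "(actF (MN l p l' p') * G) $$ (a * l' + b, s) = (\<Sum>c<l. \<Sum>e<l'.
      (if c = a - 1 \<and> e = b then if 1 \<le> a then G $$ (c * l' + e, s) else 0 else 0) +
      (if c = a \<and> e = b - 1 then if 1 \<le> b then q (int p + int a) * G $$ (c * l' + e, s) else 0 else 0))"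
    unfolding *[OF M(2)]
  proof (intro sum.cong refl)
    fix c e assume "c \<in> {..<l}" "e \<in> {..<l'}"
    then have ce: "c < l" "e < l'" by auto
    show "actF (MN l p l' p') $$ (a * l' + b, c * l' + e) * G $$ (c * l' + e, s) =
      (if c = a - 1 \<and> e = b then if 1 \<le> a then G $$ (c * l' + e, s) else 0 else 0) +
      (if c = a \<and> e = b - 1 then if 1 \<le> b then q (int p + int a) * G $$ (c * l' + e, s) else 0 else 0)"
      unfolding index_tensor(2)[OF ab ce] by (cases a; cases b) auto
  qed
  then show ?F
    using ab by (simp add: sum.distrib sum_pair_delta less_imp_diff_less)
  have "(actK (MN l p l' p') * G) $$ (a * l' + b, s) = (\<Sum>c<l. \<Sum>e<l'.
      if c = a \<and> e = b then q (wt l p a + wt l' p' b) * G $$ (c * l' + e, s) else 0)"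
    unfolding *[OF M(3)] using ab by (intro sum.cong refl) (auto simp: index_tensor)
  then show ?K
    using ab by (simp add: sum_pair_delta)
  have "(actz (MN l p l' p') * G) $$ (a * l' + b, s) = (\<Sum>c<l. \<Sum>e<l'.
      if c = a \<and> e = b then q (2 * int p + int l - 1 + (2 * int p' + int l' - 1)) * G $$ (c * l' + e, s) else 0)"
    unfolding *[OF M(4)] using ab by (intro sum.cong refl) (auto simp: index_tensor)
  then show ?z
    using ab by (simp add: sum_pair_delta)
qed

lemma braiding_carrier:
  "braiding d \<zeta> (V l p) (V l' p') \<in> carrier_mat (l' * l) (l * l')"
  unfolding braiding_def rdim_simple
  by (rule mult_carrier_mat[of _ _ "l * l'"]) (simp_all add: flip_mat_def R_mat_def)

lemma index_braiding:
  assumes "a < l" "a' < l" "b < l'" "b' < l'" "l \<le> d"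
  shows "braiding d \<zeta> (V l p) (V l' p') $$ (b * l + a, a' * l' + b') =
    Rent l p p' a b a' b'"
proof -
  let ?R = "R_mat d \<zeta> (V l p) (V l' p')"
  have R: "?R \<in> carrier_mat (l * l') (l * l')" by (simp add: R_mat_def)
  have F: "flip_mat l l' \<in> carrier_mat (l' * l) (l * l')" by (simp add: flip_mat_def)
  have lt: "b * l + a < l' * l" "a' * l' + b' < l * l'" using assms by (auto intro: pair_index_less)
  have "braiding d \<zeta> (V l p) (V l' p') $$ (b * l + a, a' * l' + b') =
      (\<Sum>c<l. \<Sum>e<l'. flip_mat l l' $$ (b * l + a, c * l' + e) * ?R $$ (c * l' + e, a' * l' + b'))"
    unfolding braiding_def rdim_simple by (rule index_mult_mat_pair[OF F R lt])
  also have "\<dots> = (\<Sum>c<l. \<Sum>e<l'. if c = a \<and> e = b then ?R $$ (c * l' + e, a' * l' + b') else 0)"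
    using assms lt by (intro sum.cong refl) (auto simp: flip_mat_def pair_index_less)
  also have "\<dots> = ?R $$ (a * l' + b, a' * l' + b')"
    using assms by (simp add: sum_pair_delta)
  also have "\<dots> = Rent l p p' a b a' b'"
    using assms by (intro index_R_mat) auto
  finally show ?thesis .
qed

text \<open>For E and F this is \<open>Rent_E\<close> and \<open>Rent_F\<close>, once the terms
  leaving the modules are seen to vanish; for K it holds because R preserves a + b, and z acts by a
  scalar.\<close>

lemma braiding_hom:
  assumes l: "l < d"
  shows "braiding d \<zeta> (V l p) (V l' p') \<in> db_hom (MN l p l' p') (MN l' p' l p)"
proof -
  let ?C = "braiding d \<zeta> (V l p) (V l' p')"
  note C = braiding_carrier[of l p l' p']
  note T = db_carrierD[OF tensor_simple_carrier[of l p l' p'], simplified]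
    and T' = db_carrierD[OF tensor_simple_carrier[of l' p' l p], simplified]
  have ld: "l \<le> d" using l by simp
  note ib = index_braiding[where l = l and l' = l' and p = p and p' = p', OF _ _ _ _ ld]
  have "?C * actE (MN l p l' p') = actE (MN l' p' l p) * ?C"
  proof (rule eq_pair_matI[of _ l' l l l'])
    fix b a a' b' assume *: "b < l'" "a < l" "a' < l" "b' < l'"
    then have lt: "b * l + a < l' * l" "a' * l' + b' < l * l'" by (auto intro: pair_index_less)
    have 1: "(?C * actE (MN l p l' p')) $$ (b * l + a, a' * l' + b') =
        Ec l' p' b' * Rent l p p' a b a' (b' - 1) + Ec l p a' * q (wt l' p' b') * Rent l p p' a b (a' - 1) b'"
      unfolding mult_tensor_right[OF C lt(1) *(3,4)] using * by (simp add: ib)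
    \<comment> \<open>At the end a + 1 = l the missing term may be restored because
      \<open>Ec l p l = 0\<close>.\<close>
    have 2: "(if a + 1 < l then Ec l p (a + 1) * ?C $$ (b * l + (a + 1), a' * l' + b') else 0) =
        Ec l p (a + 1) * Rent l p p' (a + 1) b a' b'"
    proof (cases "a + 1 < l")
      case True
      then show ?thesis using * by (simp only: if_True ib)
    next
      case False
      then have "a + 1 = l" using * by simp
      then show ?thesis by simp
    qed
    have 3: "(if b + 1 < l' then Ec l' p' (b + 1) * q (wt l p a) * ?C $$ ((b + 1) * l + a, a' * l' + b') else 0) =
        Ec l' p' (b + 1) * q (wt l p a) * Rent l p p' a (b + 1) a' b'"
    proof (cases "b + 1 < l'")
      case True
      then show ?thesis using * by (simp only: if_True ib)
    next
      case False
      then have "b + 1 = l'" using * by simp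
      then show ?thesis by simp
    qed
    show "(?C * actE (MN l p l' p')) $$ (b * l + a, a' * l' + b') =
        (actE (MN l' p' l p) * ?C) $$ (b * l + a, a' * l' + b')"
      unfolding 1 mult_tensor_left[OF C lt(2) *(1,2)] 2 3 using * ld by (intro Rent_E)
  qed (use C T T' in \<open>auto intro: mult_carrier_mat\<close>)
  moreover have "?C * actF (MN l p l' p') = actF (MN l' p' l p) * ?C"
  proof (rule eq_pair_matI[of _ l' l l l'])
    fix b a a' b' assume *: "b < l'" "a < l" "a' < l" "b' < l'"
    then have lt: "b * l + a < l' * l" "a' * l' + b' < l * l'" by (auto intro: pair_index_less)
    \<comment> \<open>At the end a' + 1 = l the entry has positive degree l - a, and
      \<open>Eprod l p l\<close> vanishes in positive degree.\<close>
    have 1: "(if a' + 1 < l then ?C $$ (b * l + a, (a' + 1) * l' + b') else 0) = Rent l p p' a b (a' + 1) b'"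
    proof (cases "a' + 1 < l")
      case True
      then show ?thesis using * by (simp only: if_True ib)
    next
      case False
      then have "a' + 1 = l" using * by simp
      then show ?thesis using * by (simp add: Rent_def Rc_def Eprod_top)
    qed
    have 2: "(if b' + 1 < l' then ?C $$ (b * l + a, a' * l' + (b' + 1)) * q (int p + int a') else 0) =
        q (int p + int a') * Rent l p p' a b a' (b' + 1)"
    proof (cases "b' + 1 < l'")
      case True
      then show ?thesis using * by (simp only: if_True ib mult.commute)
    next
      case False
      \<comment> \<open>Now b is at most b', so preserving the total index would force a > a',
        contrary to R lowering the first index.\<close>
      then have "\<not> (a + b = a' + (b' + 1) \<and> a \<le> a')" using * by linarith
      then show ?thesis using False by (simp only: Rent_def if_False mult_zero_right)
    qed
    have 3: "(if 1 \<le> b then ?C $$ ((b - 1) * l + a, a' * l' + b') else 0) = (if 1 \<le> b then Rent l p p' a (b - 1) a' b' else 0)"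
      using * by (simp only: ib less_imp_diff_less)
    have 4: "(if 1 \<le> a then q (int p' + int b) * ?C $$ (b * l + (a - 1), a' * l' + b') else 0) =
        (if 1 \<le> a then q (int p' + int b) * Rent l p p' (a - 1) b a' b' else 0)"
      using * by (simp only: ib less_imp_diff_less)
    have 5: "(actF (MN l' p' l p) * ?C) $$ (b * l + a, a' * l' + b') =
      (if 1 \<le> b then Rent l p p' a (b - 1) a' b' else 0) +
      (if 1 \<le> a then q (int p' + int b) * Rent l p p' (a - 1) b a' b' else 0)"
      unfolding mult_tensor_left[OF C lt(2) *(1,2)] 3 4 ..
    show "(?C * actF (MN l p l' p')) $$ (b * l + a, a' * l' + b') =
        (actF (MN l' p' l p) * ?C) $$ (b * l + a, a' * l' + b')"
      unfolding 5 mult_tensor_right[OF C lt(1) *(3,4)] 1 2 using * l by (intro Rent_F)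
  qed (use C T T' in \<open>auto intro: mult_carrier_mat\<close>)
  moreover have "?C * actK (MN l p l' p') = actK (MN l' p' l p) * ?C"
  proof (rule eq_pair_matI[of _ l' l l l'])
    fix b a a' b' assume *: "b < l'" "a < l" "a' < l" "b' < l'"
    then have lt: "b * l + a < l' * l" "a' * l' + b' < l * l'" by (auto intro: pair_index_less)
    have "wt l p a' + wt l' p' b' = wt l' p' b + wt l p a" if "a + b = a' + b'"
      using that by (simp add: wt_def)
    then show "(?C * actK (MN l p l' p')) $$ (b * l + a, a' * l' + b') =
        (actK (MN l' p' l p) * ?C) $$ (b * l + a, a' * l' + b')"
      unfolding mult_tensor_left[OF C lt(2) *(1,2)] mult_tensor_right[OF C lt(1) *(3,4)]
      using * by (simp add: ib Rent_def)
  qed (use C T T' in \<open>auto intro: mult_carrier_mat\<close>)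
  moreover have "?C * actz (MN l p l' p') = actz (MN l' p' l p) * ?C"
  proof (rule eq_pair_matI[of _ l' l l l'])
    fix b a a' b' assume *: "b < l'" "a < l" "a' < l" "b' < l'"
    then have lt: "b * l + a < l' * l" "a' * l' + b' < l * l'" by (auto intro: pair_index_less)
    show "(?C * actz (MN l p l' p')) $$ (b * l + a, a' * l' + b') =
        (actz (MN l' p' l p) * ?C) $$ (b * l + a, a' * l' + b')"
      unfolding mult_tensor_left[OF C lt(2) *(1,2)] mult_tensor_right[OF C lt(1) *(3,4)]
      by (simp add: algebra_simps)
  qed (use C T T' in \<open>auto intro: mult_carrier_mat\<close>)
  ultimately show ?thesis using C by (simp add: db_hom_def)
qed

section \<open>The trace of the double braiding\<close>

lemma pivot_tensor:
  assumes "a < l" "b < l'" "a' < l" "b' < l'"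
  shows "word_mat (MN l p l' p') (gpow d gz (- 1) @ [gK]) $$ (a * l' + b, a' * l' + b') =
    (if a = a' \<and> b = b' then q (- (int p + int a)) * q (- (int p' + int b)) else 0)"
proof -
  have "set (gpow d gz (- 1) @ [gK]) \<subseteq> {gK, gz}" by (auto simp: gpow_def)
  note w = word_tensor[OF simple_carrier simple_carrier this]
  show ?thesis
    unfolding w
    using index_kron_simple[OF word_mat_carrier[OF simple_carrier, simplified] word_mat_carrier[OF simple_carrier, simplified] assms] assms
    by (simp add: word_pivot)
qed

lemma Tr_plus_tensor:
  assumes f: "f \<in> carrier_mat (l * l') (l * l')"
  shows "Tr_plus d (MN l p l' p') f =
    (\<Sum>a<l. q (- (int p + int a)) * (\<Sum>b<l'. q (- (int p' + int b)) * f $$ (a * l' + b, a * l' + b)))"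
proof -
  let ?W = "word_mat (MN l p l' p') (gpow d gz (- 1) @ [gK])"
  have W: "?W \<in> carrier_mat (l * l') (l * l')"
    using word_mat_carrier[OF tensor_simple_carrier, of l p l' p'] by simp
  have "Tr_plus d (MN l p l' p') f = (\<Sum>a<l. \<Sum>b<l'. \<Sum>c<l. \<Sum>e<l'.
      ?W $$ (a * l' + b, c * l' + e) * f $$ (c * l' + e, a * l' + b))"
    unfolding Tr_plus_def act_word[OF tensor_simple_carrier] mtrace_mult[OF W f] sum_lessThan_mult ..
  also have "\<dots> = (\<Sum>a<l. \<Sum>b<l'. \<Sum>c<l. \<Sum>e<l'. if c = a \<and> e = b then
      q (- (int p + int a)) * (q (- (int p' + int b)) * f $$ (c * l' + e, a * l' + b)) else 0)"
    by (intro sum.cong refl) (auto simp: pivot_tensor)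
  also have "\<dots> = (\<Sum>a<l. \<Sum>b<l'. q (- (int p + int a)) * (q (- (int p' + int b)) * f $$ (a * l' + b, a * l' + b)))"
    by (intro sum.cong refl) (simp add: sum_pair_delta)
  finally show ?thesis by (simp add: sum_distrib_left)
qed

text \<open>The partial trace of an endomorphism of \<open>M \<otimes> N\<close> is an endomorphism of \<open>M\<close>: commutation with
  \<open>F\<close> makes the difference of consecutive diagonal entries a telescoping sum.\<close>

lemma partial_trace_Suc:
  assumes f: "f \<in> db_hom (MN l p l' p') (MN l p l' p')" and a: "Suc a < l"
  shows "(\<Sum>b<l'. q (- (int p' + int b)) * f $$ (Suc a * l' + b, Suc a * l' + b)) =
    (\<Sum>b<l'. q (- (int p' + int b)) * f $$ (a * l' + b, a * l' + b))"
proof -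
  \<comment> \<open>The off-diagonal entries of f produced by F on the second factor. The definition
    vanishes at 0 and at l', the two ends left by the telescoping sum.\<close>
  define A where "A b = (if 1 \<le> b \<and> b < l' then q (- (int p' + int b)) * q (int p + int (Suc a)) *
     f $$ (Suc a * l' + (b - 1), a * l' + b) else 0)" for b
  have fc: "f \<in> carrier_mat (l * l') (l * l')" and fF: "f * actF (MN l p l' p') = actF (MN l p l' p') * f"
    using f by (auto simp: db_hom_def)
  have "q (- (int p' + int b)) * f $$ (Suc a * l' + b, Suc a * l' + b) -
     q (- (int p' + int b)) * f $$ (a * l' + b, a * l' + b) = A b - A (Suc b)" if b: "b < l'" for b
  proof -
    have eq: "x + y = z + w \<Longrightarrow> x - z = w - y" for x y z w :: complex by (simp add: algebra_simps)
    have lt: "Suc a * l' + b < l * l'" "a * l' + b < l * l'" "a < l"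
      using a b by (auto intro: pair_index_less simp del: mult_Suc)
    have "f $$ (Suc a * l' + b, Suc a * l' + b) + (if b + 1 < l' then f $$ (Suc a * l' + b, a * l' + (b + 1)) * q (int p + int a) else 0) =
       f $$ (a * l' + b, a * l' + b) + (if 1 \<le> b then q (int p + int (Suc a)) * f $$ (Suc a * l' + (b - 1), a * l' + b) else 0)"
      using mult_tensor_right(2)[OF fc lt(1) lt(3) b, of p p'] mult_tensor_left(2)[OF fc lt(2) a b, of p p'] fF a
      by (simp del: index_mult_mat mult_Suc)
    then have "f $$ (Suc a * l' + b, Suc a * l' + b) - f $$ (a * l' + b, a * l' + b) =
       (if 1 \<le> b then q (int p + int (Suc a)) * f $$ (Suc a * l' + (b - 1), a * l' + b) else 0) -
       (if b + 1 < l' then f $$ (Suc a * l' + b, a * l' + (b + 1)) * q (int p + int a) else 0)"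
      by (rule eq)
    then have "q (- (int p' + int b)) * f $$ (Suc a * l' + b, Suc a * l' + b) -
        q (- (int p' + int b)) * f $$ (a * l' + b, a * l' + b) =
       q (- (int p' + int b)) * ((if 1 \<le> b then q (int p + int (Suc a)) * f $$ (Suc a * l' + (b - 1), a * l' + b) else 0) -
       (if b + 1 < l' then f $$ (Suc a * l' + b, a * l' + (b + 1)) * q (int p + int a) else 0))"
      by (simp only: right_diff_distrib[symmetric])
    also have "\<dots> = A b - A (Suc b)"
    proof -
      \<comment> \<open>The pivot weight drops by one exponent from b to b + 1, exactly compensating
        the eigenvalues of z K^-1 on the neighbouring vectors of the first factor; this makes the
        terms telescope.\<close>
      have e: "q (- (int p' + int (Suc b))) * q (int p + int (Suc a)) = q (- (int p' + int b)) * q (int p + int a)"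
        unfolding q_add[symmetric] by (rule arg_cong[of _ _ q]) simp
      have "A (Suc b) = q (- (int p' + int b)) * (if b + 1 < l' then f $$ (Suc a * l' + b, a * l' + (b + 1)) * q (int p + int a) else 0)"
        unfolding A_def e by (simp del: mult_Suc)
      moreover have "A b = q (- (int p' + int b)) * (if 1 \<le> b then q (int p + int (Suc a)) * f $$ (Suc a * l' + (b - 1), a * l' + b) else 0)"
        unfolding A_def using b by (simp del: mult_Suc)
      ultimately show ?thesis by (simp only: right_diff_distrib)
    qed
    finally show ?thesis .
  qed
  then have "(\<Sum>b<l'. q (- (int p' + int b)) * f $$ (Suc a * l' + b, Suc a * l' + b)) -
     (\<Sum>b<l'. q (- (int p' + int b)) * f $$ (a * l' + b, a * l' + b)) = (\<Sum>b<l'. A b - A (Suc b))"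
    by (simp add: sum_subtractf[symmetric] del: mult_Suc)
  also have "\<dots> = 0" unfolding sum_lessThan_telescope' by (simp add: A_def)
  finally show ?thesis by simp
qed

lemma q_sum: "(1 - q m) * (\<Sum>a<n. q (m * int a)) = 1 - q (m * int n)"
  by (simp add: one_diff_power_eq flip: q_mult(2))

lemma Tr_plus_hom_tensor:
  assumes f: "f \<in> db_hom (MN l p l' p') (MN l p l' p')"
  shows "Tr_plus d (MN l p l' p') f =
    (\<Sum>a<l. q (- (int p + int a))) * (\<Sum>b<l'. q (- (int p' + int b)) * f $$ (b, b))"
proof -
  have "(\<Sum>b<l'. q (- (int p' + int b)) * f $$ (a * l' + b, a * l' + b)) = (\<Sum>b<l'. q (- (int p' + int b)) * f $$ (b, b))"
    if "a < l" for a
    using that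
  proof (induction a)
    case (Suc a)
    then show ?case using partial_trace_Suc[OF f, of a] by (simp del: mult_Suc)
  qed simp
  then show ?thesis
    using f by (subst Tr_plus_tensor) (auto simp: db_hom_def sum_distrib_right)
qed

lemma Tr_plus_double_braiding:
  assumes l: "0 < l" "l < d" "0 < l'" "l' < d"
  shows "(1 - q (- 1)) * Tr_plus d (MN l p l' p')
      (braiding d \<zeta> (V l' p') (V l p) * braiding d \<zeta> (V l p) (V l' p')) =
    q (- (2 * int p * int p' + int l * int p' + int p * int l')) * (1 - q (- (int l * int l')))"
proof -
  let ?C = "braiding d \<zeta> (V l p) (V l' p')"
  let ?D = "braiding d \<zeta> (V l' p') (V l p)"
  let ?X = "2 * int p * int p' + int l * int p' + int p * int l'"
  have hom: "?D * ?C \<in> db_hom (MN l p l' p') (MN l p l' p')"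
    using l by (intro hom_comp[OF _ _ _ braiding_hom braiding_hom] tensor_simple_carrier)
  \<comment> \<open>On a highest weight vector of the first factor E vanishes, so the first R acts
    by its term of degree 0; returning to the same vector leaves only degree 0 in the second
    R.\<close>
  have diag: "(?D * ?C) $$ (b, b) = q (- ((int p' + int b) * wt l p 0)) * q (- (int p * wt l' p' b))" if b: "b < l'" for b
  proof -
    have lt: "b < l * l'" using pair_index_less[of 0 l b l'] b l by simp
    have "(?D * ?C) $$ (b, b) = (\<Sum>e<l'. \<Sum>c<l. ?D $$ (b, e * l + c) * ?C $$ (e * l + c, b))"
      by (rule index_mult_mat_pair[OF braiding_carrier braiding_carrier lt lt])
    also have "\<dots> = (\<Sum>e<l'. \<Sum>c<l. if e = b \<and> c = 0 then Rc l' p' p b 0 0 * Rc l p p' 0 b 0 else 0)"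
    proof (intro sum.cong refl)
      fix e c assume *: "e \<in> {..<l'}" "c \<in> {..<l}"
      have "?D $$ (0 * l' + b, e * l + c) = Rent l' p' p b 0 e c" "?C $$ (e * l + c, 0 * l' + b) = Rent l p p' c e 0 b"
        using * l b by (intro index_braiding; simp)+
      then show "?D $$ (b, e * l + c) * ?C $$ (e * l + c, b) =
          (if e = b \<and> c = 0 then Rc l' p' p b 0 0 * Rc l p p' 0 b 0 else 0)"
        by (auto simp: Rent_def)
    qed
    also have "\<dots> = Rc l' p' p b 0 0 * Rc l p p' 0 b 0"
      using b l by (simp add: sum_pair_delta)
    finally show ?thesis by (simp add: Rc_def mult.commute)
  qed
  \<comment> \<open>The contributions p b of the two braidings cancel, and so does the pivot against
    the -1 in the highest weight; the exponent depends on b only through -l b.\<close>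
  have "(\<Sum>b<l'. q (- (int p' + int b)) * (?D * ?C) $$ (b, b)) = (\<Sum>b<l'. q (- ?X + int p) * q (- int l * int b))"
  proof (intro sum.cong refl)
    fix b assume "b \<in> {..<l'}"
    then have b: "b < l'" by simp
    show "q (- (int p' + int b)) * (?D * ?C) $$ (b, b) = q (- ?X + int p) * q (- int l * int b)"
      unfolding diag[OF b] q_add[symmetric]
      by (rule arg_cong[of _ _ q]) (simp add: wt_def algebra_simps)
  qed
  also have "\<dots> = q (- ?X + int p) * (\<Sum>b<l'. q (- int l * int b))"
    by (simp add: sum_distrib_left)
  finally have s1: "(\<Sum>b<l'. q (- (int p' + int b)) * (?D * ?C) $$ (b, b)) =
    q (- ?X + int p) * (\<Sum>b<l'. q (- int l * int b))" .
  have "(\<Sum>a<l. q (- (int p + int a))) = (\<Sum>a<l. q (- int p) * q (- 1 * int a))"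
    by (simp flip: q_add)
  then have s2: "(\<Sum>a<l. q (- (int p + int a))) = q (- int p) * (\<Sum>a<l. q (- 1 * int a))"
    by (simp add: sum_distrib_left)
  have "(1 - q (- 1)) * Tr_plus d (MN l p l' p') (?D * ?C) =
      (q (- int p) * q (- ?X + int p)) * (((1 - q (- 1)) * (\<Sum>a<l. q (- 1 * int a))) * (\<Sum>b<l'. q (- int l * int b)))"
    unfolding Tr_plus_hom_tensor[OF hom] s1 s2 by (simp only: mult_ac)
  \<comment> \<open>The sum over a yields 1 - q(-l), which is precisely the factor that sums the
    geometric series over b.\<close>
  also have "\<dots> = (q (- int p) * q (- ?X + int p)) * ((1 - q (- int l)) * (\<Sum>b<l'. q (- int l * int b)))"
    unfolding q_sum[of "- 1" l] by simp
  also have "\<dots> = q (- ?X) * (1 - q (- int l * int l'))"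
    unfolding q_sum by (simp flip: q_add)
  finally show ?thesis by simp
qed

lemma Tr_plus_one:
  assumes "l > 0"
  shows "Tr_plus d (V l p) (1\<^sub>m l) = (\<Sum>a<l. q (- (int p + int a)))"
proof -
  have "Tr_plus d (V l p) (1\<^sub>m l) = mtrace (word_mat (V l p) (gpow d gz (- 1) @ [gK]))"
    by (simp add: Tr_plus_def act_word[OF simple_carrier]
        right_mult_one_mat[OF word_mat_carrier[OF simple_carrier, simplified]])
  then show ?thesis
    using word_mat_carrier[OF simple_carrier, of l p "gpow d gz (- 1) @ [gK]"] assms
    by (simp add: mtrace_def word_pivot)
qed

lemma Tr_minus_one:
  assumes "l > 0"
  shows "Tr_minus d (V l p) (1\<^sub>m l) = (\<Sum>a<l. q (int p + int a))"
proof -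
  have "Tr_minus d (V l p) (1\<^sub>m l) = mtrace (word_mat (V l p) (gpow d gK (- 1) @ [gz]))"
    by (simp add: Tr_minus_def act_word[OF simple_carrier]
        left_mult_one_mat[OF word_mat_carrier[OF simple_carrier, simplified]])
  then show ?thesis
    using word_mat_carrier[OF simple_carrier, of l p "gpow d gK (- 1) @ [gz]"] assms
    by (simp add: mtrace_def word_pivot)
qed

end

section \<open>The twist\<close>

lemma sum_list_map_product:
  fixes f :: "'a \<times> 'b \<Rightarrow> 'c::comm_monoid_add"
  shows "(\<Sum>z\<leftarrow>List.product xs ys. f z) = (\<Sum>x\<leftarrow>xs. \<Sum>y\<leftarrow>ys. f (x, y))"
  by (induction xs) (simp_all add: o_def)

lemma sum_list_sum_swap:
  fixes f :: "'a \<Rightarrow> nat \<Rightarrow> complex"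
  shows "(\<Sum>x\<leftarrow>xs. \<Sum>m<n. f x m) = (\<Sum>m<n. \<Sum>x\<leftarrow>xs. f x m)"
  by (induction xs) (simp_all add: sum.distrib)

lemma dim_act [simp]: "dim_row (act M x) = rdim M" "dim_col (act M x) = rdim M"
  by (simp_all add: act_def)

lemma index_act:
  "r < rdim M \<Longrightarrow> s < rdim M \<Longrightarrow> act M x $$ (r, s) = (\<Sum>z\<leftarrow>x. fst z * word_mat M (snd z) $$ (r, s))"
  by (simp add: act_def case_prod_beta')

lemma act_elt_mult:
  assumes M: "db_carrier M"
  shows "act M (elt_mult x y) = act M x * act M y"
proof (rule eq_matI)
  fix r s assume "r < dim_row (act M x * act M y)" "s < dim_col (act M x * act M y)"
  then have rs: "r < rdim M" "s < rdim M" by auto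
  note W = word_mat_carrier[OF M]
  have "(act M x * act M y) $$ (r, s) = (\<Sum>m<rdim M. (\<Sum>v\<leftarrow>x. fst v * word_mat M (snd v) $$ (r, m)) * (\<Sum>w\<leftarrow>y. fst w * word_mat M (snd w) $$ (m, s)))"
    using rs by (simp add: index_mult_mat_sum[OF act_carrier act_carrier] index_act del: index_mult_mat)
  also have "\<dots> = (\<Sum>m<rdim M. \<Sum>v\<leftarrow>x. \<Sum>w\<leftarrow>y. (fst v * word_mat M (snd v) $$ (r, m)) * (fst w * word_mat M (snd w) $$ (m, s)))"
    by (simp only: sum_list_mult_const[symmetric]) (simp only: sum_list_const_mult[symmetric])
  also have "\<dots> = (\<Sum>v\<leftarrow>x. \<Sum>w\<leftarrow>y. \<Sum>m<rdim M. (fst v * word_mat M (snd v) $$ (r, m)) * (fst w * word_mat M (snd w) $$ (m, s)))"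
    by (simp only: sum_list_sum_swap)
  also have "\<dots> = (\<Sum>v\<leftarrow>x. \<Sum>w\<leftarrow>y. fst v * fst w * word_mat M (snd v @ snd w) $$ (r, s))"
    using rs by (simp add: word_mat_append[OF M] index_mult_mat_sum[OF W W] sum_distrib_left mult_ac del: index_mult_mat)
  also have "\<dots> = act M (elt_mult x y) $$ (r, s)"
    using rs by (simp add: index_act elt_mult_def sum_list_map_product o_def case_prod_beta)
  finally show "act M (elt_mult x y) $$ (r, s) = (act M x * act M y) $$ (r, s)" ..
qed auto

lemma index_act_concat:
  assumes "r < rdim M" "s < rdim M"
  shows "act M (concat xs) $$ (r, s) = (\<Sum>x\<leftarrow>xs. act M x $$ (r, s))"
  using assms by (induction xs) (simp_all add: index_act)

lemma word_mat_concat_replicate: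
  assumes "db_carrier M"
  shows "word_mat M (concat (replicate n w)) = word_mat M w ^\<^sub>m n"
proof (induction n)
  case 0
  then show ?case using word_mat_carrier[OF assms, of w] by simp
next
  case (Suc n)
  then show ?case
    by (simp add: word_mat_append[OF assms] pow_mat_Suc_left[OF word_mat_carrier[OF assms]] del: pow_mat.simps(2))
qed

context taft
begin

section \<open>Gaussian binomials and the sum over i in the Drinfeld element\<close>

text \<open>A falling q-factorial: for i < d, \<open>qfall n i / qfact \<zeta> i\<close> is the
  Gaussian binomial coefficient.\<close>

definition qfall :: "nat \<Rightarrow> nat \<Rightarrow> complex" where
  "qfall n i = (\<Prod>t<i. qnum \<zeta> (n - t))"

lemma qfall_0 [simp]: "qfall n 0 = 1"
  and qfall_Suc: "qfall n (Suc i) = qfall n i * qnum \<zeta> (n - i)"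
  by (simp_all add: qfall_def mult.commute)

lemma qfall_Suc_Suc: "qfall (Suc n) (Suc i) = qnum \<zeta> (Suc n) * qfall n i"
  by (simp add: qfall_def prod.lessThan_Suc_shift del: prod.lessThan_Suc)

lemma qfall_eq_0: "n < i \<Longrightarrow> qfall n i = 0"
  unfolding qfall_def by (rule prod_zero) (auto intro!: bexI[of _ n] simp: qnum_def)

text \<open>From (n+1)_\<zeta> = (i+1)_\<zeta> + \<zeta>^(i+1) (n-i)_\<zeta>. The bound by d keeps
  the q-factorials in the denominators nonzero.\<close>

lemma qbinomial_Pascal:
  assumes "i \<le> n" "Suc n < d"
  shows "qfall (Suc n) (Suc i) / qfact \<zeta> (Suc i) =
    qfall n i / qfact \<zeta> i + \<zeta> ^ Suc i * (qfall n (Suc i) / qfact \<zeta> (Suc i))"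
proof -
  have z: "\<zeta> - 1 \<noteq> 0" using \<zeta>_neq_1 by simp
  have nz: "qfact \<zeta> i \<noteq> 0" "qnum \<zeta> (Suc i) \<noteq> 0"
    using assms qfact_nonzero[of i] qnum_nonzero[of "Suc i"] by auto
  have n: "\<zeta> ^ Suc n = \<zeta> ^ Suc i * \<zeta> ^ (n - i)"
    using assms by (simp flip: power_add)
  have "(\<zeta> - 1) * qnum \<zeta> (Suc n) = (\<zeta> - 1) * (qnum \<zeta> (Suc i) + \<zeta> ^ Suc i * qnum \<zeta> (n - i))"
    unfolding distrib_left mult.left_commute[of "\<zeta> - 1"] qnum_eq q_of_nat[symmetric] n by (simp add: algebra_simps)
  then have "qnum \<zeta> (Suc n) = qnum \<zeta> (Suc i) + \<zeta> ^ Suc i * qnum \<zeta> (n - i)"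
    using z by simp
  then show ?thesis
    using nz unfolding qfall_Suc_Suc unfolding qfall_Suc qfact_Suc by (simp add: field_simps del: power_Suc)
qed

text \<open>In the induction step the two halves of Pascal's rule recombine because the product P i
  satisfies \<open>P (Suc i) + \<zeta> ^ i * P i = y * P i\<close>.\<close>

lemma Cauchy_qbinomial:
  assumes "n < d"
  shows "(\<Sum>i\<le>n. qfall n i / qfact \<zeta> i * (\<Prod>t<i. y - \<zeta> ^ t)) = y ^ n"
  using assms
proof (induction n)
  case (Suc n)
  let ?G = "\<lambda>n i. qfall n i / qfact \<zeta> i" and ?P = "\<lambda>i. \<Prod>t<i. y - \<zeta> ^ t"
  have "(\<Sum>i\<le>Suc n. ?G (Suc n) i * ?P i) = 1 + (\<Sum>i\<le>n. ?G (Suc n) (Suc i) * ?P (Suc i))"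
    by (subst sum.atMost_Suc_shift) simp
  also have "(\<Sum>i\<le>n. ?G (Suc n) (Suc i) * ?P (Suc i)) =
      (\<Sum>i\<le>n. ?G n i * ?P (Suc i)) + (\<Sum>i\<le>n. \<zeta> ^ Suc i * ?G n (Suc i) * ?P (Suc i))"
    unfolding sum.distrib[symmetric]
    using Suc.prems by (intro sum.cong refl) (subst qbinomial_Pascal, simp_all add: distrib_right)
  also have "1 + ((\<Sum>i\<le>n. ?G n i * ?P (Suc i)) + (\<Sum>i\<le>n. \<zeta> ^ Suc i * ?G n (Suc i) * ?P (Suc i))) =
      (\<Sum>i\<le>n. ?G n i * ?P (Suc i)) + (\<Sum>i\<le>Suc n. \<zeta> ^ i * ?G n i * ?P i)"
  proof -
    have "(\<Sum>i\<le>Suc n. \<zeta> ^ i * ?G n i * ?P i) = 1 + (\<Sum>i\<le>n. \<zeta> ^ Suc i * ?G n (Suc i) * ?P (Suc i))"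
      by (subst sum.atMost_Suc_shift) simp
    then show ?thesis by (simp only: add.left_commute)
  qed
  also have "(\<Sum>i\<le>Suc n. \<zeta> ^ i * ?G n i * ?P i) = (\<Sum>i\<le>n. \<zeta> ^ i * ?G n i * ?P i)"
    by (simp add: qfall_eq_0)
  also have "(\<Sum>i\<le>n. ?G n i * ?P (Suc i)) + (\<Sum>i\<le>n. \<zeta> ^ i * ?G n i * ?P i) = (\<Sum>i\<le>n. y * (?G n i * ?P i))"
    unfolding sum.distrib[symmetric] by (intro sum.cong refl) (simp add: algebra_simps)
  also have "\<dots> = y * y ^ n"
    unfolding sum_distrib_left[symmetric] using Suc by simp
  finally show ?case by simp
qed simp

text \<open>Put x = \<zeta>^(l-c). A sign and the power of \<zeta> turn each factor
  \<open>Ec l p (c - t)\<close> into (c-t)_\<zeta> (x^-1 - \<zeta>^t), so the sum is Cauchy's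
  expansion at y = x^-1.\<close>

lemma twist_sum:
  assumes c: "c < l" "l \<le> d"
  shows "(\<Sum>i<d. (- 1) ^ i * q (- int i * (int p + int l - int c)) * Eprod l p c i / qfact \<zeta> i) = q (- (int l - int c) * int c)"
proof -
  define x where "x = q (int l - int c)"
  have E: "(- 1) ^ i * q (- int i * (int p + int l - int c)) * Eprod l p c i = qfall c i * (\<Prod>t<i. inverse x - \<zeta> ^ t)"
    if "i \<le> c" for i
    using that
  proof (induction i)
    case (Suc i)
    have "q (int l - int (c - i)) = x * \<zeta> ^ i"
      unfolding x_def q_of_nat q_add[symmetric]
      by (rule arg_cong[of _ _ q]) (use Suc.prems in \<open>simp add: of_nat_diff\<close>)
    then have 1: "Ec l p (c - i) = q (int p) * qnum \<zeta> (c - i) * (x * \<zeta> ^ i - 1)"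
      by (simp add: Ec_def)
    \<comment> \<open>Stated with free variables so that normalization does not meet the powers of
      \<zeta> themselves.\<close>
    have gen: "- s * (Q * (inverse P * inverse X)) * (E * (P * n * (X * z - 1))) = (s * Q * E) * (n * (inverse X * (1 - X * z)))"
      if "P \<noteq> 0" "X \<noteq> 0" for s Q P X E n z :: complex
      using that by (simp add: field_simps)
    have 2: "q (- int (Suc i) * (int p + int l - int c)) = q (- int i * (int p + int l - int c)) * (inverse (q (int p)) * inverse x)"
      unfolding x_def q_minus[symmetric] q_add[symmetric] by (rule arg_cong[of _ _ q]) (simp add: algebra_simps)
    have "(- 1) ^ Suc i * q (- int (Suc i) * (int p + int l - int c)) * Eprod l p c (Suc i) =
       ((- 1) ^ i * q (- int i * (int p + int l - int c)) * Eprod l p c i) * (qnum \<zeta> (c - i) * (inverse x * (1 - x * \<zeta> ^ i)))"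
      unfolding Eprod_Suc 1 2 power_Suc mult_minus1 by (rule gen) (simp_all add: x_def)
    also have "inverse x * (1 - x * \<zeta> ^ i) = inverse x - \<zeta> ^ i"
      by (simp add: x_def algebra_simps)
    finally show ?case using Suc by (simp add: qfall_Suc mult_ac)
  qed simp
  have "(\<Sum>i<d. (- 1) ^ i * q (- int i * (int p + int l - int c)) * Eprod l p c i / qfact \<zeta> i) =
      (\<Sum>i\<le>c. (- 1) ^ i * q (- int i * (int p + int l - int c)) * Eprod l p c i / qfact \<zeta> i)"
    using c by (intro sum.mono_neutral_right) (auto simp: Eprod_eq_0)
  also have "\<dots> = (\<Sum>i\<le>c. qfall c i / qfact \<zeta> i * (\<Prod>t<i. inverse x - \<zeta> ^ t))"
  proof (intro sum.cong refl)
    fix i assume "i \<in> {..c}"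
    then have i: "i \<le> c" by simp
    show "(- 1) ^ i * q (- int i * (int p + int l - int c)) * Eprod l p c i / qfact \<zeta> i =
        qfall c i / qfact \<zeta> i * (\<Prod>t<i. inverse x - \<zeta> ^ t)"
      unfolding E[OF i] by simp
  qed
  also have "\<dots> = inverse x ^ c"
    using c by (intro Cauchy_qbinomial) simp
  also have "\<dots> = q (- (int l - int c) * int c)"
    unfolding x_def q_minus[symmetric] q_mult(2) ..
  finally show ?thesis .
qed

section \<open>The antipode, the Drinfeld element and the scalar of the twist\<close>

lemma tri_double: "2 * tri i = int i * int i + int i"
  by (induction i) (simp_all add: tri_Suc algebra_simps)

text \<open>The antipode reverses the order of the letters, so the powers of K come to the front.
  The factor z^-k is stored as a nonnegative number of letters, the residue of -k, and each of them
  is replaced separately.\<close>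

lemma antipode_beta_word:
  "concat (map (\<lambda>g. snd (antipode_gen d \<zeta> g)) (rev (gpow d gz (- int k) @ replicate i gF @ replicate k gK))) =
    concat (replicate k (gpow d gK (- 1))) @ concat (replicate i (gF # gK # gpow d gz (- 1))) @
    concat (replicate (nat (- int k mod int d)) (gpow d gz (- 1)))"
  by (simp add: gpow_def[of d gz "- int k"])

lemma antipode_beta_coeff:
  "(\<Prod>g\<leftarrow>gpow d gz (- int k) @ replicate i gF @ replicate k gK. fst (antipode_gen d \<zeta> g)) = (- inverse \<zeta>) ^ i"
  by (simp add: gpow_def)

lemma index_antipode_beta:
  assumes "r < l" "s < l"
  shows "act (V l p) (antipode d \<zeta> (beta d \<zeta> i j)) $$ (r, s) = (if r = s + i then
    (\<Sum>k<d. (- 1) ^ i / of_nat d / qfact \<zeta> i *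
      q ((int i - int k) * (int i + int j) - int i * int i - int i - (int p + int s) * int i + (int p + int r) * int k)) else 0)"
proof -
  let ?M = "V l p" let ?s = "2 * int p + int l - 1"
  let ?D = "\<lambda>c. mat l l (\<lambda>(r, s). if r = s then c r else 0) :: complex mat"
  have l: "l > 0" using assms by simp
  let ?F = "mat l l (\<lambda>(r, s). if r = s + i then \<Prod>t<i. q (- int p - int (s + t)) else 0)"
  have Fc: "?F \<in> carrier_mat l l" by simp
  have FKz: "word_mat ?M (gF # gK # gpow d gz (- 1)) = mat l l (\<lambda>(r, s). if r = s + 1 then q (- int p - int s) else 0)"
  proof -
    have F: "actF ?M \<in> carrier_mat l l" and K: "?D (\<lambda>r. q (wt l p r)) \<in> carrier_mat l l"
      using db_carrierD[OF simple_carrier, of l p] by auto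
    have e: "(actF ?M * (?D (\<lambda>r. q (wt l p r)) * ?D (\<lambda>_. q (?s * - 1)))) $$ (r, s) =
       (if r = s + 1 then q (- int p - int s) else 0)" if rs: "r < l" "s < l" for r s
    proof -
      have "(actF ?M * (?D (\<lambda>r. q (wt l p r)) * ?D (\<lambda>_. q (?s * - 1)))) $$ (r, s) =
          actF ?M $$ (r, s) * q (wt l p s) * q (?s * - 1)"
        unfolding assoc_mult_mat[OF F K mat_carrier, symmetric]
        using rs by (simp only: index_mult_diag_right[OF mult_carrier_mat[OF F K]] index_mult_diag_right[OF F])
      moreover have "q (wt l p s) * q (?s * - 1) = q (- int p - int s)"
        unfolding q_add[symmetric] by (rule arg_cong[of _ _ q]) (simp add: wt_def)
      ultimately show ?thesis using rs by (simp add: actF_simple)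
    qed
    have "word_mat ?M (gF # gK # gpow d gz (- 1)) = actF ?M * (?D (\<lambda>r. q (wt l p r)) * ?D (\<lambda>_. q (?s * - 1)))"
      by (simp only: word_mat_Cons gen_mat.simps word_gpow_z[OF l] actK_simple)
    also have "\<dots> = mat l l (\<lambda>(r, s). if r = s + 1 then q (- int p - int s) else 0)"
      by (rule eq_matI) (use e F K in \<open>auto simp del: index_mult_mat(1)\<close>)
    finally show ?thesis .
  qed
  have prod: "(\<Prod>t<i. q (- int p - int (s + t))) = q (- (int p + int s) * int i - tri i + int i)"
  proof (induction i)
    case (Suc i)
    have "q (- (int p + int s) * int i - tri i + int i) * q (- int p - int (s + i)) =
      q (- (int p + int s) * int (Suc i) - tri (Suc i) + int (Suc i))"
      unfolding q_add[symmetric] by (rule arg_cong[of _ _ q]) (simp add: tri_Suc algebra_simps)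
    then show ?case using Suc by simp
  qed simp
  have w: "word_mat ?M (concat (replicate k (gpow d gK (- 1))) @ concat (replicate i (gF # gK # gpow d gz (- 1))) @
    concat (replicate (nat (- int k mod int d)) (gpow d gz (- 1)))) $$ (r, s) =
    (if r = s + i then q (- wt l p r * int k - (int p + int s) * int i - tri i + int i + ?s * int k) else 0)" for k
  proof -
    \<comment> \<open>Each of these letters becomes z^-1; modulo d their total exponent is k, as it
      must be for the antipode of z^-k.\<close>
    have z: "q (?s * - 1) ^ nat (- int k mod int d) = q (?s * int k)"
    proof -
      have "q (?s * - 1) ^ nat (- int k mod int d) = q ((?s * - 1) * (- int k mod int d))"
        using d by (simp add: q_mult(2))
      also have "\<dots> = q ((?s * - 1) * - int k)" by (rule q_mod(2))
      also have "(?s * - 1) * - int k = ?s * int k" by (simp add: algebra_simps)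
      finally show ?thesis .
    qed
    have "word_mat ?M (concat (replicate k (gpow d gK (- 1))) @ concat (replicate i (gF # gK # gpow d gz (- 1))) @
        concat (replicate (nat (- int k mod int d)) (gpow d gz (- 1)))) =
      ?D (\<lambda>r. q (wt l p r * - 1) ^ k) * (?F * ?D (\<lambda>_. q (?s * - 1) ^ nat (- int k mod int d)))"
      by (simp only: word_mat_append[OF simple_carrier] word_mat_concat_replicate[OF simple_carrier]
        word_gpow_K word_gpow_z[OF l] FKz diag_pow subdiagonal_pow)
    then have "word_mat ?M (concat (replicate k (gpow d gK (- 1))) @ concat (replicate i (gF # gK # gpow d gz (- 1))) @
        concat (replicate (nat (- int k mod int d)) (gpow d gz (- 1)))) $$ (r, s) =
      q (wt l p r * - 1) ^ k * (?F $$ (r, s) * q (?s * int k))"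
      using assms by (simp only: z index_mult_diag_left[OF mult_carrier_mat[OF Fc mat_carrier]] index_mult_diag_right[OF Fc])
    also have "\<dots> = (if r = s + i then q (wt l p r * - 1 * int k) * (q (- (int p + int s) * int i - tri i + int i) * q (?s * int k)) else 0)"
    proof -
      have "?F $$ (r, s) = (if r = s + i then q (- (int p + int s) * int i - tri i + int i) else 0)"
        using assms by (simp only: index_mat prod.case prod)
      then show ?thesis by (simp only: q_mult(2)) auto
    qed
    also have "q (wt l p r * - 1 * int k) * (q (- (int p + int s) * int i - tri i + int i) * q (?s * int k)) =
      q (- wt l p r * int k - (int p + int s) * int i - tri i + int i + ?s * int k)"
      unfolding q_add[symmetric] by (rule arg_cong[of _ _ q]) (simp add: algebra_simps)
    finally show ?thesis .
  qed
  have "act ?M (antipode d \<zeta> (beta d \<zeta> i j)) $$ (r, s) = (\<Sum>k\<leftarrow>[0..<d].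
     (1 / of_nat d * (\<zeta> powi ((int i - int k) * (int i + int j) - int (i * (i + 1) div 2)) / qfact \<zeta> i)) * (- inverse \<zeta>) ^ i *
     word_mat ?M (concat (replicate k (gpow d gK (- 1))) @ concat (replicate i (gF # gK # gpow d gz (- 1))) @
    concat (replicate (nat (- int k mod int d)) (gpow d gz (- 1)))) $$ (r, s))"
    using assms
    unfolding antipode_def beta_def map_map o_def case_prod_conv antipode_beta_word antipode_beta_coeff
    by (simp add: index_act o_def)
  also have "\<dots> = (\<Sum>k<d. (1 / of_nat d * (q ((int i - int k) * (int i + int j) - tri i) / qfact \<zeta> i)) * ((- 1) ^ i * q (- int i)) *
     (if r = s + i then q (- wt l p r * int k - (int p + int s) * int i - tri i + int i + ?s * int k) else 0))"
  proof -
    have "(- inverse \<zeta>) ^ i = (- 1) ^ i * q (- int i)"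
      unfolding power_minus[of "inverse \<zeta>"] by (simp add: q_minus power_inverse flip: q_of_nat)
    then show ?thesis
      by (simp only: w interv_sum_list_conv_sum_set_nat set_upt lessThan_atLeast0 q_def tri_def)
  qed
  also have "\<dots> = (if r = s + i then (\<Sum>k<d. (- 1) ^ i / of_nat d / qfact \<zeta> i *
     (q (- int i) * q ((int i - int k) * (int i + int j) - tri i) *
      q (- wt l p r * int k - (int p + int s) * int i - tri i + int i + ?s * int k))) else 0)"
    by (simp add: mult_ac)
  \<comment> \<open>One triangular exponent comes from \<open>beta\<close>, the other from the i-th
    power of F K z^-1; together they give i^2 + i.\<close>
  also have "(\<lambda>k. q (- int i) * q ((int i - int k) * (int i + int j) - tri i) *
      q (- wt l p r * int k - (int p + int s) * int i - tri i + int i + ?s * int k)) =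
     (\<lambda>k. q ((int i - int k) * (int i + int j) - int i * int i - int i - (int p + int s) * int i + (int p + int r) * int k))"
    unfolding q_add[symmetric]
    by (intro ext arg_cong[of _ _ q]) (use tri_double[of i] in \<open>simp add: wt_def algebra_simps\<close>)
  finally show ?thesis .
qed

text \<open>E^i lowers the index by i and the F^i in the antipode of \<open>beta\<close> restores
  it, so u is diagonal. Fourier inversion removes j and k, and \<open>twist_sum\<close> evaluates
  the rest.\<close>

lemma index_u:
  assumes "r < l" "c < l" "l \<le> d"
  shows "act (V l p) (u_elt d \<zeta>) $$ (r, c) =
    (if r = c then q ((int p + int c) * wt l p c - (int l - int c) * int c) else 0)"
proof -
  let ?M = "V l p"
  \<comment> \<open>\<open>A i\<close> and \<open>b i\<close> are the constant term and the
    coefficient of k in the exponent, as \<open>q_double_sum\<close> requires them.\<close>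
  define A where "A i = int i * int i - int i - (int p + int c) * int i" for i
  define b where "b i = int p + int c - int i" for i
  have e: "(act ?M (antipode d \<zeta> (beta d \<zeta> i j)) * act ?M (EK i j)) $$ (r, c) =
    (if r = c then \<Sum>k<d. (- 1) ^ i / of_nat d / qfact \<zeta> i * Eprod l p c i * q (A i + b i * int k + int j * ((wt l p c + int i) - int k)) else 0)"
    for i j
  proof -
    let ?X = "\<lambda>k. (int i - int k) * (int i + int j) - int i * int i - int i - (int p + int (c - i)) * int i + (int p + int c) * int k"
    have "(act ?M (antipode d \<zeta> (beta d \<zeta> i j)) * act ?M (EK i j)) $$ (r, c) =
       (\<Sum>s<l. act ?M (antipode d \<zeta> (beta d \<zeta> i j)) $$ (r, s) * act ?M (EK i j) $$ (s, c))"
      using assms act_carrier[of ?M] by (intro index_mult_mat_sum) auto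
    also have "\<dots> = (\<Sum>s<l. if s = c - i then
       (if i \<le> c \<and> r = c then (\<Sum>k<d. (- 1) ^ i / of_nat d / qfact \<zeta> i *
      q (?X k)) * (Eprod l p c i * q (wt l p c * int j)) else 0) else 0)"
      using assms by (intro sum.cong refl) (auto simp: index_antipode_beta act_EK)
    also have "\<dots> = (if i \<le> c \<and> r = c then (\<Sum>k<d. (- 1) ^ i / of_nat d / qfact \<zeta> i * Eprod l p c i *
      (q (?X k) * q (wt l p c * int j))) else 0)"
    proof -
      have "c - i < l" using assms by simp
      then show ?thesis
        by (simp only: sum.delta finite_lessThan lessThan_iff if_True sum_distrib_right) (simp only: mult_ac)
    qed
    also have "\<dots> = (if i \<le> c \<and> r = c then \<Sum>k<d. (- 1) ^ i / of_nat d / qfact \<zeta> i * Eprod l p c i *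
       q (A i + b i * int k + int j * ((wt l p c + int i) - int k)) else 0)"
    proof (rule if_cong[OF refl _ refl], rule sum.cong[OF refl], rule arg_cong2[of _ _ _ _ "(*)", OF refl])
      fix k assume "i \<le> c \<and> r = c"
      then have "?X k + wt l p c * int j = A i + b i * int k + int j * ((wt l p c + int i) - int k)"
        by (simp add: A_def b_def wt_def of_nat_diff algebra_simps)
      then show "q (?X k) * q (wt l p c * int j) = q (A i + b i * int k + int j * ((wt l p c + int i) - int k))"
        unfolding q_add[symmetric] by (rule arg_cong)
    qed
    \<comment> \<open>The condition that i is at most c, which gave \<open>c - i\<close> its meaning
      as an integer difference, can now be dropped because \<open>Eprod\<close> vanishes for i >
      c.\<close>
    also have "\<dots> = (if r = c then \<Sum>k<d. (- 1) ^ i / of_nat d / qfact \<zeta> i * Eprod l p c i *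
       q (A i + b i * int k + int j * ((wt l p c + int i) - int k)) else 0)"
      by (cases "i \<le> c") (simp_all add: Eprod_eq_0)
    finally show ?thesis .
  qed
  have "act ?M (u_elt d \<zeta>) $$ (r, c) =
     (\<Sum>i<d. \<Sum>j<d. (act ?M (antipode d \<zeta> (beta d \<zeta> i j)) * act ?M (EK i j)) $$ (r, c))"
    using assms
    by (simp add: u_elt_def index_act_concat o_def case_prod_beta act_elt_mult[OF simple_carrier] sum_list_map_product
      interv_sum_list_conv_sum_set_nat lessThan_atLeast0 del: index_mult_mat)
  also have "\<dots> = (if r = c then \<Sum>i<d. (- 1) ^ i / of_nat d / qfact \<zeta> i * Eprod l p c i *
     (\<Sum>j<d. \<Sum>k<d. q (A i + b i * int k + int j * ((wt l p c + int i) - int k))) else 0)"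
    unfolding e by (simp add: sum_distrib_left)
  also have "\<dots> = (if r = c then \<Sum>i<d. q ((int p + int c) * wt l p c) *
     ((- 1) ^ i * q (- int i * (int p + int l - int c)) * Eprod l p c i / qfact \<zeta> i) else 0)"
  proof (rule if_cong[OF refl _ refl], rule sum.cong[OF refl])
    fix i
    have "q (A i + b i * (wt l p c + int i)) = q ((int p + int c) * wt l p c) * q (- int i * (int p + int l - int c))"
      unfolding q_add[symmetric] by (rule arg_cong[of _ _ q]) (simp add: A_def b_def wt_def algebra_simps)
    then show "(- 1) ^ i / of_nat d / qfact \<zeta> i * Eprod l p c i *
       (\<Sum>j<d. \<Sum>k<d. q (A i + b i * int k + int j * ((wt l p c + int i) - int k))) = q ((int p + int c) * wt l p c) *
     ((- 1) ^ i * q (- int i * (int p + int l - int c)) * Eprod l p c i / qfact \<zeta> i)"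
      unfolding q_double_sum using d by (simp add: mult_ac)
  qed
  also have "\<dots> = (if r = c then q ((int p + int c) * wt l p c) * q (- (int l - int c) * int c) else 0)"
    unfolding sum_distrib_left[symmetric] using assms by (simp only: twist_sum)
  also have "q ((int p + int c) * wt l p c) * q (- (int l - int c) * int c) = q ((int p + int c) * wt l p c - (int l - int c) * int c)"
    unfolding q_add[symmetric] by (rule arg_cong[of _ _ q]) (simp add: algebra_simps)
  finally show ?thesis .
qed

text \<open>The dependence on c cancels in (p+c)(p+l-c) - (l-c)c = p(p+l), the total exponent of z,
  K^-1 and u.\<close>

lemma act_theta1:
  assumes l: "0 < l" "l \<le> d"
  shows "act (V l p) (theta1 d \<zeta>) = q (int p * (int p + int l)) \<cdot>\<^sub>m 1\<^sub>m l"
proof (rule eq_matI)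
  let ?M = "V l p" let ?s = "2 * int p + int l - 1"
  let ?D = "\<lambda>c. mat l l (\<lambda>(r, s). if r = s then c r else 0) :: complex mat"
  fix r c assume "r < dim_row (q (int p * (int p + int l)) \<cdot>\<^sub>m 1\<^sub>m l)" "c < dim_col (q (int p * (int p + int l)) \<cdot>\<^sub>m 1\<^sub>m l)"
  then have rc: "r < l" "c < l" by auto
  have U: "act ?M (u_elt d \<zeta>) \<in> carrier_mat l l" using act_carrier[of ?M] by simp
  have "act ?M [(1, [gz])] = ?D (\<lambda>_. q ?s)"
    using l db_carrierD(4)[OF simple_carrier, of l p]
    by (simp add: act_word[OF simple_carrier] word_mat_Cons) (simp add: actz_simple)
  moreover have "act ?M [(1, gpow d gK (- 1))] = ?D (\<lambda>r. q (wt l p r * - 1))"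
    by (simp only: act_word[OF simple_carrier] word_gpow_K)
  ultimately have "act ?M (theta1 d \<zeta>) = ?D (\<lambda>_. q ?s) * (?D (\<lambda>r. q (wt l p r * - 1)) * act ?M (u_elt d \<zeta>))"
    by (simp only: theta1_def theta_def act_elt_mult[OF simple_carrier])
  then have "act ?M (theta1 d \<zeta>) $$ (r, c) = q ?s * (q (wt l p r * - 1) * act ?M (u_elt d \<zeta>) $$ (r, c))"
    using rc by (simp only: index_mult_diag_left[OF mult_carrier_mat[OF mat_carrier U]] index_mult_diag_left[OF U])
  also have "\<dots> = (if r = c then q ?s * (q (wt l p c * - 1) * q ((int p + int c) * wt l p c - (int l - int c) * int c)) else 0)"
    using rc l by (simp add: index_u)
  also have "q ?s * (q (wt l p c * - 1) * q ((int p + int c) * wt l p c - (int l - int c) * int c)) = q (int p * (int p + int l))"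
    unfolding q_add[symmetric] by (rule arg_cong[of _ _ q]) (simp add: wt_def algebra_simps)
  finally show "act ?M (theta1 d \<zeta>) $$ (r, c) = (q (int p * (int p + int l)) \<cdot>\<^sub>m 1\<^sub>m l) $$ (r, c)"
    using rc by simp
qed (use act_carrier[of "V l p"] in auto)

lemma theta1_inv_simple:
  assumes l: "0 < l" "l \<le> d"
  shows "theta1_inv_mat d \<zeta> (V l p) = q (- (int p * (int p + int l))) \<cdot>\<^sub>m 1\<^sub>m l"
  unfolding theta1_inv_mat_def act_theta1[OF l] rdim_simple
proof (rule the_equality)
  let ?n = "int p * (int p + int l)"
  have c: "q (- ?n) * q ?n = 1" "q ?n * q (- ?n) = 1" by (simp_all flip: q_add)
  show "q (- ?n) \<cdot>\<^sub>m 1\<^sub>m l \<in> carrier_mat l l \<and> inverts_mat (q (- ?n) \<cdot>\<^sub>m 1\<^sub>m l) (q ?n \<cdot>\<^sub>m 1\<^sub>m l) \<and>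
      inverts_mat (q ?n \<cdot>\<^sub>m 1\<^sub>m l) (q (- ?n) \<cdot>\<^sub>m 1\<^sub>m l)"
    by (simp add: inverts_mat_def mult_smult_assoc_mat[of _ l l _ l] c)
  fix A assume A: "A \<in> carrier_mat l l \<and> inverts_mat A (q ?n \<cdot>\<^sub>m 1\<^sub>m l) \<and> inverts_mat (q ?n \<cdot>\<^sub>m 1\<^sub>m l) A"
  then have "q ?n \<cdot>\<^sub>m A = 1\<^sub>m l"
    using mult_smult_assoc_mat[of "1\<^sub>m l" l l A l "q ?n"] by (auto simp: inverts_mat_def)
  then have "q (- ?n) \<cdot>\<^sub>m (q ?n \<cdot>\<^sub>m A) = q (- ?n) \<cdot>\<^sub>m 1\<^sub>m l" by simp
  then show "A = q (- ?n) \<cdot>\<^sub>m 1\<^sub>m l" by (simp add: c)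
qed

lemma stab_T_simple:
  assumes l: "0 < l" "l < d"
  shows "stab_T d \<zeta> (l, p) (l, p) = q (- (int p * (int p + int l)))"
proof -
  let ?M = "V l p" let ?t = "q (- (int p * (int p + int l)))"
  \<comment> \<open>The quantum dimension is a power of \<zeta> times a geometric sum of length l,
    nonzero because d does not divide l.\<close>
  have "\<not> int d dvd - int l" using l by (auto dest: dvd_imp_le)
  then have "1 - q (- int l) \<noteq> 0" using q_eq_1_iff[of "- int l"] by auto
  then have "(\<Sum>a<l. q (- 1 * int a)) \<noteq> 0"
    using q_sum[of "- 1" l] by auto
  moreover have "(\<Sum>a<l. q (- (int p + int a))) = q (- int p) * (\<Sum>a<l. q (- 1 * int a))"
    unfolding sum_distrib_left q_add[symmetric] by simp
  ultimately have dim: "Tr_plus d ?M (1\<^sub>m (rdim ?M)) \<noteq> 0"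
    using l by (simp add: Tr_plus_one)
  have tw: "stab_twist_inv d \<zeta> ?M = stab_scalar d \<zeta> ?M ?t"
    using l by (simp add: stab_twist_inv_def stab_scalar_def theta1_inv_simple)
  have "(THE t. stab_twist_inv d \<zeta> ?M = stab_scalar d \<zeta> ?M t) = ?t"
    unfolding tw using stab_scalar_inject[OF d \<zeta> simple_carrier dim] by (intro the_equality) auto
  then show ?thesis by (simp add: stab_T_def)
qed

end

section \<open>The exterior powers in Malle's datum\<close>

text \<open>Both maps list the same finite set in increasing order.\<close>

lemma strict_mono_on_image_unique:
  fixes f g :: "'a::linorder \<Rightarrow> 'b::linorder"
  assumes A: "finite A" and f: "strict_mono_on A f" and g: "strict_mono_on A g" and eq: "f ` A = g ` A" and x: "x \<in> A"
  shows "f x = g x"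
proof -
  let ?xs = "sorted_list_of_set A"
  have "sorted_wrt (<) (map h ?xs)" if h: "strict_mono_on A h" for h :: "'a \<Rightarrow> 'b"
    unfolding sorted_wrt_map
    by (rule sorted_wrt_mono_rel[OF _ strict_sorted_list_of_set]) (use h A in \<open>auto simp: strict_mono_on_def\<close>)
  then have "map f ?xs = map g ?xs"
    using f g eq A by (intro strict_sorted_equal) auto
  then show ?thesis using x A by (simp add: map_eq_conv)
qed

text \<open>The increasing enumeration of the numbers other than k. It is also the reindexing
  performed by \<open>mat_delete\<close>, so minors with one row and one column deleted appear
  without further bookkeeping.\<close>

definition skip :: "nat \<Rightarrow> nat \<Rightarrow> nat" where
  "skip k m = (if m < k then m else Suc m)"

text \<open>Elements of \<open>Psi d\<close>, given by the values \<open>i < j\<close> on \<open>{0, 1}\<close> and the value \<open>k\<close> omitted on \<open>{2..d}\<close>.\<close>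

definition mfun :: "nat \<Rightarrow> nat \<Rightarrow> nat \<Rightarrow> nat \<Rightarrow> nat \<Rightarrow> nat" where
  "mfun d i j k y = (if y = 0 then i else if y = 1 then j else if y \<le> d then skip k (y - 2) else undefined)"

lemma skip_mono: "strict_mono (skip k)"
  by (auto simp: strict_mono_def skip_def)

lemma skip_image: "k < d \<Longrightarrow> skip k ` {..<d - 1} = {..<d} - {k}"
proof (intro equalityI subsetI)
  fix x assume x: "x \<in> {..<d} - {k}" and k: "k < d"
  show "x \<in> skip k ` {..<d - 1}"
  proof (cases "x < k")
    case True
    then show ?thesis using x k by (intro image_eqI[of _ _ x]) (auto simp: skip_def)
  next
    case False
    then show ?thesis using x k by (intro image_eqI[of _ _ "x - 1"]) (auto simp: skip_def)
  qed
qed (auto simp: skip_def split: if_splits)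

lemma atLeastAtMost_2_image: "{2..d :: nat} = (\<lambda>m. m + 2) ` {..<d - 1}"
proof (intro equalityI subsetI)
  fix x assume "x \<in> {2..d}"
  then show "x \<in> (\<lambda>m. m + 2) ` {..<d - 1}" by (intro image_eqI[of _ _ "x - 2"]) auto
qed auto

lemma mfun_image: "k < d \<Longrightarrow> mfun d i j k ` {2..d} = {..<d} - {k}"
proof -
  assume k: "k < d"
  have "mfun d i j k ` {2..d} = (\<lambda>m. skip k m) ` {..<d - 1}"
    unfolding atLeastAtMost_2_image image_image by (intro image_cong) (auto simp: mfun_def)
  then show ?thesis using skip_image[OF k] by simp
qed

lemma strict_mono_on_mfun: "strict_mono_on {2..d} (mfun d i j k)"
  using skip_mono[of k] by (auto simp: strict_mono_on_def strict_mono_def mfun_def)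

lemma mfun_Psi:
  assumes "d \<ge> 2" "i < j" "j < d" "k < d"
  shows "mfun d i j k \<in> Psi d"
proof -
  have "mfun d i j k y < d" if "y \<le> d" for y
    using that assms by (auto simp: mfun_def skip_def)
  then have "mfun d i j k \<in> Yfun d"
    using assms by (auto simp: Yfun_def PiE_def extensional_def mfun_def)
  then show ?thesis
    using strict_mono_on_mfun[of d i j k] assms by (auto simp: Psi_def strict_mono_on_def mfun_def)
qed

lemma missing_value:
  fixes g :: "nat \<Rightarrow> nat"
  assumes d: "d \<ge> 2" and g: "g \<in> Yfun d" and inj: "inj_on g {2..d}"
  obtains k where "k < d" "g ` {2..d} = {..<d} - {k}"
proof -
  have sub: "g ` {2..d} \<subseteq> {..<d}" using g by (auto simp: Yfun_def PiE_def Pi_def)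
  have "card ({..<d} - g ` {2..d}) = 1"
    using d by (subst card_Diff_subset) (auto simp: sub card_image[OF inj])
  then obtain k where "{..<d} - g ` {2..d} = {k}" by (auto simp: card_1_singleton_iff)
  then show ?thesis using sub by (intro that[of k]) auto
qed

lemma Psi_cases:
  assumes d: "d \<ge> 2" and f: "f \<in> Psi d"
  obtains i j k where "i < j" "j < d" "k < d" "f = mfun d i j k"
proof -
  have m: "f \<in> Yfun d" "strict_mono_on {2..d} f" "f 0 < f 1"
    using f by (auto simp: Psi_def strict_mono_on_def)
  obtain k where k: "k < d" "f ` {2..d} = {..<d} - {k}"
    using missing_value[OF d m(1) strict_mono_on_imp_inj_on[OF m(2)]] by blast
  have "f y = mfun d (f 0) (f 1) k y" for y
  proof -
    consider "y < 2" | "y \<in> {2..d}" | "y > d" using d by force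
    then show ?thesis
    proof cases
      case 1
      then show ?thesis by (cases y) (auto simp: mfun_def less_Suc_eq numeral_2_eq_2)
    next
      case 2
      then show ?thesis
        using strict_mono_on_image_unique[OF _ m(2) strict_mono_on_mfun[of d "f 0" "f 1" k] _ 2] k mfun_image[OF k(1)]
        by simp
    next
      case 3
      then show ?thesis using m(1) d by (auto simp: Yfun_def PiE_def extensional_def mfun_def)
    qed
  qed
  then have "f = mfun d (f 0) (f 1) k" by blast
  moreover have "f 1 < d" using m(1) d by (auto simp: Yfun_def PiE_def Pi_def)
  ultimately show ?thesis using that m(3) k(1) by blast
qed

section \<open>Block permutations and their free action on \<open>Psi d\<close>\<close>

text \<open>The pointwise form makes closure under composition and inverse immediate.\<close>

lemma block_perms_iff:
  assumes d: "d \<ge> 2"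
  shows "\<sigma> \<in> block_perms d \<longleftrightarrow> \<sigma> permutes {0..d} \<and> (\<forall>y. \<sigma> y < 2 \<longleftrightarrow> y < 2)"
proof
  assume "\<sigma> \<in> block_perms d"
  then have p: "\<sigma> permutes {0..d}" and 1: "\<sigma> ` {0, 1} = {0, 1}" and 2: "\<sigma> ` {2..d} = {2..d}"
    by (simp_all only: block_perms_def mem_Collect_eq)
  have "\<sigma> y < 2 \<longleftrightarrow> y < 2" for y
  proof -
    consider "y \<in> {0, 1}" | "y \<in> {2..d}" | "y > d" using d by force
    then show ?thesis
    proof cases
      case 1
      then have "\<sigma> y \<in> \<sigma> ` {0, 1}" by (rule imageI)
      then have "\<sigma> y \<in> {0, 1}" by (simp only: \<open>\<sigma> ` {0, 1} = {0, 1}\<close>)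
      then show ?thesis using 1 by auto
    next
      case 2
      then have "\<sigma> y \<in> \<sigma> ` {2..d}" by (rule imageI)
      then have "\<sigma> y \<in> {2..d}" by (simp only: \<open>\<sigma> ` {2..d} = {2..d}\<close>)
      then show ?thesis using 2 by auto
    next
      case 3
      then show ?thesis using permutes_not_in[OF p, of y] by simp
    qed
  qed
  with p show "\<sigma> permutes {0..d} \<and> (\<forall>y. \<sigma> y < 2 \<longleftrightarrow> y < 2)" by blast
next
  assume *: "\<sigma> permutes {0..d} \<and> (\<forall>y. \<sigma> y < 2 \<longleftrightarrow> y < 2)"
  then have p: "\<sigma> permutes {0..d}" and b: "\<And>y. \<sigma> y < 2 \<longleftrightarrow> y < 2" by auto
  have inj: "inj_on \<sigma> A" for A using permutes_inj[OF p] by (rule inj_on_subset) simp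
  have im: "\<sigma> ` A = A" if "finite A" "\<And>y. y \<in> A \<Longrightarrow> \<sigma> y \<in> A" for A
    using that by (intro card_subset_eq card_image[OF inj] image_subsetI)
  have "\<sigma> y \<in> {0, 1}" if "y \<in> {0, 1}" for y
    using b[of y] that by (simp add: less_2_cases_iff)
  then have 1: "\<sigma> ` {0, 1} = {0, 1}" by (intro im) simp_all
  have "\<sigma> y \<in> {2..d}" if "y \<in> {2..d}" for y
    using b[of y] that permutes_in_image[OF p, of y] by auto
  then have 2: "\<sigma> ` {2..d} = {2..d}" by (intro im) simp_all
  show "\<sigma> \<in> block_perms d" using p 1 2 by (simp only: block_perms_def mem_Collect_eq)
qed

lemma block_perms_permutation: "\<sigma> \<in> block_perms d \<Longrightarrow> permutation \<sigma>"
  unfolding permutation_permutes by (auto simp: block_perms_def)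

lemma block_perms_id: "id \<in> block_perms d"
  by (auto simp: block_perms_def permutes_id)

lemma block_perms_comp:
  assumes "d \<ge> 2" "\<sigma> \<in> block_perms d" "\<tau> \<in> block_perms d"
  shows "\<sigma> \<circ> \<tau> \<in> block_perms d"
  using assms by (simp add: block_perms_iff permutes_compose)

lemma block_perms_inv:
  assumes "d \<ge> 2" "\<sigma> \<in> block_perms d"
  shows "Hilbert_Choice.inv \<sigma> \<in> block_perms d"
proof -
  have p: "\<sigma> permutes {0..d}" and b: "\<And>y. \<sigma> y < 2 \<longleftrightarrow> y < 2" using assms by (auto simp: block_perms_iff)
  show ?thesis
    using b[of "Hilbert_Choice.inv \<sigma> _"] permutes_inverses(1)[OF p] permutes_inv[OF p] by (simp add: block_perms_iff[OF assms(1)])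
qed

lemma finite_block_perms: "finite (block_perms d)"
  by (rule finite_subset[OF _ finite_permutations[of "{0..d}"]]) (auto simp: block_perms_def)

lemma finite_Yfun: "finite (Yfun d)"
  by (simp add: Yfun_def finite_PiE)

lemma finite_Psi: "finite (Psi d)"
  by (rule finite_subset[OF _ finite_Yfun]) (auto simp: Psi_def)

lemma Yfun_comp:
  assumes "f \<in> Yfun d" "\<sigma> permutes {0..d}"
  shows "f \<circ> \<sigma> \<in> Yfun d"
proof -
  have "\<sigma> y \<in> {0..d} \<longleftrightarrow> y \<in> {0..d}" for y using assms(2) by (rule permutes_in_image)
  then show ?thesis using assms permutes_not_in[OF assms(2)] unfolding Yfun_def PiE_def Pi_def extensional_def by auto
qed

text \<open>A block permutation preserves the image of each block, and an increasing map is
  determined by these images; injectivity on the blocks then forces the permutation to be trivial.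
  So \<open>Psi d\<close> meets each of its orbits once, with trivial stabilizer.\<close>

lemma Psi_comp_eq:
  assumes d: "d \<ge> 2" and f: "f \<in> Psi d" and g: "g \<in> Psi d" and \<sigma>: "\<sigma> \<in> block_perms d" and eq: "f = g \<circ> \<sigma>"
  shows "f = g \<and> \<sigma> = id"
proof -
  have \<sigma>': "\<sigma> ` {0, 1} = {0, 1}" "\<sigma> ` {2..d} = {2..d}" "\<sigma> permutes {0..d}"
    using \<sigma> by (simp_all only: block_perms_def mem_Collect_eq)
  have m: "strict_mono_on {0, 1} f" "strict_mono_on {2..d} f" "strict_mono_on {0, 1} g" "strict_mono_on {2..d} g"
    "f \<in> extensional {0..d}" "g \<in> extensional {0..d}"
    using f g by (auto simp: Psi_def Yfun_def PiE_def)
  have im: "f ` {0, 1} = g ` {0, 1}" "f ` {2..d} = g ` {2..d}"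
    unfolding eq image_comp[symmetric] \<sigma>' by simp_all
  have fg: "f y = g y" if "y \<in> {0..d}" for y
  proof -
    have "y \<in> {0, 1} \<or> y \<in> {2..d}" using that by auto
    then show ?thesis
      using strict_mono_on_image_unique[OF _ m(1,3) im(1), of y] strict_mono_on_image_unique[OF _ m(2,4) im(2), of y] by auto
  qed
  then have "f = g" using m(5,6) by (intro extensionalityI) auto
  moreover have "\<sigma> y = y" for y
  proof (cases "y \<in> {0..d}")
    case True
    have e: "g (\<sigma> y) = g y" using eq \<open>f = g\<close> by (metis comp_apply)
    have "(y \<in> {0, 1} \<and> \<sigma> y \<in> {0, 1}) \<or> (y \<in> {2..d} \<and> \<sigma> y \<in> {2..d})"
    proof (cases "y < 2")
      case True
      then have "y \<in> {0, 1}" by auto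
      moreover from this have "\<sigma> y \<in> \<sigma> ` {0, 1}" by (rule imageI)
      ultimately show ?thesis by (simp only: \<sigma>'(1) simp_thms)
    next
      case False
      then have "y \<in> {2..d}" using True by auto
      moreover from this have "\<sigma> y \<in> \<sigma> ` {2..d}" by (rule imageI)
      ultimately show ?thesis by (simp only: \<sigma>'(2) simp_thms)
    qed
    then show ?thesis
      using e strict_mono_on_imp_inj_on[OF m(3)] strict_mono_on_imp_inj_on[OF m(4)] by (auto dest: inj_onD)
  qed (use permutes_not_in[OF \<sigma>'(3)] in auto)
  ultimately show ?thesis by (auto simp: fun_eq_iff)
qed

text \<open>The vector of h is supported on the free orbit of h. Distinct elements of
  \<open>Psi d\<close> thus give disjoint supports, which yields linear independence.\<close>

lemma wedge_vec_Psi_comp: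
  assumes d: "d \<ge> 2" and f: "f \<in> Psi d" and h: "h \<in> Psi d" and \<tau>: "\<tau> \<in> block_perms d"
  shows "wedge_vec d h (f \<circ> \<tau>) = (if h = f then of_int (sign \<tau>) else 0)"
proof -
  have p: "\<tau> permutes {0..d}" using \<tau> by (simp add: block_perms_def)
  have iff: "f \<circ> \<tau> = h \<circ> \<sigma> \<longleftrightarrow> h = f \<and> \<sigma> = \<tau>" if \<sigma>: "\<sigma> \<in> block_perms d" for \<sigma>
  proof
    assume *: "f \<circ> \<tau> = h \<circ> \<sigma>"
    have "f = f \<circ> \<tau> \<circ> Hilbert_Choice.inv \<tau>" by (simp add: comp_assoc permutes_inv_o[OF p])
    also have "\<dots> = h \<circ> (\<sigma> \<circ> Hilbert_Choice.inv \<tau>)" by (simp add: * comp_assoc)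
    finally have "f = h \<and> \<sigma> \<circ> Hilbert_Choice.inv \<tau> = id"
      by (intro Psi_comp_eq[OF d f h block_perms_comp[OF d \<sigma> block_perms_inv[OF d \<tau>]]])
    then have "f = h" "\<sigma> \<circ> Hilbert_Choice.inv \<tau> = id" by auto
    have "\<sigma> = \<sigma> \<circ> Hilbert_Choice.inv \<tau> \<circ> \<tau>" by (simp add: comp_assoc permutes_inv_o[OF p])
    then have "\<sigma> = \<tau>" using \<open>\<sigma> \<circ> Hilbert_Choice.inv \<tau> = id\<close> by simp
    then show "h = f \<and> \<sigma> = \<tau>" using \<open>f = h\<close> by simp
  qed auto
  have "wedge_vec d h (f \<circ> \<tau>) = (\<Sum>\<sigma>\<in>block_perms d. if \<sigma> = \<tau> then if h = f then of_int (sign \<sigma>) else 0 else 0)"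
    unfolding wedge_vec_def by (intro sum.cong refl) (simp add: iff)
  then show ?thesis using \<tau> by (simp add: finite_block_perms)
qed

lemma exists_block_sorting:
  assumes inj: "inj_on g B" "inj_on h B" and im: "g ` B = h ` B"
  obtains \<tau> where "\<tau> permutes B" "\<And>y. y \<in> B \<Longrightarrow> g y = h (\<tau> y)"
proof -
  define \<tau> where "\<tau> y = (if y \<in> B then inv_into B h (g y) else y)" for y
  have h\<tau>: "h (\<tau> y) = g y" "\<tau> y \<in> B" if "y \<in> B" for y
    using that im f_inv_into_f[of "g y" h B] inv_into_into[of "g y" h B] by (auto simp: \<tau>_def)
  have "bij_betw \<tau> B B"
  proof (rule bij_betw_imageI)
    show "inj_on \<tau> B" using inj(1) h\<tau>(1) by (metis inj_on_def)
    show "\<tau> ` B = B"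
    proof (intro equalityI subsetI)
      fix x assume x: "x \<in> B"
      then obtain y where y: "y \<in> B" "g y = h x" using im by (metis imageE image_eqI)
      then have "\<tau> y = x" using h\<tau>[OF y(1)] inj(2) x by (metis inj_onD)
      then show "x \<in> \<tau> ` B" using y(1) by blast
    qed (use h\<tau> in auto)
  qed
  then have "\<tau> permutes B" by (rule bij_imp_permutes) (simp add: \<tau>_def)
  then show ?thesis using that h\<tau>(1) by metis
qed

text \<open>Sort the values separately in each block; on the second block the sorted map is fixed by
  the single missing value.\<close>

lemma exists_Psi_comp:
  assumes d: "d \<ge> 2" and g: "g \<in> Yfun d" and inj: "g 0 \<noteq> g 1" "inj_on g {2..d}"
  obtains h \<tau> where "h \<in> Psi d" "\<tau> \<in> block_perms d" "g = h \<circ> \<tau>"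
proof -
  obtain k where k: "k < d" "g ` {2..d} = {..<d} - {k}" using missing_value[OF d g inj(2)] by blast
  define i j where "i = min (g 0) (g 1)" and "j = max (g 0) (g 1)"
  have gd: "g 0 < d" "g 1 < d" using g d by (auto simp: Yfun_def PiE_def Pi_def)
  then have ij: "i < j" "j < d" using inj(1) by (auto simp: i_def j_def)
  let ?h = "mfun d i j k"
  have hP: "?h \<in> Psi d" using d ij k(1) by (intro mfun_Psi)
  have "g ` {0, 1} = ?h ` {0, 1}" by (auto simp: mfun_def i_def j_def min_def max_def)
  moreover have "inj_on g {0, 1}" "inj_on ?h {0, 1}" using inj(1) ij by (auto simp: inj_on_def mfun_def)
  ultimately obtain \<tau>1 where t1: "\<tau>1 permutes {0, 1}" "\<And>y. y \<in> {0, 1} \<Longrightarrow> g y = ?h (\<tau>1 y)"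
    using exists_block_sorting[of g "{0, 1}" ?h] by blast
  obtain \<tau>2 where t2: "\<tau>2 permutes {2..d}" "\<And>y. y \<in> {2..d} \<Longrightarrow> g y = ?h (\<tau>2 y)"
    using exists_block_sorting[OF inj(2) strict_mono_on_imp_inj_on[OF strict_mono_on_mfun]] k mfun_image[OF k(1)] by metis
  let ?\<tau> = "\<tau>1 \<circ> \<tau>2"
  have v: "?\<tau> y = (if y \<in> {0, 1} then \<tau>1 y else if y \<in> {2..d} then \<tau>2 y else y)" for y
  proof -
    have "\<tau>2 y \<in> {2..d}" if "y \<in> {2..d}" using that permutes_in_image[OF t2(1)] by blast
    then show ?thesis
      using permutes_not_in[OF t1(1), of y] permutes_not_in[OF t2(1), of y] permutes_not_in[OF t1(1), of "\<tau>2 y"] by auto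
  qed
  have "\<tau>1 permutes {0..d}" "\<tau>2 permutes {0..d}"
    using permutes_subset[OF t1(1), of "{0..d}"] permutes_subset[OF t2(1), of "{0..d}"] d by auto
  then have p: "?\<tau> permutes {0..d}" by (intro permutes_compose)
  have "?\<tau> y < 2 \<longleftrightarrow> y < 2" for y
    using permutes_in_image[OF t1(1), of y] permutes_in_image[OF t2(1), of y] unfolding v by auto
  then have "?\<tau> \<in> block_perms d" using p by (simp add: block_perms_iff[OF d])
  moreover have "g y = (?h \<circ> ?\<tau>) y" for y
  proof (cases "y \<le> d")
    case True
    then have "y \<in> {0, 1} \<or> y \<in> {2..d}" by auto
    then show ?thesis using t1(2)[of y] t2(2)[of y] unfolding comp_apply[of ?h] v by auto
  next
    case False
    then show ?thesis using g d unfolding comp_apply[of ?h] v by (auto simp: Yfun_def PiE_def extensional_def mfun_def)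
  qed
  ultimately show ?thesis using that[OF hP] by blast
qed

section \<open>Coefficients of the exterior powers as minors\<close>

text \<open>A product of a minor of order 2 and one of order d - 1, kept as one signed sum so that
  equivariance under block permutations is visible.\<close>

definition wedge_minor :: "nat \<Rightarrow> complex \<Rightarrow> (nat \<Rightarrow> nat) \<Rightarrow> (nat \<Rightarrow> nat) \<Rightarrow> complex" where
  "wedge_minor d \<zeta> g f = (\<Sum>\<sigma>\<in>block_perms d. of_int (sign \<sigma>) * (\<Prod>y=0..d. fourier \<zeta> (g y) (f (\<sigma> y))))"

lemma fourier_tensor_wedge:
  assumes f: "f \<in> Yfun d"
  shows "fourier_tensor d \<zeta> (wedge_vec d f) g = wedge_minor d \<zeta> g f"
proof -
  have "fourier_tensor d \<zeta> (wedge_vec d f) g =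
     (\<Sum>h\<in>Yfun d. \<Sum>\<sigma>\<in>block_perms d. if h = f \<circ> \<sigma> then of_int (sign \<sigma>) * (\<Prod>y=0..d. fourier \<zeta> (g y) (h y)) else 0)"
    unfolding fourier_tensor_def wedge_vec_def sum_distrib_left by (intro sum.cong refl) auto
  also have "\<dots> = (\<Sum>\<sigma>\<in>block_perms d. \<Sum>h\<in>Yfun d. if h = f \<circ> \<sigma> then of_int (sign \<sigma>) * (\<Prod>y=0..d. fourier \<zeta> (g y) (h y)) else 0)"
    by (rule sum.swap)
  also have "\<dots> = wedge_minor d \<zeta> g f"
    unfolding wedge_minor_def
  proof (intro sum.cong refl)
    fix \<sigma> assume "\<sigma> \<in> block_perms d"
    then have "f \<circ> \<sigma> \<in> Yfun d" by (intro Yfun_comp[OF f]) (simp add: block_perms_def)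
    then show "(\<Sum>h\<in>Yfun d. if h = f \<circ> \<sigma> then of_int (sign \<sigma>) * (\<Prod>y=0..d. fourier \<zeta> (g y) (h y)) else 0) =
        of_int (sign \<sigma>) * (\<Prod>y=0..d. fourier \<zeta> (g y) (f (\<sigma> y)))"
      by (simp add: finite_Yfun)
  qed
  finally show ?thesis .
qed

lemma wedge_minor_comp:
  assumes d: "d \<ge> 2" and \<tau>: "\<tau> \<in> block_perms d"
  shows "wedge_minor d \<zeta> (g \<circ> \<tau>) f = of_int (sign \<tau>) * wedge_minor d \<zeta> g f"
proof -
  have p: "\<tau> permutes {0..d}" using \<tau> by (simp add: block_perms_def)
  have "wedge_minor d \<zeta> (g \<circ> \<tau>) f =
    (\<Sum>\<rho>\<in>block_perms d. of_int (sign (\<rho> \<circ> \<tau>)) * (\<Prod>y=0..d. fourier \<zeta> (g (\<tau> y)) (f (\<rho> (\<tau> y)))))"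
    unfolding wedge_minor_def
    by (rule sum.reindex_bij_witness[of _ "\<lambda>\<rho>. \<rho> \<circ> \<tau>" "\<lambda>\<sigma>. \<sigma> \<circ> Hilbert_Choice.inv \<tau>"])
      (auto simp: comp_assoc permutes_inv_o[OF p] permutes_inverses[OF p]
        intro: block_perms_comp[OF d] \<tau> block_perms_inv[OF d])
  also have "\<dots> = (\<Sum>\<rho>\<in>block_perms d. of_int (sign \<tau>) * (of_int (sign \<rho>) * (\<Prod>y=0..d. fourier \<zeta> (g y) (f (\<rho> y)))))"
  proof (intro sum.cong refl)
    fix \<rho> assume "\<rho> \<in> block_perms d"
    then have "sign (\<rho> \<circ> \<tau>) = sign \<tau> * sign \<rho>"
      using \<tau> by (simp add: sign_compose block_perms_permutation)
    moreover have "(\<Prod>y=0..d. fourier \<zeta> (g (\<tau> y)) (f (\<rho> (\<tau> y)))) = (\<Prod>y=0..d. fourier \<zeta> (g y) (f (\<rho> y)))"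
      using prod.permute[OF p, of "\<lambda>y. fourier \<zeta> (g y) (f (\<rho> y))"] by (simp add: o_def)
    ultimately show "of_int (sign (\<rho> \<circ> \<tau>)) * (\<Prod>y=0..d. fourier \<zeta> (g (\<tau> y)) (f (\<rho> (\<tau> y)))) =
        of_int (sign \<tau>) * (of_int (sign \<rho>) * (\<Prod>y=0..d. fourier \<zeta> (g y) (f (\<rho> y))))" by simp
  qed
  finally show ?thesis by (simp add: wedge_minor_def sum_distrib_left)
qed

text \<open>The transposition fixes g and has sign -1, so the minor equals its own negative.\<close>

lemma wedge_minor_eq_0:
  assumes d: "d \<ge> 2" and \<tau>: "transpose a b \<in> block_perms d" and ab: "a \<noteq> b" "g a = g b"
  shows "wedge_minor d \<zeta> g f = 0"
proof -
  have "g \<circ> transpose a b = g" using ab(2) by (auto simp: fun_eq_iff transpose_def)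
  then show ?thesis using wedge_minor_comp[OF d \<tau>, of \<zeta> g f] ab(1) by (simp add: sign_swap_id)
qed

text \<open>If g were in the orbit of h, a conjugate of the transposition would stabilize h,
  contrary to freeness of the action.\<close>

lemma wedge_vec_eq_0:
  assumes d: "d \<ge> 2" and \<tau>: "transpose a b \<in> block_perms d" and ab: "a \<noteq> b" "g a = g b" and h: "h \<in> Psi d"
  shows "wedge_vec d h g = 0"
proof -
  have "g \<noteq> h \<circ> \<sigma>" if \<sigma>: "\<sigma> \<in> block_perms d" for \<sigma>
  proof
    assume g: "g = h \<circ> \<sigma>"
    have gt: "g \<circ> transpose a b = g" using ab(2) by (auto simp: fun_eq_iff transpose_def)
    have p: "\<sigma> permutes {0..d}" using \<sigma> by (simp add: block_perms_def)
    have "h = h \<circ> (\<sigma> \<circ> transpose a b \<circ> Hilbert_Choice.inv \<sigma>)"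
      using gt g by (metis comp_assoc comp_id permutes_inv_o(1)[OF p])
    then have "\<sigma> \<circ> transpose a b \<circ> Hilbert_Choice.inv \<sigma> = id"
      using Psi_comp_eq[OF d h h] \<sigma> \<tau> by (metis block_perms_comp[OF d] block_perms_inv[OF d])
    then have "\<sigma> (transpose a b (Hilbert_Choice.inv \<sigma> (\<sigma> a))) = \<sigma> a" by (metis comp_apply id_apply)
    then have "\<sigma> b = \<sigma> a" using permutes_inverses(2)[OF p] by simp
    then show False using ab(1) permutes_inj[OF p] by (simp add: inj_eq)
  qed
  then show ?thesis unfolding wedge_vec_def by (intro sum.neutral) auto
qed

lemma transpose_block_perms:
  assumes d: "d \<ge> 2" and ab: "{a, b} \<subseteq> {0, 1} \<or> {a, b} \<subseteq> {2..d}"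
  shows "transpose a b \<in> block_perms d"
proof -
  have "a \<in> {0..d}" "b \<in> {0..d}" using ab d by auto
  then have "transpose a b permutes {0..d}" by (rule permutes_swap_id)
  moreover have "transpose a b y < 2 \<longleftrightarrow> y < 2" for y
    using ab by (cases "y = a"; cases "y = b") (auto simp: transpose_def)
  ultimately show ?thesis by (simp add: block_perms_iff[OF d])
qed

text \<open>Every point of \<open>Yfun d\<close> either lies in the orbit of an element of
  \<open>Psi d\<close> or repeats a value inside a block; both sides transform by the sign in the
  first case and vanish in the second. Uniqueness of the coefficients follows by evaluating at the
  points of \<open>Psi d\<close> themselves.\<close>

lemma wedge_S_eq:
  assumes d: "d \<ge> 2" and f: "f \<in> Psi d" and f': "f' \<in> Psi d"
  shows "wedge_S d \<zeta> f f' = wedge_minor d \<zeta> f f'"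
proof -
  have Y: "Psi d \<subseteq> Yfun d" by (auto simp: Psi_def)
  have f'Y: "f' \<in> Yfun d" using f' Y by blast
  let ?c = "restrict (\<lambda>h. wedge_minor d \<zeta> h f') (Psi d)"
  have val: "(\<Sum>h\<in>Psi d. c h * wedge_vec d h (h0 \<circ> \<tau>)) = c h0 * of_int (sign \<tau>)"
    if "h0 \<in> Psi d" "\<tau> \<in> block_perms d" for c h0 \<tau>
  proof -
    have "(\<Sum>h\<in>Psi d. c h * wedge_vec d h (h0 \<circ> \<tau>)) = (\<Sum>h\<in>Psi d. if h = h0 then c h * of_int (sign \<tau>) else 0)"
      using that by (intro sum.cong refl) (simp add: wedge_vec_Psi_comp[OF d])
    then show ?thesis using that by (simp add: finite_Psi)
  qed
  have "(THE c. c \<in> extensional (Psi d) \<and>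
     (\<forall>g\<in>Yfun d. fourier_tensor d \<zeta> (wedge_vec d f') g = (\<Sum>h\<in>Psi d. c h * wedge_vec d h g))) = ?c"
  proof (rule the_equality)
    have "wedge_minor d \<zeta> g f' = (\<Sum>h\<in>Psi d. ?c h * wedge_vec d h g)" if g: "g \<in> Yfun d" for g
    proof (cases "g 0 \<noteq> g 1 \<and> inj_on g {2..d}")
      case True
      then obtain h0 \<tau> where h: "h0 \<in> Psi d" "\<tau> \<in> block_perms d" "g = h0 \<circ> \<tau>"
        using exists_Psi_comp[OF d g] by blast
      show ?thesis unfolding h(3) val[OF h(1,2)] wedge_minor_comp[OF d h(2)] using h(1) by simp
    next
      case False
      then obtain a b where ab: "{a, b} \<subseteq> {0, 1} \<or> {a, b} \<subseteq> {2..d}" "a \<noteq> b" "g a = g b"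
      proof (cases "g 0 = g 1")
        case True
        then show ?thesis using that[of 0 1] by simp
      next
        case F: False
        then obtain a b where "a \<in> {2..d}" "b \<in> {2..d}" "a \<noteq> b" "g a = g b"
          using False unfolding inj_on_def by blast
        then show ?thesis using that[of a b] by simp
      qed
      note t = transpose_block_perms[OF d ab(1)]
      show ?thesis
        using wedge_minor_eq_0[OF d t ab(2,3)] wedge_vec_eq_0[OF d t ab(2,3)] by (simp add: sum.neutral)
    qed
    then show "?c \<in> extensional (Psi d) \<and>
      (\<forall>g\<in>Yfun d. fourier_tensor d \<zeta> (wedge_vec d f') g = (\<Sum>h\<in>Psi d. ?c h * wedge_vec d h g))"
      by (simp add: fourier_tensor_wedge[OF f'Y])
  next
    fix c assume c: "c \<in> extensional (Psi d) \<and>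
     (\<forall>g\<in>Yfun d. fourier_tensor d \<zeta> (wedge_vec d f') g = (\<Sum>h\<in>Psi d. c h * wedge_vec d h g))"
    show "c = ?c"
    proof (rule extensionalityI[of _ "Psi d"])
      fix h0 assume h0: "h0 \<in> Psi d"
      then have "wedge_minor d \<zeta> h0 f' = (\<Sum>h\<in>Psi d. c h * wedge_vec d h (h0 \<circ> id))"
        using c Y by (auto simp: fourier_tensor_wedge[OF f'Y])
      then show "c h0 = ?c h0" unfolding val[OF h0 block_perms_id] using h0 by simp
    qed (use c in auto)
  qed
  then show ?thesis using f by (simp add: wedge_S_def)
qed

lemma det_2x2:
  assumes "A \<in> carrier_mat 2 2"
  shows "det (A :: complex mat) = A $$ (0, 0) * A $$ (1, 1) - A $$ (0, 1) * A $$ (1, 0)"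
proof -
  have m: "mat_delete A i j \<in> carrier_mat 1 1" for i j using mat_delete_carrier[OF assms, of i j] by simp
  show ?thesis
    using assms laplace_expansion_column[OF assms, of 0]
    by (simp add: numeral_2_eq_2 cofactor_def det_single[OF m]) (simp add: mat_delete_def)
qed

text \<open>The signed sum over block permutations is the determinant of a block diagonal matrix.\<close>

lemma wedge_minor_mfun:
  assumes d: "d \<ge> 2"
  shows "wedge_minor d \<zeta> (mfun d i j k) (mfun d i' j' k') =
    (fourier \<zeta> i i' * fourier \<zeta> j j' - fourier \<zeta> i j' * fourier \<zeta> j i') *
    det (mat_delete (mat d d (\<lambda>(r, c). fourier \<zeta> r c)) k k')"
proof -
  let ?f = "mfun d i j k" and ?g = "mfun d i' j' k'"
  define A1 where "A1 = mat 2 2 (\<lambda>(r, c). fourier \<zeta> (?f r) (?g c))"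
  define A4 where "A4 = mat (d - 1) (d - 1) (\<lambda>(r, c). fourier \<zeta> (?f (r + 2)) (?g (c + 2)))"
  define A where "A = four_block_mat A1 (0\<^sub>m 2 (d - 1)) (0\<^sub>m (d - 1) 2) A4"
  have c1: "A1 \<in> carrier_mat 2 2" and c4: "A4 \<in> carrier_mat (d - 1) (d - 1)" by (simp_all add: A1_def A4_def)
  have "A \<in> carrier_mat (2 + (d - 1)) (2 + (d - 1))" unfolding A_def by (rule four_block_carrier_mat[OF c1 c4])
  moreover have n: "2 + (d - 1) = Suc d" using d by simp
  ultimately have Ac: "A \<in> carrier_mat (Suc d) (Suc d)" by simp
  have e: "Suc (Suc (x - 2)) = x" if "\<not> x < 2" for x :: nat using that by simp
  have iA: "A $$ (r, c) = (if (r < 2) = (c < 2) then fourier \<zeta> (?f r) (?g c) else 0)" if "r \<le> d" "c \<le> d" for r c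
    unfolding A_def using that d
    by (subst index_mat_four_block) (auto simp: A1_def A4_def e)
  have "det A = (\<Sum>p | p permutes {0..<Suc d}. of_int (sign p) * (\<Prod>y=0..<Suc d. A $$ (y, p y)))"
    by (rule det_def'[OF Ac])
  also have "\<dots> = (\<Sum>p | p permutes {0..d}. of_int (sign p) * (\<Prod>y=0..d. A $$ (y, p y)))"
    by (simp add: atLeastLessThanSuc_atLeastAtMost)
  also have "\<dots> = (\<Sum>p\<in>block_perms d. of_int (sign p) * (\<Prod>y=0..d. A $$ (y, p y)))"
  proof (rule sum.mono_neutral_right)
    show "finite {p. p permutes {0..d}}" by (rule finite_permutations) simp
    show "block_perms d \<subseteq> {p. p permutes {0..d}}" by (auto simp: block_perms_def)
    \<comment> \<open>A permutation mixing the two blocks picks an entry of an off-diagonal zero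
      block.\<close>
    show "\<forall>p\<in>{p. p permutes {0..d}} - block_perms d. of_int (sign p) * (\<Prod>y=0..d. A $$ (y, p y)) = 0"
    proof
      fix p assume p: "p \<in> {p. p permutes {0..d}} - block_perms d"
      then obtain y where y: "(p y < 2) \<noteq> (y < 2)" by (auto simp: block_perms_iff[OF d])
      have pp: "p permutes {0..d}" using p by simp
      have yd: "y \<in> {0..d}" using y permutes_not_in[OF pp, of y] by (cases "y \<in> {0..d}") auto
      then have "p y \<in> {0..d}" using permutes_in_image[OF pp] by blast
      then have "A $$ (y, p y) = 0" using yd y by (auto simp: iA)
      then have "(\<Prod>y=0..d. A $$ (y, p y)) = 0" using yd by (intro prod_zero) auto
      then show "of_int (sign p) * (\<Prod>y=0..d. A $$ (y, p y)) = 0" by simp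
    qed
  qed
  also have "\<dots> = wedge_minor d \<zeta> ?f ?g"
    unfolding wedge_minor_def
  proof (intro sum.cong refl arg_cong2[of _ _ _ _ "(*)"] prod.cong)
    fix p y assume p: "p \<in> block_perms d" and y: "y \<in> {0..d}"
    then have "p y \<in> {0..d}" by (auto simp: block_perms_def dest: permutes_in_image)
    then show "A $$ (y, p y) = fourier \<zeta> (?f y) (?g (p y))"
      using y p by (simp add: iA block_perms_iff[OF d])
  qed
  finally have "wedge_minor d \<zeta> ?f ?g = det A1 * det A4"
    using det_four_block_mat_lower_left_zero[OF c1 _ refl c4, of "0\<^sub>m 2 (d - 1)"] by (simp add: A_def)
  also have "det A1 = fourier \<zeta> i i' * fourier \<zeta> j j' - fourier \<zeta> i j' * fourier \<zeta> j i'"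
    unfolding det_2x2[OF c1] by (simp add: A1_def mfun_def)
  also have "A4 = mat_delete (mat d d (\<lambda>(r, c). fourier \<zeta> r c)) k k'"
    unfolding mat_delete_def A4_def by (rule eq_matI) (auto simp: mfun_def skip_def)
  finally show ?thesis .
qed

context taft
begin

section \<open>Cofactors and determinant of the Fourier matrix\<close>

abbreviation "Smat \<equiv> mat d d (\<lambda>(r, c). fourier \<zeta> r c)"
abbreviation "Sbar \<equiv> mat d d (\<lambda>(r, c). q (- (int r * int c)))"

lemma fourier_q: "fourier \<zeta> a b = q (int a * int b)"
  by (simp add: fourier_def q_of_nat)

lemma cnj_q: "cnj (q n) = q (- n)"
proof -
  have "norm \<zeta> ^ d = 1" using \<zeta>_pow_d by (metis norm_power norm_one)
  then have "norm \<zeta> = 1" using d by (intro power_eq_imp_eq_base[of "norm \<zeta>" d 1]) auto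
  then have "\<zeta> * cnj \<zeta> = 1" using complex_norm_square[of \<zeta>] by simp
  then have "cnj \<zeta> = inverse \<zeta>" by (rule inverse_unique[symmetric])
  moreover have "cnj (\<zeta> powi n) = cnj \<zeta> powi n" by (simp add: power_int_def)
  ultimately show ?thesis
    by (simp add: q_def power_int_inverse power_int_minus)
qed

lemma Sbar_S: "Sbar * Smat = of_nat d \<cdot>\<^sub>m 1\<^sub>m d"
proof (rule eq_matI)
  fix r c assume "r < dim_row (complex_of_nat d \<cdot>\<^sub>m 1\<^sub>m d)" "c < dim_col (complex_of_nat d \<cdot>\<^sub>m 1\<^sub>m d)"
  then have rc: "r < d" "c < d" by auto
  have "(Sbar * Smat) $$ (r, c) = (\<Sum>m<d. Sbar $$ (r, m) * Smat $$ (m, c))"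
    using rc by (intro index_mult_mat_sum) auto
  also have "\<dots> = (\<Sum>m<d. q (int m * (int c - int r)))"
  proof (intro sum.cong refl)
    fix m assume "m \<in> {..<d}"
    moreover have "q (- (int r * int m)) * q (int m * int c) = q (int m * (int c - int r))"
      unfolding q_add[symmetric] by (rule arg_cong[of _ _ q]) (simp add: algebra_simps)
    ultimately show "Sbar $$ (r, m) * Smat $$ (m, c) = q (int m * (int c - int r))"
      using rc by (simp add: fourier_q)
  qed
  also have "\<dots> = (if int d dvd int c - int r then of_nat d else 0)" by (rule q_geometric)
  also have "int d dvd int c - int r \<longleftrightarrow> r = c"
    using rc by (auto simp: mod_eq_dvd_iff[symmetric])
  finally show "(Sbar * Smat) $$ (r, c) = (complex_of_nat d \<cdot>\<^sub>m 1\<^sub>m d) $$ (r, c)"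
    using rc by simp
qed auto

lemma delta_nonzero: "delta d \<zeta> \<noteq> 0"
proof
  assume "delta d \<zeta> = 0"
  then have "det (Sbar * Smat) = 0"
    by (subst det_mult[of _ d]) (auto simp: delta_def)
  then show False using d by (simp add: Sbar_S)
qed

text \<open>Multiplying \<open>Smat * adj_mat Smat\<close> on the left by the conjugate matrix gives
  d times the adjugate on one side and the determinant times the conjugate matrix on the
  other.\<close>

lemma cofactor_S:
  assumes "k < d" "k' < d"
  shows "cofactor Smat k k' = delta d \<zeta> * q (- (int k * int k')) / of_nat d"
proof -
  have S: "Smat \<in> carrier_mat d d" and B: "Sbar \<in> carrier_mat d d" by auto
  note adj = adj_mat[OF S]
  have "of_nat d \<cdot>\<^sub>m adj_mat Smat = Sbar * Smat * adj_mat Smat"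
    unfolding Sbar_S using adj(1) by (simp add: mult_smult_assoc_mat[of _ d d _ d])
  also have "\<dots> = delta d \<zeta> \<cdot>\<^sub>m Sbar"
    unfolding assoc_mult_mat[OF B S adj(1)] adj(2) delta_def using B
    by (simp add: mult_smult_distrib[of _ d d _ d])
  finally have "of_nat d * adj_mat Smat $$ (k', k) = delta d \<zeta> * q (- (int k' * int k))"
    using assms adj(1) by (metis (no_types, lifting) B carrier_matD index_smult_mat(1) index_mat(1) prod.case)
  moreover have "adj_mat Smat $$ (k', k) = cofactor Smat k k'"
    using assms by (simp add: adj_mat_def)
  ultimately show ?thesis using d by (simp add: field_simps)
qed

text \<open>Conjugation replaces row r by row -r modulo d, so the determinant changes by the sign of
  a permutation.\<close>

lemma cnj_delta: "cnj (delta d \<zeta>) = delta d \<zeta> \<or> cnj (delta d \<zeta>) = - delta d \<zeta>"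
proof -
  \<comment> \<open>Negation modulo d; the outer \<open>mod\<close> keeps 0 fixed, and the identity
    outside the range makes it a permutation in the sense of \<open>permutes\<close>.\<close>
  define p where "p r = (if r < d then (d - r) mod d else r)" for r
  have pp: "p (p r) = r" for r
    using d by (auto simp: p_def mod_if)
  have pd: "p r < d" if "r < d" for r
    using that by (simp add: p_def)
  have "p permutes {0..<d}"
  proof (rule bij_imp_permutes)
    show "bij_betw p {0..<d} {0..<d}"
      by (intro bij_betwI[of _ _ _ p] Pi_I) (simp_all add: pp pd)
  qed (auto simp: p_def)
  note perm = det_permute_rows[of Smat d p, OF _ this]
  have "cnj (delta d \<zeta>) = det Sbar"
    unfolding delta_def
    by (subst (1 2) det_def'[of _ d])
      (auto simp: fourier_q cnj_q permutes_in_image atLeast0LessThan[symmetric] intro!: sum.cong prod.cong dest: permutes_in_image)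
  also have "Sbar = mat d d (\<lambda>(r, c). Smat $$ (p r, c))"
  proof (rule eq_matI)
    fix r c assume "r < dim_row (mat d d (\<lambda>(r, c). Smat $$ (p r, c)))" "c < dim_col (mat d d (\<lambda>(r, c). Smat $$ (p r, c)))"
    then have rc: "r < d" "c < d" by auto
    have "p r < d" using rc d by (simp add: p_def)
    moreover have "q (- (int r * int c)) = q (int (p r) * int c)"
    proof -
      have "q (int c * (int (d - r) mod int d)) = q (int c * int (d - r))" by (rule q_mod(2))
      also have "\<dots> = q (- (int r * int c))"
        by (rule q_cong) (use rc in \<open>simp add: of_nat_diff algebra_simps\<close>)
      finally show ?thesis using rc by (simp add: p_def zmod_int mult.commute)
    qed
    ultimately show "Sbar $$ (r, c) = mat d d (\<lambda>(r, c). Smat $$ (p r, c)) $$ (r, c)"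
      using rc by (simp add: fourier_q)
  qed auto
  also have "det \<dots> = of_int (sign p) * delta d \<zeta>"
    unfolding delta_def by (rule perm) simp
  finally show ?thesis by (cases p rule: sign_cases) auto
qed

end

section \<open>Comparison of the two data\<close>

text \<open>On the second block the values are all of {..<d} except k. This serves both the
  congruence defining \<open>Psi_sharp\<close> and the exponent in \<open>malle_T\<close>.\<close>

lemma sum_mfun:
  fixes h :: "nat \<Rightarrow> 'a::ab_group_add"
  assumes d: "d \<ge> 2" and k: "k < d"
  shows "(\<Sum>y=0..d. h (mfun d i j k y)) = h i + h j + (\<Sum>v<d. h v) - h k"
proof -
  have "{0..d} = insert 0 (insert 1 {2..d})" using d by auto
  then have "(\<Sum>y=0..d. h (mfun d i j k y)) = h i + (h j + (\<Sum>y\<in>{2..d}. h (mfun d i j k y)))"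
    by (simp add: mfun_def)
  also have "(\<Sum>y\<in>{2..d}. h (mfun d i j k y)) = (\<Sum>x\<in>mfun d i j k ` {2..d}. h x)"
    by (subst sum.reindex) (simp_all add: strict_mono_on_imp_inj_on[OF strict_mono_on_mfun])
  also have "\<dots> = (\<Sum>v<d. h v) - h k"
    using k by (simp add: mfun_image sum_diff1)
  finally show ?thesis by (simp add: algebra_simps)
qed

lemma mfun_0 [simp]: "mfun d i j k 0 = i" and mfun_1 [simp]: "mfun d i j k (Suc 0) = j"
  by (simp_all add: mfun_def)

lemma mod_eq_iff_int_dvd:
  fixes d :: nat
  shows "a mod d = b mod d \<longleftrightarrow> int d dvd int a - int b"
  unfolding mod_eq_dvd_iff[symmetric] zmod_int[symmetric] of_nat_eq_iff ..

text \<open>The sum of the values is i + j - k plus the sum of all residues, and the latter is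
  d(d-1)/2.\<close>

lemma mfun_Psi_sharp:
  assumes d: "d \<ge> 2" and ij: "i < j" "j < d" and k: "k < d"
  shows "mfun d i j k \<in> Psi_sharp d \<longleftrightarrow> k = (i + j) mod d"
proof -
  have P: "mfun d i j k \<in> Psi d" using assms by (intro mfun_Psi)
  have "(\<Sum>v<d. v) = d * (d - 1) div 2" using Sum_Ico_nat[of 0 d] by (simp add: lessThan_atLeast0)
  then have g: "(\<Sum>v<d. int v) = int (d * (d - 1) div 2)"
    unfolding of_nat_sum[symmetric] by (rule arg_cong)
  have e: "int (\<Sum>y=0..d. mfun d i j k y) - int (d * (d - 1) div 2) = int (i + j) - int k"
    using sum_mfun[OF d k, of int i j] g by simp
  have "(\<Sum>y=0..d. mfun d i j k y) mod d = (d * (d - 1) div 2) mod d \<longleftrightarrow> (i + j) mod d = k mod d"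
    unfolding mod_eq_iff_int_dvd e ..
  then show ?thesis unfolding Psi_sharp_def mem_Collect_eq using P k by auto
qed

definition mpair :: "nat \<Rightarrow> nat \<Rightarrow> nat \<Rightarrow> nat \<Rightarrow> nat" where
  "mpair d i j = mfun d i j ((i + j) mod d)"

lemma mpair_Psi_sharp: "d \<ge> 2 \<Longrightarrow> i < j \<Longrightarrow> j < d \<Longrightarrow> mpair d i j \<in> Psi_sharp d"
  unfolding mpair_def by (subst mfun_Psi_sharp) auto

lemma Psi_sharp_cases:
  assumes d: "d \<ge> 2" and f: "f \<in> Psi_sharp d"
  obtains i j where "i < j" "j < d" "f = mpair d i j"
proof -
  have "f \<in> Psi d" using f by (simp add: Psi_sharp_def)
  then obtain i j k where *: "i < j" "j < d" "k < d" "f = mfun d i j k" by (rule Psi_cases[OF d])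
  then have "k = (i + j) mod d" using mfun_Psi_sharp[OF d *(1-3)] f by simp
  then show ?thesis using * that by (simp add: mpair_def)
qed

text \<open>On \<open>Psi_sharp\<close> the exponent is the value omitted on {2..d}, so the power of
  -1 is the share of that row or column in the cofactor sign. The definition thus collects all signs
  that f contributes to \<open>malle_S\<close>, and it is also the test in
  \<open>malle_to_simple\<close>.\<close>

definition msign :: "nat \<Rightarrow> (nat \<Rightarrow> nat) \<Rightarrow> complex" where
  "msign d f = (-1) ^ ((f 0 + f 1) mod d) * eps d f"

lemma eps_cases: "eps d f = 1 \<or> eps d f = -1"
  by (simp add: eps_def minus_one_power_iff)

lemma msign_cases: "msign d f = 1 \<or> msign d f = -1"
  using eps_cases[of d f] by (auto simp: msign_def minus_one_power_iff)

lemma malle_to_simple_mpair: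
  assumes "i < j" "j < d"
  shows "malle_to_simple d (mpair d i j) = (if msign d (mpair d i j) = 1 then (j - i, i) else (d - (j - i), j))"
  using assms by (simp add: malle_to_simple_def msign_def iota_def Let_def mpair_def)

text \<open>Recovers the pair \<open>i < j\<close> from either element of the orbit of \<open>(j - i, i)\<close>.\<close>

definition orbit_pair :: "nat \<Rightarrow> nat \<times> nat \<Rightarrow> nat \<times> nat" where
  "orbit_pair d = (\<lambda>(l, p). if p + l < d then (p, p + l) else (p + l - d, p))"

lemma orbit_pair_mpair:
  assumes "i < j" "j < d"
  shows "orbit_pair d (malle_to_simple d (mpair d i j)) = (i, j)"
  unfolding malle_to_simple_mpair[OF assms] using assms by (auto simp: orbit_pair_def)

lemma orbit_pair_iota:
  assumes "\<kappa> \<in> Lambda_sharp d"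
  shows "orbit_pair d (iota d \<kappa>) = orbit_pair d \<kappa>"
proof -
  obtain l p where \<kappa>: "\<kappa> = (l, p)" by force
  have *: "0 < l" "l < d" "p < d" using assms by (auto simp: \<kappa> Lambda_sharp_def)
  have "(p + l) mod d = (if p + l < d then p + l else p + l - d)"
    using * by (simp add: le_mod_geq)
  then show ?thesis using * by (auto simp: \<kappa> orbit_pair_def iota_def)
qed

lemma orbit_pair_less:
  assumes "\<kappa> \<in> Lambda_sharp d" "orbit_pair d \<kappa> = (i, j)"
  shows "i < j" "j < d" "malle_to_simple d (mpair d i j) \<in> {\<kappa>, iota d \<kappa>}"
proof -
  obtain l p where \<kappa>: "\<kappa> = (l, p)" by force
  have *: "0 < l" "l < d" "p < d" using assms(1) by (auto simp: \<kappa> Lambda_sharp_def)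
  show ij: "i < j" "j < d" using assms(2) * by (auto simp: \<kappa> orbit_pair_def split: if_splits)
  show "malle_to_simple d (mpair d i j) \<in> {\<kappa>, iota d \<kappa>}"
    unfolding malle_to_simple_mpair[OF ij] using assms(2) *
    by (auto simp: \<kappa> orbit_pair_def iota_def mod_if split: if_splits)
qed

lemma malle_to_simple_Lambda:
  assumes "i < j" "j < d"
  shows "malle_to_simple d (mpair d i j) \<in> Lambda_sharp d"
  unfolding malle_to_simple_mpair[OF assms] using assms by (auto simp: Lambda_sharp_def)

text \<open>\<open>orbit_pair\<close> is constant on orbits and recovers (i, j) from the image of
  \<open>mpair d i j\<close>, so each orbit contains exactly one such image.\<close>

lemma malle_orbit_representatives:
  assumes d: "d \<ge> 2"
  shows "orbit_representatives d (malle_to_simple d ` Psi_sharp d)"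
  unfolding orbit_representatives_def
proof (intro conjI ballI)
  show "malle_to_simple d ` Psi_sharp d \<subseteq> Lambda_sharp d"
    using malle_to_simple_Lambda by (auto elim!: Psi_sharp_cases[OF d])
  fix \<kappa> assume \<kappa>: "\<kappa> \<in> Lambda_sharp d"
  obtain i j where ij: "orbit_pair d \<kappa> = (i, j)" by force
  note less = orbit_pair_less[OF \<kappa> ij]
  show "\<exists>!\<mu>. \<mu> \<in> malle_to_simple d ` Psi_sharp d \<and> \<mu> \<in> {\<kappa>, iota d \<kappa>}"
  proof (rule ex1I[of _ "malle_to_simple d (mpair d i j)"])
    show "malle_to_simple d (mpair d i j) \<in> malle_to_simple d ` Psi_sharp d \<and>
        malle_to_simple d (mpair d i j) \<in> {\<kappa>, iota d \<kappa>}"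
      using less mpair_Psi_sharp[OF d less(1,2)] by blast
    fix \<mu> assume \<mu>: "\<mu> \<in> malle_to_simple d ` Psi_sharp d \<and> \<mu> \<in> {\<kappa>, iota d \<kappa>}"
    then obtain i' j' where ij': "i' < j'" "j' < d" "\<mu> = malle_to_simple d (mpair d i' j')"
      by (auto elim!: Psi_sharp_cases[OF d])
    have "orbit_pair d \<mu> = (i, j)" using \<mu> ij orbit_pair_iota[OF \<kappa>] by auto
    then have "(i', j') = (i, j)" using orbit_pair_mpair[OF ij'(1,2)] ij'(3) by simp
    then show "\<mu> = malle_to_simple d (mpair d i j)" using ij'(3) by simp
  qed
qed

lemma malle_to_simple_inj:
  assumes d: "d \<ge> 2"
  shows "inj_on (malle_to_simple d) (Psi_sharp d)"
proof (rule inj_onI)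
  fix f g assume f: "f \<in> Psi_sharp d" and g: "g \<in> Psi_sharp d" and eq: "malle_to_simple d f = malle_to_simple d g"
  obtain i j where ij: "i < j" "j < d" "f = mpair d i j" using f by (rule Psi_sharp_cases[OF d])
  obtain i' j' where ij': "i' < j'" "j' < d" "g = mpair d i' j'" using g by (rule Psi_sharp_cases[OF d])
  have "(i, j) = orbit_pair d (malle_to_simple d f)" unfolding ij(3) by (rule orbit_pair_mpair[OF ij(1,2), symmetric])
  also have "\<dots> = (i', j')" unfolding eq unfolding ij'(3) by (rule orbit_pair_mpair[OF ij'(1,2)])
  finally show "f = g" unfolding ij(3) ij'(3) by simp
qed

lemma sum_symmetric:
  fixes w :: "nat \<Rightarrow> nat \<Rightarrow> complex"
  assumes "\<And>i j. w i j = w j i" "\<And>i. w i i = 0"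
  shows "(\<Sum>i<n. \<Sum>j<n. w i j) = 2 * (\<Sum>j<n. \<Sum>i<j. w i j)"
proof (induction n)
  case (Suc n)
  have "(\<Sum>j<n. w n j) = (\<Sum>i<n. w i n)" by (intro sum.cong refl assms)
  then show ?case using Suc assms(2) by (simp add: sum.distrib)
qed simp

lemma prod_powi:
  assumes "(z :: complex) \<noteq> 0" "finite A"
  shows "(\<Prod>y\<in>A. z powi e y) = z powi (\<Sum>y\<in>A. e y)"
  using assms(2) by (induction A rule: finite_induct) (simp_all add: power_int_add assms(1))

lemma sum_squares_lessThan: "6 * (\<Sum>v<n. int v * int v) = int n * (int n - 1) * (2 * int n - 1)"
  by (induction n) (simp_all add: algebra_simps)

lemma sum_lessThan_int: "2 * (\<Sum>v<n. int v) = int n * (int n - 1)"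
  by (induction n) (simp_all add: algebra_simps)

context taft
begin

section \<open>Entries of the two S-matrices\<close>

lemma malle_S_mpair:
  assumes ij: "i < j" "j < d" and ij': "i' < j'" "j' < d"
  shows "malle_S d \<zeta> (mpair d i j) (mpair d i' j') =
    (-1) ^ (d - 1) * (cnj (delta d \<zeta>) / delta d \<zeta>) * msign d (mpair d i j) * msign d (mpair d i' j') *
    (q (int i * int j' + int j * int i') - q (int i * int i' + int j * int j')) / of_nat d"
proof -
  define k where "k = (i + j) mod d" define k' where "k' = (i' + j') mod d"
  have kd: "k < d" "k' < d" using d by (auto simp: k_def k'_def)
  let ?f = "mfun d i j k" and ?g = "mfun d i' j' k'"
  have fg: "mpair d i j = ?f" "mpair d i' j' = ?g" by (simp_all add: mpair_def k_def k'_def)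
  have m: "det (mat_delete Smat k k') = (-1) ^ (k + k') * cofactor Smat k k'"
    by (simp add: cofactor_def flip: mult.assoc power_add) (simp add: power_add)?
  \<comment> \<open>The residues k' and k are replaced by the actual sums one after the other, each
    time by periodicity of q.\<close>
  have kk: "q (- (int k * int k')) = q (- ((int i + int j) * (int i' + int j')))"
  proof -
    have "q (- (int k * int k')) = q (- int k * (int (i' + j') mod int d))" by (simp add: k'_def zmod_int)
    also have "\<dots> = q (- int k * int (i' + j'))" by (rule q_mod(2))
    also have "- int k * int (i' + j') = - int (i' + j') * (int (i + j) mod int d)"
      unfolding k_def zmod_int by (simp only: mult_minus_left mult.commute)
    also have "q \<dots> = q (- int (i' + j') * int (i + j))" by (rule q_mod(2))
    finally show ?thesis by (simp add: algebra_simps)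
  qed
  have "wedge_S d \<zeta> ?f ?g = wedge_minor d \<zeta> ?f ?g"
    using d ij ij' kd by (intro wedge_S_eq mfun_Psi)
  also have "\<dots> = (q (int i * int i' + int j * int j') - q (int i * int j' + int j * int i')) *
      ((-1) ^ (k + k') * (delta d \<zeta> * q (- ((int i + int j) * (int i' + int j'))) / of_nat d))"
    unfolding wedge_minor_mfun[OF d] m cofactor_S[OF kd] kk fourier_q q_add ..
  also have "\<dots> = (-1) ^ (k + k') * delta d \<zeta> *
     (q (- (int i * int j' + int j * int i')) - q (- (int i * int i' + int j * int j'))) / of_nat d"
  proof -
    have "q (int i * int i' + int j * int j') * q (- ((int i + int j) * (int i' + int j'))) = q (- (int i * int j' + int j * int i'))"
      "q (int i * int j' + int j * int i') * q (- ((int i + int j) * (int i' + int j'))) = q (- (int i * int i' + int j * int j'))"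
      unfolding q_add[symmetric] by (rule arg_cong[of _ _ q], simp add: algebra_simps)+
    note * = this
    have "(A - B) * (s * (D * Q / n)) = s * D * (A * Q - B * Q) / n" for A B s D Q n :: complex
      by (simp add: algebra_simps)
    then show ?thesis unfolding * by (simp only: *)
  qed
  finally have w: "wedge_S d \<zeta> ?f ?g = (-1) ^ (k + k') * delta d \<zeta> *
     (q (- (int i * int j' + int j * int i')) - q (- (int i * int i' + int j * int j'))) / of_nat d" .
  have s: "msign d ?f = (-1) ^ k * eps d ?f" "msign d ?g = (-1) ^ k' * eps d ?g"
    by (simp_all add: msign_def k_def k'_def)
  show ?thesis
    unfolding fg malle_S_def w s by (simp add: cnj_q power_add add.commute)
qed

text \<open>The trace of the double braiding multiplied by 1 - \<zeta>^-1. Integer arguments allow l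
  to be replaced by a difference of either sign in its class modulo d.\<close>

definition Sval :: "int \<Rightarrow> int \<Rightarrow> int \<Rightarrow> int \<Rightarrow> complex" where
  "Sval l p l' p' = q (- (2 * p * p' + l * p' + p * l')) * (1 - q (- (l * l')))"

text \<open>No order between a and b is assumed: exchanging them is the effect of \<iota>, and the
  right side visibly changes sign.\<close>

lemma Sval_eq:
  assumes "int d dvd l - (b - a)" "int d dvd l' - (b' - a')"
  shows "Sval l a l' a' = q (- (a * b' + b * a')) - q (- (a * a' + b * b'))"
proof -
  have 1: "q (- (2 * a * a' + l * a' + a * l')) = q (- (a * b' + b * a'))"
  proof (rule q_cong)
    have "- (2 * a * a' + l * a' + a * l') - - (a * b' + b * a') = (l - (b - a)) * - a' + (l' - (b' - a')) * - a"
      by (simp add: algebra_simps)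
    then show "int d dvd - (2 * a * a' + l * a' + a * l') - - (a * b' + b * a')"
      using assms by (metis dvd_add dvd_mult2)
  qed
  have 2: "q (- (2 * a * a' + l * a' + a * l')) * q (- (l * l')) = q (- (a * a' + b * b'))"
    unfolding 1 q_add[symmetric]
  proof (rule q_cong)
    have "- (a * b' + b * a') + - (l * l') - - (a * a' + b * b') = (l - (b - a)) * - l' + (l' - (b' - a')) * - (b - a)"
      by (simp add: algebra_simps)
    then show "int d dvd - (a * b' + b * a') + - (l * l') - - (a * a' + b * b')"
      using assms by (metis dvd_add dvd_mult2)
  qed
  show ?thesis unfolding Sval_def right_diff_distrib 2 unfolding 1 by simp
qed

lemma stab_S_value:
  assumes l: "0 < l" "l < d" "0 < l'" "l' < d"
  shows "stab_S d \<zeta> \<E> (l, p) (l', p') =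
    Sval (int l) (int p) (int l') (int p') / (1 - q (- 1)) / csqrt (stab_dim d \<zeta> \<E>)"
proof -
  let ?M = "V l p" and ?N = "V l' p'"
  have "1 - q (- 1) \<noteq> 0" using \<zeta>_neq_1 by (simp add: q_minus q_1)
  then have "Tr_plus d (MN l p l' p') (braiding d \<zeta> ?N ?M * braiding d \<zeta> ?M ?N) =
      Sval (int l) (int p) (int l') (int p') / (1 - q (- 1))"
    using Tr_plus_double_braiding[OF l, of p p'] by (simp add: Sval_def field_simps)
  then show ?thesis
    unfolding stab_S_def Let_def stab_braiding_def
    by (simp only: stab_Tr_plus_comp[OF d \<zeta> tensor_simple_carrier tensor_simple_carrier braiding_hom[OF l(2)] braiding_hom[OF l(4)]])
qed

text \<open>Both cases have one shape: p is a member of the pair and l is congruent to the other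
  member minus p. This is the form needed for \<open>Sval_eq\<close>.\<close>

lemma malle_to_simple_coordinates:
  assumes ij: "i < j" "j < d"
  obtains l p where "malle_to_simple d (mpair d i j) = (l, p)" "0 < l" "l < d"
    "msign d (mpair d i j) = 1 \<and> int p = int i \<and> int d dvd int l - (int j - int i) \<or>
     msign d (mpair d i j) = - 1 \<and> int p = int j \<and> int d dvd int l - (int i - int j)"
proof (cases "msign d (mpair d i j) = 1")
  case True
  then show ?thesis using ij that[of "j - i" i] by (simp add: malle_to_simple_mpair of_nat_diff)
next
  case False
  then have "msign d (mpair d i j) = - 1" using msign_cases by blast
  then show ?thesis using ij that[of "d - (j - i)" j] by (simp add: malle_to_simple_mpair of_nat_diff)
qed

lemma stab_S_mpair:
  assumes ij: "i < j" "j < d" and ij': "i' < j'" "j' < d"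
  shows "stab_S d \<zeta> \<E> (malle_to_simple d (mpair d i j)) (malle_to_simple d (mpair d i' j')) =
    msign d (mpair d i j) * msign d (mpair d i' j') *
    (q (- (int i * int j' + int j * int i')) - q (- (int i * int i' + int j * int j'))) / (1 - q (- 1)) / csqrt (stab_dim d \<zeta> \<E>)"
proof -
  let ?e = "msign d (mpair d i j)" and ?e' = "msign d (mpair d i' j')"
  obtain l p where 1: "malle_to_simple d (mpair d i j) = (l, p)" "0 < l" "l < d"
    "?e = 1 \<and> int p = int i \<and> int d dvd int l - (int j - int i) \<or>
     ?e = - 1 \<and> int p = int j \<and> int d dvd int l - (int i - int j)"
    using malle_to_simple_coordinates[OF ij] by blast
  obtain l' p' where 2: "malle_to_simple d (mpair d i' j') = (l', p')" "0 < l'" "l' < d"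
    "?e' = 1 \<and> int p' = int i' \<and> int d dvd int l' - (int j' - int i') \<or>
     ?e' = - 1 \<and> int p' = int j' \<and> int d dvd int l' - (int i' - int j')"
    using malle_to_simple_coordinates[OF ij'] by blast
  have "Sval (int l) (int p) (int l') (int p') = ?e * ?e' *
    (q (- (int i * int j' + int j * int i')) - q (- (int i * int i' + int j * int j')))"
    using 1(4) 2(4)
  proof (elim disjE conjE)
    assume "?e = 1" "int p = int i" "int d dvd int l - (int j - int i)"
      "?e' = 1" "int p' = int i'" "int d dvd int l' - (int j' - int i')"
    then show ?thesis using Sval_eq[of "int l" "int j" "int i" "int l'" "int j'" "int i'"] by simp
  next
    assume "?e = 1" "int p = int i" "int d dvd int l - (int j - int i)"
      "?e' = - 1" "int p' = int j'" "int d dvd int l' - (int i' - int j')"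
    then show ?thesis using Sval_eq[of "int l" "int j" "int i" "int l'" "int i'" "int j'"] by (simp add: add.commute)
  next
    assume "?e = - 1" "int p = int j" "int d dvd int l - (int i - int j)"
      "?e' = 1" "int p' = int i'" "int d dvd int l' - (int j' - int i')"
    then show ?thesis using Sval_eq[of "int l" "int i" "int j" "int l'" "int j'" "int i'"] by (simp add: add.commute)
  next
    assume "?e = - 1" "int p = int j" "int d dvd int l - (int i - int j)"
      "?e' = - 1" "int p' = int j'" "int d dvd int l' - (int i' - int j')"
    then show ?thesis using Sval_eq[of "int l" "int i" "int j" "int l'" "int i'" "int j'"] by (simp add: add.commute)
  qed
  then show ?thesis unfolding 1(1) 2(1) stab_S_value[OF 1(2,3) 2(2,3)] by simp
qed

section \<open>The dimension of the category and the comparison factor\<close>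

lemma dims_simple:
  assumes l: "0 < l"
  shows "(1 - q 1) * (1 - q (- 1)) * (stab_dim_minus d \<zeta> (V l p) * stab_dim_plus d \<zeta> (V l p)) =
    2 - q (int l) - q (- int l)"
proof -
  have "(\<Sum>a<l. q (- (int p + int a))) = q (- int p) * (\<Sum>a<l. q (- 1 * int a))"
    unfolding sum_distrib_left q_add[symmetric] by simp
  moreover have "(\<Sum>a<l. q (int p + int a)) = q (int p) * (\<Sum>a<l. q (1 * int a))"
    unfolding sum_distrib_left q_add[symmetric] by simp
  ultimately have "(1 - q 1) * (1 - q (- 1)) * (stab_dim_minus d \<zeta> (V l p) * stab_dim_plus d \<zeta> (V l p)) =
     (q (int p) * q (- int p)) * (((1 - q 1) * (\<Sum>a<l. q (1 * int a))) * ((1 - q (- 1)) * (\<Sum>a<l. q (- 1 * int a))))"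
    unfolding stab_dim_minus_eq[OF d \<zeta> simple_carrier] stab_dim_plus_eq[OF d \<zeta> simple_carrier] rdim_simple
      Tr_plus_one[OF l] Tr_minus_one[OF l] by (simp only: mult_ac)
  also have "\<dots> = (q (int p) * q (- int p)) * ((1 - q (int l)) * (1 - q (- int l)))"
    unfolding q_sum by simp
  also have "\<dots> = 2 - q (int l) - q (- int l)"
    by (simp add: q_minus algebra_simps)
  finally show ?thesis .
qed

lemma norm_1_minus_\<zeta>: "(1 - q 1) * (1 - q (- 1)) = of_real ((norm (1 - \<zeta>))\<^sup>2)"
  unfolding complex_norm_square using cnj_q[of 1] by (simp add: q_1)

text \<open>After multiplication by |1 - \<zeta>|^2 the pair i < j contributes |\<zeta>^i -
  \<zeta>^j|^2. This is symmetric and zero on the diagonal, so the sum is half the sum over all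
  pairs, where orthogonality leaves only the constant 2.\<close>

lemma stab_dim_malle:
  "csqrt (stab_dim d \<zeta> (malle_to_simple d ` Psi_sharp d)) = of_nat d / of_real (norm (1 - \<zeta>))"
proof -
  let ?D = "\<lambda>\<kappa>. stab_dim_minus d \<zeta> (simple_rep \<zeta> \<kappa>) * stab_dim_plus d \<zeta> (simple_rep \<zeta> \<kappa>)"
  let ?N = "norm (1 - \<zeta>)"
  \<comment> \<open>The larger index comes first, so that the range of the smaller one depends on
    it.\<close>
  let ?P = "SIGMA j:{..<d}. {..<j}"
  define c where "c = complex_of_real (?N\<^sup>2)"
  define w where "w i j = 2 - q (int j - int i) - q (int i - int j)" for i j
  have im: "malle_to_simple d ` Psi_sharp d = (\<lambda>(j, i). malle_to_simple d (mpair d i j)) ` ?P"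
    using mpair_Psi_sharp[OF d] by (force elim!: Psi_sharp_cases[OF d])
  have inj: "inj_on (\<lambda>(j, i). malle_to_simple d (mpair d i j)) ?P"
  proof (rule inj_onI, clarify)
    fix i j i' j' assume "j < d" "i < j" "j' < d" "i' < j'"
      "malle_to_simple d (mpair d i j) = malle_to_simple d (mpair d i' j')"
    then show "j = j' \<and> i = i'" using orbit_pair_mpair[of i j d] orbit_pair_mpair[of i' j' d] by (metis prod.inject)
  qed
  have D: "c * ?D (malle_to_simple d (mpair d i j)) = w i j" if ij: "i < j" "j < d" for i j
  proof -
    obtain l p where 1: "malle_to_simple d (mpair d i j) = (l, p)" "0 < l"
      "int d dvd int l - (int j - int i) \<or> int d dvd int l - (int i - int j)"
      using malle_to_simple_coordinates[OF ij] by blast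
    have m: "q (int l) = q x \<and> q (- int l) = q (- x)" if "int d dvd int l - x" for x
      using that q_cong[OF that] by (simp add: q_minus)
    have "2 - q (int l) - q (- int l) = w i j"
      using 1(3) m[of "int j - int i"] m[of "int i - int j"] by (auto simp: w_def algebra_simps)
    then show ?thesis
      unfolding 1(1) c_def norm_1_minus_\<zeta>[symmetric] dims_simple[OF 1(2)] .
  qed
  have zero: "(\<Sum>j<d. q (int j - x)) = 0" "(\<Sum>j<d. q (x - int j)) = 0" for x
  proof -
    have n: "\<not> int d dvd 1" "\<not> int d dvd - 1" using d by auto
    have "(\<Sum>j<d. q (int j - x)) = q (- x) * (\<Sum>j<d. q (int j * 1))"
      unfolding sum_distrib_left q_add[symmetric] by simp
    then show "(\<Sum>j<d. q (int j - x)) = 0" unfolding q_geometric using n by simp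
    have "(\<Sum>j<d. q (x - int j)) = q x * (\<Sum>j<d. q (int j * - 1))"
      unfolding sum_distrib_left q_add[symmetric] by simp
    then show "(\<Sum>j<d. q (x - int j)) = 0" unfolding q_geometric using n by simp
  qed
  have "2 * (c * stab_dim d \<zeta> (malle_to_simple d ` Psi_sharp d)) = 2 * (\<Sum>j<d. \<Sum>i<j. w i j)"
    unfolding stab_dim_def im sum.reindex[OF inj] sum_distrib_left
    by (subst sum.Sigma) (auto simp: D intro!: sum.cong)
  also have "\<dots> = (\<Sum>i<d. \<Sum>j<d. w i j)"
    by (rule sum_symmetric[symmetric]) (simp_all add: w_def)
  also have "\<dots> = 2 * (of_nat d)\<^sup>2"
    by (simp add: w_def sum_subtractf zero power2_eq_square)
  finally have "c * stab_dim d \<zeta> (malle_to_simple d ` Psi_sharp d) = (of_nat d)\<^sup>2" by simp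
  moreover have N: "?N > 0" using \<zeta>_neq_1 by simp
  ultimately have "stab_dim d \<zeta> (malle_to_simple d ` Psi_sharp d) = of_real ((real d / ?N)\<^sup>2)"
    by (simp add: c_def field_simps)
  moreover have "csqrt (of_real ((real d / ?N)\<^sup>2)) = of_real (real d / ?N)"
    using N by (subst csqrt_of_real_nonneg) simp_all
  ultimately show ?thesis by simp
qed

text \<open>The ratio of the two normalizations: the determinant and sign come from
  \<open>malle_S\<close> after conjugation, 1 - \<zeta> from the conjugated denominator of the
  trace, and |1 - \<zeta>| from the root of the dimension; the factors d cancel.\<close>

definition S_factor :: complex where
  "S_factor = (-1) ^ (d - 1) * (cnj (delta d \<zeta>) / delta d \<zeta>) * (1 - q 1) / of_real (norm (1 - \<zeta>))"

text \<open>Both signs square to 1, and (1 - \<zeta>)^2 / |1 - \<zeta>|^2 = (1 - \<zeta>) / (1 -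
  \<zeta>^-1) = -\<zeta>. The exponent 4d therefore works for every parity of d.\<close>

lemma S_factor_root: "root_of_unity S_factor"
proof -
  have N: "norm (1 - \<zeta>) \<noteq> 0" using \<zeta>_neq_1 by simp
  have z: "1 - q 1 \<noteq> 0" "1 - q (- 1) \<noteq> 0" using \<zeta>_neq_1 by (simp_all add: q_minus q_1)
  have "((-1) ^ (d - 1))\<^sup>2 = (1 :: complex)" by (simp flip: power_mult)
  moreover have "(cnj (delta d \<zeta>) / delta d \<zeta>)\<^sup>2 = 1"
    using cnj_delta delta_nonzero by (auto simp: power_divide)
  ultimately have "S_factor\<^sup>2 = (1 - q 1)\<^sup>2 / of_real ((norm (1 - \<zeta>))\<^sup>2)"
    unfolding S_factor_def by (simp add: power_mult_distrib power_divide)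
  also have "\<dots> = (1 - q 1) / (1 - q (- 1))"
    unfolding norm_1_minus_\<zeta>[symmetric] using z by (simp add: power2_eq_square)
  also have "\<dots> = - \<zeta>"
    using z by (simp add: divide_eq_eq q_minus q_1 algebra_simps)
  finally have "S_factor\<^sup>2 = - \<zeta>" .
  then have "S_factor ^ (2 * (2 * d)) = (- \<zeta>) ^ (2 * d)" unfolding power_mult[of S_factor 2] by simp
  also have "\<dots> = \<zeta> ^ (d * 2)" by (simp add: power_minus' mult.commute)
  also have "\<dots> = 1" unfolding power_mult \<zeta>_pow_d by simp
  finally show ?thesis unfolding root_of_unity_def using d by (intro exI[of _ "2 * (2 * d)"]) auto
qed

lemma malle_S_stab_S:
  assumes f: "f \<in> Psi_sharp d" and g: "g \<in> Psi_sharp d"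
  shows "malle_S d \<zeta> f g =
    S_factor * cnj (stab_S d \<zeta> (malle_to_simple d ` Psi_sharp d) (malle_to_simple d f) (malle_to_simple d g))"
proof -
  obtain i j where ij: "i < j" "j < d" "f = mpair d i j" using f by (rule Psi_sharp_cases[OF d])
  obtain i' j' where ij': "i' < j'" "j' < d" "g = mpair d i' j'" using g by (rule Psi_sharp_cases[OF d])
  have c: "cnj (msign d h) = msign d h" for h using msign_cases[of d h] by auto
  have z: "1 - q 1 \<noteq> 0" "norm (1 - \<zeta>) \<noteq> 0" using \<zeta>_neq_1 by (simp_all add: q_1)
  let ?e = "msign d f * (msign d g * (q (int i * int j' + int j * int i') - q (int i * int i' + int j * int j')))"
  have S: "cnj (stab_S d \<zeta> (malle_to_simple d ` Psi_sharp d) (malle_to_simple d f) (malle_to_simple d g)) =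
      ?e / (1 - q 1) / (of_nat d / of_real (norm (1 - \<zeta>)))"
    unfolding ij(3) ij'(3) stab_S_mpair[OF ij(1,2) ij'(1,2)] stab_dim_malle by (simp add: cnj_q c add.commute)
  have "A * B / n = A * z / N * (B / z / (n / N))" if "z \<noteq> 0" "N \<noteq> 0" for A B n z N :: complex
    using that by (simp add: field_simps)
  from this[of "1 - q 1" "of_real (norm (1 - \<zeta>))" "(-1) ^ (d - 1) * (cnj (delta d \<zeta>) / delta d \<zeta>)" ?e "of_nat d"] z
  have "(-1) ^ (d - 1) * (cnj (delta d \<zeta>) / delta d \<zeta>) * ?e / of_nat d =
      S_factor * cnj (stab_S d \<zeta> (malle_to_simple d ` Psi_sharp d) (malle_to_simple d f) (malle_to_simple d g))"
    unfolding S S_factor_def by simp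
  then show ?thesis
    unfolding ij(3) ij'(3) malle_S_mpair[OF ij(1,2) ij'(1,2)] by (simp only: mult.assoc)
qed

lemma malle_T_stab_T:
  assumes \<zeta>s: "primitive_root_of_unity (12 * d) \<zeta>s" "\<zeta>s ^ 12 = \<zeta>"
    and f: "f \<in> Psi_sharp d" and g: "g \<in> Psi_sharp d"
  shows "malle_T d \<zeta>s f g = cnj (stab_T d \<zeta> (malle_to_simple d f) (malle_to_simple d g))"
proof (cases "f = g")
  case False
  then have "malle_to_simple d f \<noteq> malle_to_simple d g" using malle_to_simple_inj[OF d] f g by (auto dest: inj_onD)
  then show ?thesis using False by (simp add: malle_T_def stab_T_def)
next
  case True
  obtain i j where ij: "i < j" "j < d" "f = mpair d i j" using f by (rule Psi_sharp_cases[OF d])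
  obtain l p where 1: "malle_to_simple d (mpair d i j) = (l, p)" "0 < l" "l < d"
    "int p = int i \<and> int d dvd int l - (int j - int i) \<or> int p = int j \<and> int d dvd int l - (int i - int j)"
    using malle_to_simple_coordinates[OF ij(1,2)] by blast
  \<comment> \<open>Both members of the orbit give i j modulo d: i(i + (j - i)) and j(j + (i -
    j)).\<close>
  have "q (int p * (int p + int l)) = q (int i * int j)"
  proof (rule q_cong)
    from 1(4) show "int d dvd int p * (int p + int l) - int i * int j"
    proof (elim disjE conjE)
      assume p: "int p = int i" and l: "int d dvd int l - (int j - int i)"
      have "int p * (int p + int l) - int i * int j = int i * (int l - (int j - int i))"
        unfolding p by (simp add: algebra_simps)
      then show ?thesis using l by (simp only: dvd_mult)
    next
      assume p: "int p = int j" and l: "int d dvd int l - (int i - int j)"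
      have "int p * (int p + int l) - int i * int j = int j * (int l - (int i - int j))"
        unfolding p by (simp add: algebra_simps)
      then show ?thesis using l by (simp only: dvd_mult)
    qed
  qed
  then have "cnj (stab_T d \<zeta> (l, p) (l, p)) = q (int i * int j)"
    by (simp add: stab_T_simple[OF 1(2,3)] cnj_q)
  moreover have "malle_T d \<zeta>s f f = q (int i * int j)"
  proof -
    define k where "k = (i + j) mod d"
    \<comment> \<open>The carry in i + j = k + m d; its contributions to the exponent turn out to be
      multiples of 12 d.\<close>
    define m where "m = int ((i + j) div d)"
    have kd: "k < d" using d by (simp add: k_def)
    have z0: "\<zeta>s \<noteq> 0" using \<zeta>s(2) by auto
    define h where "h v = - 6 * (int v ^ 2 + int d * int v)" for v
    have "malle_T d \<zeta>s f f = \<zeta>s powi (int d * (1 - int d ^ 2)) * \<zeta>s powi (\<Sum>y=0..d. h (f y))"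
      unfolding malle_T_def h_def using z0 by (subst prod_powi) auto
    also have "(\<Sum>y=0..d. h (f y)) = h i + h j + (\<Sum>v<d. h v) - h k"
      unfolding ij(3) mpair_def k_def[symmetric] by (rule sum_mfun[OF d kd])
    also have "\<zeta>s powi (int d * (1 - int d ^ 2)) * \<zeta>s powi (h i + h j + (\<Sum>v<d. h v) - h k) =
        \<zeta>s powi (int d * (1 - int d ^ 2) + (h i + h j + (\<Sum>v<d. h v) - h k))"
      using z0 by (simp add: power_int_add)
    also have "int d * (1 - int d ^ 2) + (h i + h j + (\<Sum>v<d. h v) - h k) =
        12 * (int i * int j) + int (12 * d) * (- (\<Sum>v<d. int v) - m * (int i + int j) + int d * (m * (m - 1) div 2))"
    proof -
      have "int k = int i + int j - m * int d"
        unfolding k_def m_def by (simp add: zmod_int zdiv_int minus_mult_div_eq_mod[symmetric] mult.commute)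
      moreover have "2 * (m * (m - 1) div 2) = m * (m - 1)" by simp
      moreover have "(\<Sum>v<d. h v) = - (6 * (\<Sum>v<d. int v * int v)) - 6 * int d * (\<Sum>v<d. int v)"
      proof -
        have "(\<Sum>v<d. h v) = (\<Sum>v<d. (- 6) * (int v * int v) + (- 6 * int d) * int v)"
          by (simp add: h_def power2_eq_square algebra_simps)
        then show ?thesis by (simp only: sum.distrib sum_distrib_left[symmetric])
      qed
      moreover note sum_squares_lessThan[of d] sum_lessThan_int[of d]
      \<comment> \<open>T is d(d-1)/2 and C is m(m-1)/2. In terms of them, d(1 - d^2) plus the sum
        over all residues is -12 d T, and the quadratic terms in m give 12 d times d C, so only 12 i
        j remains modulo 12 d.\<close>
      moreover define T where "T = (\<Sum>v<d. int v)" moreover define C where "C = m * (m - 1) div 2"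
      ultimately have "(\<Sum>v<d. h v) = - (int d * (int d - 1) * (2 * int d - 1)) - 6 * int d * T"
        and T: "2 * T = int d * (int d - 1)" and C: "2 * C = m * (m - 1)" and k: "int k = int i + int j - m * int d"
        by simp_all
      then have "int d * (1 - int d ^ 2) + (h i + h j + (\<Sum>v<d. h v) - h k) =
          12 * (int i * int j) - 6 * int d * (int d * (int d - 1)) + 3 * int d * (int d * (int d - 1)) - 6 * int d * T
           - 12 * int d * m * (int i + int j) + 6 * int d * int d * (m * (m - 1))"
        by (simp add: h_def k power2_eq_square algebra_simps)
      also have "\<dots> = 12 * (int i * int j) + int (12 * d) * (- T - m * (int i + int j) + int d * C)"
        unfolding T[symmetric] C[symmetric] by (simp add: algebra_simps)
      finally show ?thesis by (simp add: T_def C_def)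
    qed
    also have "\<zeta>s powi (12 * (int i * int j) + int (12 * d) * n) = q (int i * int j)" for n
    proof -
      have a: "\<zeta>s powi int (12 * d) = 1"
        unfolding power_int_of_nat using \<zeta>s(1) by (simp add: primitive_root_of_unity_def)
      have b: "\<zeta>s powi 12 = \<zeta>" using \<zeta>s(2) by simp
      have "\<zeta>s powi (12 * (int i * int j) + int (12 * d) * n) = \<zeta>s powi (12 * (int i * int j)) * \<zeta>s powi (int (12 * d) * n)"
        by (rule power_int_add) (simp add: z0)
      also have "\<dots> = q (int i * int j)"
        unfolding power_int_mult[of \<zeta>s 12] power_int_mult[of \<zeta>s "int (12 * d)"] a b by (simp add: q_def)
      finally show ?thesis .
    qed
    finally show ?thesis .
  qed
  ultimately show ?thesis using True ij(3) 1(1) by simp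
qed

end

theorem theorem7p8:
  fixes d :: nat and \<zeta> \<zeta>s :: complex
  assumes "d \<ge> 2"
    and "primitive_root_of_unity d \<zeta>"
    and "primitive_root_of_unity (12 * d) \<zeta>s"
    and "\<zeta>s ^ 12 = \<zeta>"
  shows "\<exists>\<E> \<omega>. orbit_representatives d \<E> \<and> root_of_unity \<omega> \<and>
    bij_betw (malle_to_simple d) (Psi_sharp d) \<E> \<and>
    (\<forall>f\<in>Psi_sharp d. \<forall>g\<in>Psi_sharp d.
       malle_S d \<zeta> f g =
         \<omega> * cnj (stab_S d \<zeta> \<E> (malle_to_simple d f) (malle_to_simple d g)) \<and>
       malle_T d \<zeta>s f g =
         cnj (stab_T d \<zeta> (malle_to_simple d f) (malle_to_simple d g)))"
proof -
  interpret taft d \<zeta> by unfold_locales (fact assms)+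
  show ?thesis
  proof (intro exI conjI ballI)
    show "orbit_representatives d (malle_to_simple d ` Psi_sharp d)"
      by (rule malle_orbit_representatives[OF d])
    show "root_of_unity S_factor" by (rule S_factor_root)
    show "bij_betw (malle_to_simple d) (Psi_sharp d) (malle_to_simple d ` Psi_sharp d)"
      by (rule inj_on_imp_bij_betw[OF malle_to_simple_inj[OF d]])
  next
    fix f g assume "f \<in> Psi_sharp d" "g \<in> Psi_sharp d"
    then show "malle_S d \<zeta> f g =
        S_factor * cnj (stab_S d \<zeta> (malle_to_simple d ` Psi_sharp d) (malle_to_simple d f) (malle_to_simple d g))"
      and "malle_T d \<zeta>s f g = cnj (stab_T d \<zeta> (malle_to_simple d f) (malle_to_simple d g))"
      by (rule malle_S_stab_S, rule malle_T_stab_T[OF assms(3,4)])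
  qed
qed

end
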